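(* Let $Q\subseteq\mathbb{R}^m$ be a closed set, let $g_1,\ldots,g_s\in\mathbb{R}[\mathrm{x},\mathrm{y}]$, $g_0:=1$, and let $K=\{x\in\mathbb{R}^n : g_1(x,y)\ge 0,\ldots,g_s(x,y)\ge 0\ \ \forall y\in Q\}$. Let $\nu$ be a nonnegative Borel measure on $\mathbb{R}^m$ with $\operatorname{supp}(\nu)=Q$ satisfying the multivariate Carleman condition. Let $c_{eq}=(c_i)_{i\in\mathcal{I}}$ and $c_{in}=(c_j)_{j\in\mathcal{J}}$ be finite tuples of polynomials in $\mathbb{R}[\mathrm{x}]$ (with $\mathcal{I},\mathcal{J}$ disjoint finite index sets), let $X=\{x\in\mathbb{R}^n: c_i(x)=0\ (i\in\mathcal{I}),\ c_j(x)\ge0\ (j\in\mathcal{J})\}$, and let $f\in\mathbb{R}[\mathrm{x}]$. Let $f_{\min}$ be the optimal value of the semi-infinite program of minimizing $f(x)$ over $x\in X$ subject to $g_j(x,y)\ge0$ for all $y\in Q$ and $j=1,\ldots,s$ (that is, over $x\in X\cap K$). Assume that $\operatorname{QM}[g,\nu]+\operatorname{Ideal}[c_{eq}]+\operatorname{QM}[c_{in}]$ is archimedean. For each $k$ let $\gamma_k$ be the optimal value of $$\left\{\begin{array}{rl}\min & \sum_\alpha f_\alpha w_\alpha\\ \text{s.t.} & \mathscr{V}^{(2k)}_{c_i}[w]=0\ (i\in\mathcal{I}),\\ & \mathrm{L}^{(k)}_{c_j}[w]\succeq0\ (j\in\mathcal{J}),\\ & \mathrm{L}^{(k,k)}_{\nu,g_j}[w]\succeq0\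 (j=0,1,\ldots,s),\\ & w_0=1,\quad w\in\mathbb{R}^{\mathbb{N}^n_{2k}},\end{array}\right.$$ where $f=\sum_\alpha f_\alpha\mathrm{x}^\alpha$. Then the sequence $(\gamma_k)_k$ is monotonically increasing and $\gamma_k\to f_{\min}$ as $k\to\infty$.
   Context: Here $\mathrm{x}=(\mathrm{x}_1,\ldots,\mathrm{x}_n)$ and $\mathrm{y}=(\mathrm{y}_1,\ldots,\mathrm{y}_m)$ are tuples of variables; $\mathbb{N}$ is the set of nonnegative integers and $\mathbb{N}^n_d=\{\alpha\in\mathbb{N}^n:\alpha_1+\cdots+\alpha_n\le d\}$. All measures are finite, and $\nu$ has finite moments of all orders. The measure $\nu$ satisfies the multivariate Carleman condition if $\sum_{d=1}^\infty\big(\int y_j^{2d}\,d\nu(y)\big)^{-\frac{1}{2d}}=\infty$ for $j=1,\ldots,m$ (a term with zero moment is read as $+\infty$). $\Sigma^2[\cdot]$ denotes the cone of sums of squares of polynomials in the indicated variables. Define $$\operatorname{QM}[g,\nu]:=\Big\{\sum_{j=0}^s\int \tau_j(\mathrm{x},y)g_j(\mathrm{x},y)\,d\nu(y)\ :\ \tau_0,\ldots,\tau_s\in\Sigma^2[\mathrm{x},\mathrm{y}]\Big\},$$ $\operatorname{QM}[c_{in}]:=\{\sigma_0+\sum_{j\in\mathcal{J}}\sigma_jc_j:\sigma_0,\sigma_j\in\Sigma^2[\mathrm{x}]\}$, and let $\operatorname{Ideal}[c_{eq}]$ be the ideal of $\mathbb{R}[\mathrm{x}]$ generated by the $c_i$,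 $i\in\mathcal{I}$. A subset $M\subseteq\mathbb{R}[\mathrm{x}]$ of this kind is archimedean if $N-\mathrm{x}_1^2-\cdots-\mathrm{x}_n^2\in M$ for some integer $N>0$. Here $k$ ranges over integers large enough that $2k\ge\deg(f)$ and $2k\ge\deg(c_i)$ for all $i\in\mathcal{I}$. "Optimal value" means infimum (with $\inf\emptyset=+\infty$), and "monotonically increasing" means $\gamma_k\le\gamma_{k+1}$. For $w\in\mathbb{R}^{\mathbb{N}^n_{2k}}$, $\mathscr{R}_w$ is the linear functional on polynomials of degree at most $2k$ with $\mathscr{R}_w(\mathrm{x}^\alpha)=w_\alpha$. $[\cdot]_d$ denotes the vector of all monomials of degree at most $d$. - $\mathscr{V}^{(2k)}_{c_i}[w]$ (localizing vector) is the vector with $\mathscr{R}_w(c_iu)=(\mathscr{V}^{(2k)}_{c_i}[w])^T\mathbf{u}$ for all $u\in\mathbb{R}[\mathrm{x}]$ with $\deg u\le 2k-\deg(c_i)$, where $\mathbf{u}$ is the coefficient vector of $u$. - $\mathrm{L}^{(k)}_{c_j}[w]=\mathscr{R}_w\big(c_j[\mathrm{x}]_{k'}[\mathrm{x}]_{k'}^T\big)$ (applied entrywise) with $k'=k-\lceil\deg(c_j)/2\rceil$. - $\mathrm{L}^{(k,l)}_{\nu,g_j}[w]$ is the symmetric matrix such that $\mathscr{R}_w\big(\int p(\mathrm{x},y)^2g_j(\mathrm{x},y)\,d\nu(y)\big)=\mathbf{p}^T\mathrm{L}^{(k,l)}_{\nu,g_j}[w]\mathbf{p}$ for all $p\in\mathbb{R}[\mathrm{x},\mathrm{y}]$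 with $\deg_{\mathrm{x}}(p)\le k-\lceil\deg_{\mathrm{x}}(g_j)/2\rceil$ and $\deg_{\mathrm{y}}(p)\le l-\lceil\deg_{\mathrm{y}}(g_j)/2\rceil$, where $\mathbf{p}$ is the coefficient vector of $p$. When a degree bound is negative the corresponding matrix is empty and the condition vacuous. $W\succeq0$ means $W$ is positive semidefinite.
   Formalization: The set Q is assumed nonempty (equivalently ν is not the zero measure); for Q empty and ν = 0 the claim fails, e.g. n = 1, s = 0, c_in = (1 − x²), f = x, where f_min = −1 but every γ_k ≤ −2. *)

theory Defs
  imports "HOL-Analysis.Analysis" "HOL-Library.Poly_Mapping"
begin

section \<open>Real multivariate polynomials\<close>

text \<open>
  A finite type of variables; exponent vectors are finitely supported maps to the naturals, and
  the ring structure is that of \<^theory>\<open>HOL-Library.Poly_Mapping\<close>. The polynomial ring in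
  \<open>x\<close> (indexed by \<open>'n\<close>) and \<open>y\<close> (indexed by \<open>'m\<close>) has the variable type \<open>'n + 'm\<close>.
\<close>

type_synonym 'v monom = "'v \<Rightarrow>\<^sub>0 nat"
type_synonym 'v rpoly = "('v \<Rightarrow>\<^sub>0 nat) \<Rightarrow>\<^sub>0 real"

abbreviation mono_poly :: "'v monom \<Rightarrow> 'v rpoly" where
  "mono_poly a \<equiv> Poly_Mapping.single a 1"

abbreviation const_poly :: "real \<Rightarrow> 'v rpoly" where
  "const_poly r \<equiv> Poly_Mapping.single 0 r"

definition var_poly :: "'v \<Rightarrow> 'v rpoly" where
  "var_poly i = mono_poly (Poly_Mapping.single i 1)"

definition mono_eval :: "'v::finite monom \<Rightarrow> ('v \<Rightarrow> real) \<Rightarrow> real" where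
  "mono_eval a v = (\<Prod>i\<in>UNIV. v i ^ Poly_Mapping.lookup a i)"

definition poly_eval :: "'v::finite rpoly \<Rightarrow> ('v \<Rightarrow> real) \<Rightarrow> real" where
  "poly_eval p v = (\<Sum>a\<in>Poly_Mapping.keys p. Poly_Mapping.lookup p a * mono_eval a v)"

definition eval_x :: "'n::finite rpoly \<Rightarrow> real^'n \<Rightarrow> real" where
  "eval_x p x = poly_eval p (\<lambda>i. x $ i)"

definition eval_xy :: "('n::finite + 'm::finite) rpoly \<Rightarrow> real^'n \<Rightarrow> real^'m \<Rightarrow> real" where
  "eval_xy p x y = poly_eval p (case_sum (\<lambda>i. x $ i) (\<lambda>j. y $ j))"

abbreviation x_part :: "('n + 'm) monom \<Rightarrow> 'n monom" where
  "x_part e \<equiv> Poly_Mapping.map_key Inl e"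

abbreviation y_part :: "('n + 'm) monom \<Rightarrow> 'm monom" where
  "y_part e \<equiv> Poly_Mapping.map_key Inr e"

text \<open>All degrees of the zero polynomial are \<open>0\<close>.\<close>

definition mono_deg :: "'v::finite monom \<Rightarrow> nat" where
  "mono_deg a = (\<Sum>i\<in>UNIV. Poly_Mapping.lookup a i)"

definition poly_deg :: "'v::finite rpoly \<Rightarrow> nat" where
  "poly_deg p = Max (insert 0 (mono_deg ` Poly_Mapping.keys p))"

definition deg_x :: "('n::finite + 'm::finite) rpoly \<Rightarrow> nat" where
  "deg_x p = Max (insert 0 ((\<lambda>e. mono_deg (x_part e)) ` Poly_Mapping.keys p))"

definition deg_y :: "('n::finite + 'm::finite) rpoly \<Rightarrow> nat" where
  "deg_y p = Max (insert 0 ((\<lambda>e. mono_deg (y_part e)) ` Poly_Mapping.keys p))"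

definition monos_upto :: "nat \<Rightarrow> 'v::finite monom set" where
  "monos_upto d = {a. mono_deg a \<le> d}"


section \<open>Measures\<close>

definition measure_supp :: "'a::topological_space measure \<Rightarrow> 'a set" where
  "measure_supp \<nu> = {y. \<forall>U. open U \<longrightarrow> y \<in> U \<longrightarrow> emeasure \<nu> U > 0}"

definition finite_moments :: "(real^'m::finite) measure \<Rightarrow> bool" where
  "finite_moments \<nu> \<longleftrightarrow> (\<forall>b. integrable \<nu> (\<lambda>y. mono_eval b (\<lambda>j. y $ j)))"

definition moment :: "(real^'m::finite) measure \<Rightarrow> 'm monom \<Rightarrow> real" where
  "moment \<nu> b = (\<integral>y. mono_eval b (\<lambda>j. y $ j) \<partial>\<nu>)"

definition carleman_term :: "(real^'m::finite) measure \<Rightarrow> 'm \<Rightarrow> nat \<Rightarrow> ennreal" where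
  "carleman_term \<nu> j d =
     (let M = (\<integral>y. (y $ j) ^ (2 * d) \<partial>\<nu>)
      in if M = 0 then \<infinity> else ennreal (M powr (- 1 / (2 * real d))))"

definition carleman :: "(real^'m::finite) measure \<Rightarrow> bool" where
  "carleman \<nu> \<longleftrightarrow> (\<forall>j. suminf (\<lambda>d. carleman_term \<nu> j (Suc d)) = \<infinity>)"

text \<open>The polynomial \<open>\<integral> p(x, y) d\<nu>(y)\<close> in \<open>x\<close>; see \<open>eval_integrate_y\<close> below.\<close>

definition integrate_y ::
    "(real^'m::finite) measure \<Rightarrow> ('n::finite + 'm) rpoly \<Rightarrow> 'n rpoly" where
  "integrate_y \<nu> p = (\<Sum>e\<in>Poly_Mapping.keys p.
     Poly_Mapping.single (x_part e) (Poly_Mapping.lookup p e * moment \<nu> (y_part e)))"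


section \<open>Quadratic modules and ideals\<close>

definition sos :: "'v rpoly set" where
  "sos = {\<Sum>i<N. (q i)\<^sup>2 | (N::nat) q. True}"

definition QM_nu ::
    "nat \<Rightarrow> (nat \<Rightarrow> ('n::finite + 'm::finite) rpoly) \<Rightarrow> (real^'m) measure \<Rightarrow> 'n rpoly set" where
  "QM_nu s g \<nu> = {\<Sum>j\<le>s. integrate_y \<nu> (\<tau> j * g j) | \<tau>. \<forall>j\<le>s. \<tau> j \<in> sos}"

definition QM_in :: "'i set \<Rightarrow> ('i \<Rightarrow> 'n rpoly) \<Rightarrow> 'n rpoly set" where
  "QM_in J c = {\<sigma>0 + (\<Sum>j\<in>J. \<sigma> j * c j) | \<sigma>0 \<sigma>. \<sigma>0 \<in> sos \<and> (\<forall>j\<in>J. \<sigma> j \<in> sos)}"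

definition ideal_eq :: "'i set \<Rightarrow> ('i \<Rightarrow> 'n rpoly) \<Rightarrow> 'n rpoly set" where
  "ideal_eq I c = {\<Sum>i\<in>I. h i * c i | h. True}"

definition archimedean :: "'n::finite rpoly set \<Rightarrow> bool" where
  "archimedean M \<longleftrightarrow>
     (\<exists>N::nat. N > 0 \<and> const_poly (real N) - (\<Sum>i\<in>UNIV. (var_poly i)\<^sup>2) \<in> M)"


section \<open>The semi-infinite program\<close>

definition set_K ::
    "(real^'m::finite) set \<Rightarrow> nat \<Rightarrow> (nat \<Rightarrow> ('n::finite + 'm) rpoly) \<Rightarrow> (real^'n) set" where
  "set_K Q s g = {x. \<forall>y\<in>Q. \<forall>j\<in>{1..s}. eval_xy (g j) x y \<ge> 0}"

definition set_X :: "'i set \<Rightarrow> 'i set \<Rightarrow> ('i \<Rightarrow> 'n::finite rpoly) \<Rightarrow> (real^'n) set" where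
  "set_X I J c = {x. (\<forall>i\<in>I. eval_x (c i) x = 0) \<and> (\<forall>j\<in>J. eval_x (c j) x \<ge> 0)}"

definition sip_value :: "'n::finite rpoly \<Rightarrow> (real^'n) set \<Rightarrow> ereal" where
  "sip_value f S = (INF x\<in>S. ereal (eval_x f x))"


section \<open>The moment relaxations\<close>

definition riesz :: "('v monom \<Rightarrow> real) \<Rightarrow> 'v rpoly \<Rightarrow> real" where
  "riesz w p = (\<Sum>a\<in>Poly_Mapping.keys p. Poly_Mapping.lookup p a * w a)"

definition psd_on :: "'a set \<Rightarrow> ('a \<Rightarrow> 'a \<Rightarrow> real) \<Rightarrow> bool" where
  "psd_on B A \<longleftrightarrow> (\<forall>a\<in>B. \<forall>b\<in>B. A a b = A b a) \<and>
     (\<forall>v. 0 \<le> (\<Sum>a\<in>B. \<Sum>b\<in>B. v a * A a b * v b))"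

text \<open>
  Vectors and matrices are indexed by monomials. In the index sets the subtracted degree is moved
  to the left-hand side, so that a negative degree bound gives the empty index set;
  \<open>(d + 1) div 2\<close> is \<open>\<lceil>d / 2\<rceil>\<close>.
\<close>

definition loc_vec_index :: "nat \<Rightarrow> 'n::finite rpoly \<Rightarrow> 'n monom set" where
  "loc_vec_index d c = {a. mono_deg a + poly_deg c \<le> d}"

definition loc_vec :: "'n rpoly \<Rightarrow> ('n monom \<Rightarrow> real) \<Rightarrow> 'n monom \<Rightarrow> real" where
  "loc_vec c w a = riesz w (c * mono_poly a)"

definition loc_mat_index :: "nat \<Rightarrow> 'n::finite rpoly \<Rightarrow> 'n monom set" where
  "loc_mat_index k c = {a. mono_deg a + (poly_deg c + 1) div 2 \<le> k}"

definition loc_mat :: "'n rpoly \<Rightarrow> ('n monom \<Rightarrow> real) \<Rightarrow> 'n monom \<Rightarrow> 'n monom \<Rightarrow> real" where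
  "loc_mat c w a b = riesz w (c * (mono_poly a * mono_poly b))"

definition nu_mat_index ::
    "nat \<Rightarrow> nat \<Rightarrow> ('n::finite + 'm::finite) rpoly \<Rightarrow> ('n + 'm) monom set" where
  "nu_mat_index k l g = {e. mono_deg (x_part e) + (deg_x g + 1) div 2 \<le> k \<and>
                            mono_deg (y_part e) + (deg_y g + 1) div 2 \<le> l}"

definition nu_mat ::
    "(real^'m::finite) measure \<Rightarrow> ('n::finite + 'm) rpoly \<Rightarrow> ('n monom \<Rightarrow> real)
      \<Rightarrow> ('n + 'm) monom \<Rightarrow> ('n + 'm) monom \<Rightarrow> real" where
  "nu_mat \<nu> g w a b = riesz w (integrate_y \<nu> ((mono_poly a * mono_poly b) * g))"

definition relax_feasible ::
    "'i set \<Rightarrow> 'i set \<Rightarrow> ('i \<Rightarrow> 'n::finite rpoly) \<Rightarrow> nat \<Rightarrow> (nat \<Rightarrow> ('n + 'm::finite) rpoly)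
      \<Rightarrow> (real^'m) measure \<Rightarrow> nat \<Rightarrow> ('n monom \<Rightarrow> real) set" where
  "relax_feasible I J c s g \<nu> k = {w \<in> monos_upto (2 * k) \<rightarrow>\<^sub>E UNIV.
     (\<forall>i\<in>I. \<forall>a\<in>loc_vec_index (2 * k) (c i). loc_vec (c i) w a = 0) \<and>
     (\<forall>j\<in>J. psd_on (loc_mat_index k (c j)) (loc_mat (c j) w)) \<and>
     (\<forall>j\<le>s. psd_on (nu_mat_index k k (g j)) (nu_mat \<nu> (g j) w)) \<and>
     w 0 = 1}"

definition relax_value ::
    "'n::finite rpoly \<Rightarrow> 'i set \<Rightarrow> 'i set \<Rightarrow> ('i \<Rightarrow> 'n rpoly) \<Rightarrow> nat
      \<Rightarrow> (nat \<Rightarrow> ('n + 'm::finite) rpoly) \<Rightarrow> (real^'m) measure \<Rightarrow> nat \<Rightarrow> ereal" where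
  "relax_value f I J c s g \<nu> k = (INF w\<in>relax_feasible I J c s g \<nu> k.
     ereal (\<Sum>a\<in>Poly_Mapping.keys f. Poly_Mapping.lookup f a * w a))"


section \<open>The defining properties of the objects above\<close>

lemma riesz_superset:
  assumes "finite A" "Poly_Mapping.keys p \<subseteq> A"
  shows "riesz w p = (\<Sum>a\<in>A. Poly_Mapping.lookup p a * w a)"
  unfolding riesz_def using assms by (intro sum.mono_neutral_left) (auto simp: in_keys_iff)

lemma riesz_add: "riesz w (p + q) = riesz w p + riesz w q"
proof -
  let ?A = "Poly_Mapping.keys p \<union> Poly_Mapping.keys q"
  have "Poly_Mapping.keys (p + q) \<subseteq> ?A"
    by (rule Poly_Mapping.keys_add)
  then show ?thesis
    by (simp add: riesz_superset[of ?A] lookup_add algebra_simps sum.distrib)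
qed

lemma riesz_sum: "riesz w (\<Sum>i\<in>A. p i) = (\<Sum>i\<in>A. riesz w (p i))"
  by (induction A rule: infinite_finite_induct) (auto simp: riesz_add, auto simp: riesz_def)

lemma riesz_single: "riesz w (Poly_Mapping.single a r) = r * w a"
  by (cases "r = 0") (auto simp: riesz_def)

lemma riesz_mono_poly: "riesz w (mono_poly a) = w a"
  by (simp add: riesz_single)

lemma const_mult_eq_sum:
  "const_poly r * p = (\<Sum>a\<in>Poly_Mapping.keys p. Poly_Mapping.single a (r * Poly_Mapping.lookup p a))"
proof -
  have "p = (\<Sum>a\<in>Poly_Mapping.keys p. Poly_Mapping.single a (Poly_Mapping.lookup p a))"
    by (rule poly_mapping_eqI)
      (simp add: lookup_sum lookup_single when_def in_keys_iff)
  then have "const_poly r * p =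
      const_poly r * (\<Sum>a\<in>Poly_Mapping.keys p. Poly_Mapping.single a (Poly_Mapping.lookup p a))"
    by simp
  then show ?thesis
    by (simp add: sum_distrib_left mult_single)
qed

lemma riesz_const_mult: "riesz w (const_poly r * p) = r * riesz w p"
  by (simp add: const_mult_eq_sum riesz_sum riesz_single)
    (simp add: riesz_def sum_distrib_left mult.assoc)

lemma integrate_y_superset:
  assumes "finite A" "Poly_Mapping.keys p \<subseteq> A"
  shows "integrate_y \<nu> p = (\<Sum>e\<in>A.
     Poly_Mapping.single (x_part e) (Poly_Mapping.lookup p e * moment \<nu> (y_part e)))"
  unfolding integrate_y_def using assms
  by (intro sum.mono_neutral_left) (auto simp: in_keys_iff)

lemma integrate_y_add: "integrate_y \<nu> (p + q) = integrate_y \<nu> p + integrate_y \<nu> q"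
proof -
  let ?A = "Poly_Mapping.keys p \<union> Poly_Mapping.keys q"
  have "Poly_Mapping.keys (p + q) \<subseteq> ?A"
    by (rule Poly_Mapping.keys_add)
  then show ?thesis
    by (simp add: integrate_y_superset[of ?A] lookup_add algebra_simps sum.distrib single_add)
qed

lemma integrate_y_sum: "integrate_y \<nu> (\<Sum>i\<in>A. p i) = (\<Sum>i\<in>A. integrate_y \<nu> (p i))"
  by (induction A rule: infinite_finite_induct)
    (auto simp: integrate_y_add, auto simp: integrate_y_def)

lemma integrate_y_single:
  "integrate_y \<nu> (Poly_Mapping.single e r) =
    Poly_Mapping.single (x_part e) (r * moment \<nu> (y_part e))"
  by (cases "r = 0") (auto simp: integrate_y_def)

lemma integrate_y_const_mult: "integrate_y \<nu> (const_poly r * p) = const_poly r * integrate_y \<nu> p"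
  by (simp add: const_mult_eq_sum[of r p] integrate_y_sum integrate_y_single)
    (simp add: integrate_y_def sum_distrib_left mult_single mult.assoc)

lemma loc_vec_property:
  assumes "finite B"
  shows "riesz w (c * (\<Sum>a\<in>B. const_poly (u a) * mono_poly a)) = (\<Sum>a\<in>B. loc_vec c w a * u a)"
proof -
  have "c * (const_poly (u a) * mono_poly a) = const_poly (u a) * (c * mono_poly a)" for a
    by (simp add: ac_simps)
  then show ?thesis
    by (simp only: sum_distrib_left riesz_sum riesz_const_mult loc_vec_def mult.commute)
qed

lemma square_expand:
  "(\<Sum>a\<in>B. const_poly (u a) * mono_poly a)\<^sup>2 =
    (\<Sum>a\<in>B. \<Sum>b\<in>B. const_poly (u a) * (const_poly (u b) * (mono_poly a * mono_poly b)))"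
  unfolding power2_eq_square sum_product by (intro sum.cong refl) (simp only: ac_simps)

lemma nu_mat_property:
  "riesz w (integrate_y \<nu> ((\<Sum>a\<in>B. const_poly (u a) * mono_poly a)\<^sup>2 * g)) =
    (\<Sum>a\<in>B. \<Sum>b\<in>B. u a * nu_mat \<nu> g w a b * u b)"
  unfolding square_expand nu_mat_def
  by (simp only: sum_distrib_right mult.assoc integrate_y_sum integrate_y_const_mult riesz_sum
      riesz_const_mult) (simp only: ac_simps)

lemma nu_mat_sym: "nu_mat \<nu> g w a b = nu_mat \<nu> g w b a"
  by (simp add: nu_mat_def mult.commute)

lemma mono_eval_case_sum:
  "mono_eval e (case_sum u v) = mono_eval (x_part e) u * mono_eval (y_part e) v"
proof -
  have "mono_eval e (case_sum u v) =
      (\<Prod>i\<in>range Inl \<union> range Inr. case_sum u v i ^ Poly_Mapping.lookup e i)"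
    unfolding mono_eval_def by (intro prod.cong) (auto simp: UNIV_sum)
  also have "\<dots> = (\<Prod>i\<in>range Inl. case_sum u v i ^ Poly_Mapping.lookup e i) *
      (\<Prod>i\<in>range Inr. case_sum u v i ^ Poly_Mapping.lookup e i)"
    by (intro prod.union_disjoint) auto
  finally show ?thesis
    by (simp add: prod.reindex mono_eval_def map_key.rep_eq)
qed

lemma eval_x_eq_riesz: "eval_x p x = riesz (\<lambda>a. mono_eval a (\<lambda>i. x $ i)) p"
  by (simp add: eval_x_def poly_eval_def riesz_def)

lemma eval_integrate_y:
  assumes "finite_moments \<nu>"
  shows "eval_x (integrate_y \<nu> p) x = (\<integral>y. eval_xy p x y \<partial>\<nu>)"
proof -
  have "(\<integral>y. eval_xy p x y \<partial>\<nu>) = (\<Sum>e\<in>Poly_Mapping.keys p. Poly_Mapping.lookup p e *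
      (mono_eval (x_part e) (\<lambda>i. x $ i) * moment \<nu> (y_part e)))"
    unfolding eval_xy_def poly_eval_def mono_eval_case_sum moment_def
    using assms by (subst Bochner_Integration.integral_sum) (auto simp: finite_moments_def)
  then show ?thesis
    by (simp add: eval_x_eq_riesz integrate_y_def riesz_sum riesz_single algebra_simps)
qed

lemma finite_monos_upto: "finite (monos_upto d :: 'v::finite monom set)"
proof -
  have "Poly_Mapping.lookup ` (monos_upto d :: 'v monom set) \<subseteq> UNIV \<rightarrow>\<^sub>E {..d}"
  proof safe
    fix a :: "'v monom" and i assume "a \<in> monos_upto d"
    moreover have "Poly_Mapping.lookup a i \<le> mono_deg a"
      unfolding mono_deg_def by (rule member_le_sum) auto
    ultimately show "Poly_Mapping.lookup a i \<le> d"
      by (simp add: monos_upto_def)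
  qed auto
  then have "finite (Poly_Mapping.lookup ` (monos_upto d :: 'v monom set))"
    by (rule finite_subset) (intro finite_PiE, auto)
  then show ?thesis
    by (rule finite_imageD) (auto intro: inj_onI poly_mapping_eqI)
qed

lemma mono_deg_parts: "mono_deg e = mono_deg (x_part e) + mono_deg (y_part e)"
proof -
  have "mono_deg e = (\<Sum>i\<in>range Inl \<union> range Inr. Poly_Mapping.lookup e i)"
    unfolding mono_deg_def by (intro sum.cong) (auto simp: UNIV_sum)
  also have "\<dots> = (\<Sum>i\<in>range Inl. Poly_Mapping.lookup e i) + (\<Sum>i\<in>range Inr. Poly_Mapping.lookup e i)"
    by (intro sum.union_disjoint) auto
  finally show ?thesis
    by (simp add: sum.reindex mono_deg_def map_key.rep_eq)
qed

lemma finite_index_sets: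
  "finite (loc_vec_index d c)" "finite (loc_mat_index k c)" "finite (nu_mat_index k l g)"
proof -
  show "finite (loc_vec_index d c)"
    by (rule finite_subset[OF _ finite_monos_upto[of d]]) (auto simp: loc_vec_index_def monos_upto_def)
  show "finite (loc_mat_index k c)"
    by (rule finite_subset[OF _ finite_monos_upto[of k]]) (auto simp: loc_mat_index_def monos_upto_def)
  show "finite (nu_mat_index k l g)"
    by (rule finite_subset[OF _ finite_monos_upto[of "k + l"]])
      (auto simp: nu_mat_index_def monos_upto_def mono_deg_parts)
qed

end

theory Submission
  imports Defs
begin

text \<open>
  Let \<open>M\<close> be the quadratic module generated by the integrals \<open>\<integral> p\<^sup>2 g\<^sub>j d\<nu>\<close>, the multiples \<open>q\<^sup>2 c\<^sub>j\<close> of the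
  inequality constraints and the ideal of the equality constraints. Up to degree bounds, a feasible
  point of the relaxation of order \<open>k\<close> is a normalized linear functional that is nonnegative on the
  part of \<open>M\<close> visible in order \<open>k\<close>. A functional feasible in order \<open>k + 1\<close> restricts to one feasible
  in order \<open>k\<close>, which gives monotonicity (\<open>relax_value_mono\<close>), and the evaluation at a feasible point
  of the semi-infinite program is feasible in every order (\<open>point_evaluation_feasible\<close>), so that the
  relaxation values stay below the minimum.

  Conversely let \<open>r\<close> be smaller than the minimum. If \<open>f - r\<close> lies in \<open>M\<close>, it is a finite sum of
  generators, each of which is nonnegative under all feasible functionals of large order
  (\<open>relax_cone_eventually_nonneg\<close>); hence the relaxation values are eventually at least \<open>r\<close>. That
  \<open>f - r\<close> lies in \<open>M\<close> rests on two theorems.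

  The first is the Positivstellensatz for an archimedean quadratic module
  (\<open>archimedean_positivstellensatz\<close>): a polynomial that is positive wherever all elements of \<open>M\<close> are
  nonnegative belongs to \<open>M\<close>. A maximal proper quadratic module induces a total ordering up to a
  support ideal, and archimedean orderings come from evaluation at a point.

  The second identifies the points where \<open>M\<close> is nonnegative with feasible points of the program
  (\<open>nonneg_on_support\<close>): if \<open>\<integral> p\<^sup>2 h d\<nu> \<ge> 0\<close> for all polynomials \<open>p\<close>, then the polynomial \<open>h\<close> is
  nonnegative on the support of \<open>\<nu>\<close>. The inequality extends from polynomials \<open>p\<close> to every function that
  polynomials approximate in \<open>L\<^sup>2\<close> of \<open>\<nu>\<close> with a polynomial weight, so it is enough to reach bump
  functions, and these are built from the functions \<open>cos (s y\<^sub>j + b)\<close>. Under the Carleman condition the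
  latter can be approximated because \<open>s \<mapsto> cos (s y\<^sub>j + b)\<close> is quasi-analytic modulo the polynomials:
  at \<open>s = 0\<close> all its derivatives are polynomials, and Bang's proof of the Denjoy-Carleman theorem, run
  in the seminorm ``distance to the polynomials'', shows that the distance vanishes for all \<open>s\<close>
  (\<open>cos_approximable\<close>).
\<close>

section \<open>Real polynomials as an algebra\<close>

lemma const_poly_add: "const_poly (a + b) = (const_poly a + const_poly b :: 'v rpoly)"
  by (simp add: single_add)

lemma const_poly_diff: "const_poly (a - b) = (const_poly a - const_poly b :: 'v rpoly)"
  by (simp add: single_diff)

lemma const_poly_mult: "const_poly (a * b) = (const_poly a * const_poly b :: 'v rpoly)"
  by (simp add: mult_single)

lemma const_poly_power: "const_poly (a ^ n) = (const_poly a ^ n :: 'v rpoly)"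
  by (induction n) (simp_all add: const_poly_mult)

lemma poly_eq_sum_singles:
  "p = (\<Sum>a\<in>Poly_Mapping.keys p. Poly_Mapping.single a (Poly_Mapping.lookup p a))"
  by (rule poly_mapping_eqI) (simp add: lookup_sum lookup_single when_def in_keys_iff)

lemma rpoly_induct_single [case_names single add]:
  fixes p :: "'v rpoly"
  assumes single: "\<And>a r. P (Poly_Mapping.single a r)"
    and add: "\<And>p q. P p \<Longrightarrow> P q \<Longrightarrow> P (p + q)"
  shows "P p"
proof -
  have "P (\<Sum>a\<in>A. Poly_Mapping.single a (Poly_Mapping.lookup p a))" if "finite A" for A
    using that
  proof induction
    case empty
    show ?case using single[of 0 0] by simp
  qed (simp add: single add)
  from this[of "Poly_Mapping.keys p"] show ?thesis
    by (subst poly_eq_sum_singles) simp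
qed

lemma mono_poly_eq_prod:
  "mono_poly a = (\<Prod>i\<in>UNIV. (var_poly i :: 'v::finite rpoly) ^ Poly_Mapping.lookup a i)"
proof -
  have var_power: "var_poly i ^ n = mono_poly (Poly_Mapping.single i n)" for i :: 'v and n
    by (induction n) (simp_all add: var_poly_def mult_single single_add[symmetric])
  have prod_mono: "(\<Prod>i\<in>A. mono_poly (b i)) = mono_poly (\<Sum>i\<in>A. b i)" if "finite A"
    for A and b :: "'v \<Rightarrow> 'v monom"
    using that by induction (simp_all add: mult_single)
  have "a = (\<Sum>i\<in>UNIV. Poly_Mapping.single i (Poly_Mapping.lookup a i))"
    by (rule poly_mapping_eqI) (simp add: lookup_sum lookup_single when_def)
  then show ?thesis
    by (simp add: var_power prod_mono)
qed

lemma rpoly_induct [case_names const var add mult]: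
  fixes p :: "'v::finite rpoly"
  assumes const: "\<And>r. P (const_poly r)"
    and var: "\<And>i. P (var_poly i)"
    and add: "\<And>p q. P p \<Longrightarrow> P q \<Longrightarrow> P (p + q)"
    and mult: "\<And>p q. P p \<Longrightarrow> P q \<Longrightarrow> P (p * q)"
  shows "P p"
proof (induction p rule: rpoly_induct_single)
  case (single a r)
  have one: "P 1" using const[of 1] by simp
  have pow: "P (p ^ n)" if "P p" for p n
    by (induction n) (simp_all add: one mult that)
  have "P (\<Prod>i\<in>A. var_poly i ^ Poly_Mapping.lookup a i)" if "finite A" for A
    using that by induction (simp_all add: one mult pow var)
  then have "P (mono_poly a)"
    by (simp add: mono_poly_eq_prod)
  then have "P (const_poly r * mono_poly a)"
    by (intro mult const)
  then show ?case by (simp add: mult_single)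
qed (rule add)

lemma mono_eval_plus: "mono_eval (a + b) v = mono_eval a v * mono_eval b v"
  by (simp add: mono_eval_def lookup_add power_add prod.distrib)

lemma mono_eval_0: "mono_eval 0 v = 1"
  by (simp add: mono_eval_def)

lemma poly_eval_eq_riesz: "poly_eval p v = riesz (\<lambda>a. mono_eval a v) p"
  by (simp add: poly_eval_def riesz_def)

lemma poly_eval_single: "poly_eval (Poly_Mapping.single a r) v = r * mono_eval a v"
  by (simp add: poly_eval_eq_riesz riesz_single)

lemma poly_eval_add: "poly_eval (p + q) v = poly_eval p v + poly_eval q v"
  by (simp add: poly_eval_eq_riesz riesz_add)

lemma poly_eval_mult: "poly_eval (p * q) v = poly_eval p v * poly_eval q v"
proof (induction p rule: rpoly_induct_single)
  case (single a r)
  show ?case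
    by (induction q rule: rpoly_induct_single)
      (simp_all add: poly_eval_single mult_single mono_eval_plus distrib_left poly_eval_add)
qed (simp add: poly_eval_add distrib_right)

lemma poly_eval_const: "poly_eval (const_poly r) v = r"
  by (simp add: poly_eval_single mono_eval_0)

lemma poly_eval_1: "poly_eval 1 v = 1"
  using poly_eval_const[of 1 v] by simp

lemma poly_eval_var: "poly_eval (var_poly i) v = v i"
proof -
  have "(\<Prod>j\<in>UNIV. v j ^ Poly_Mapping.lookup (Poly_Mapping.single i (1::nat)) j) =
      (\<Prod>j\<in>UNIV. if j = i then v i else 1)"
    by (intro prod.cong) (auto simp: lookup_single when_def)
  then show ?thesis
    by (simp add: var_poly_def poly_eval_single mono_eval_def)
qed

lemma poly_eval_power: "poly_eval (p ^ n) v = poly_eval p v ^ n"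
  by (induction n) (simp_all add: poly_eval_1 poly_eval_mult)

lemma poly_eval_minus: "poly_eval (- p) v = - poly_eval p v"
  using poly_eval_add[of p "- p" v] poly_eval_const[of 0 v] by simp

lemma poly_eval_diff: "poly_eval (p - q) v = poly_eval p v - poly_eval q v"
  using poly_eval_add[of p "- q" v] poly_eval_minus[of q v] by simp


section \<open>Archimedean quadratic modules\<close>

lemma sos_add_square: "s \<in> sos \<Longrightarrow> s + q\<^sup>2 \<in> sos"
proof -
  assume "s \<in> sos"
  then obtain N :: nat and p where s: "s = (\<Sum>i<N. (p i)\<^sup>2)"
    by (auto simp: sos_def)
  have "s + q\<^sup>2 = (\<Sum>i<Suc N. ((p(N := q)) i)\<^sup>2)"
    by (simp add: s)
  then show ?thesis unfolding sos_def by blast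
qed

lemma sos_0: "0 \<in> sos"
  unfolding sos_def by (auto intro!: exI[of _ "0::nat"])

lemma sos_square: "q\<^sup>2 \<in> sos"
  using sos_add_square[OF sos_0, of q] by simp

lemma sos_induct [consumes 1, case_names zero add_square]:
  assumes "p \<in> sos" and "P 0" and "\<And>s q. s \<in> sos \<Longrightarrow> P s \<Longrightarrow> P (s + q\<^sup>2)"
  shows "P p"
proof -
  have "(\<Sum>i<N. (q i)\<^sup>2) \<in> sos \<and> P (\<Sum>i<N. (q i)\<^sup>2)" for N :: nat and q
    by (induction N) (simp_all add: sos_0 sos_add_square assms)
  with assms(1) show ?thesis by (auto simp: sos_def)
qed

lemma sos_add: "q \<in> sos \<Longrightarrow> p \<in> sos \<Longrightarrow> p + q \<in> sos"
proof (induction q rule: sos_induct)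
  case (add_square s q)
  then show ?case using sos_add_square[of "p + s" q] by (simp add: add.assoc)
qed simp

lemma sos_mult_square: "p \<in> sos \<Longrightarrow> q\<^sup>2 * p \<in> sos"
proof (induction p rule: sos_induct)
  case (add_square s r)
  then show ?case using sos_add_square[of "q\<^sup>2 * s" "q * r"]
    by (simp add: algebra_simps power_mult_distrib)
qed (simp add: sos_0)

definition quad_module :: "'v rpoly set \<Rightarrow> bool" where
  "quad_module M \<longleftrightarrow>
     (\<forall>p\<in>M. \<forall>q\<in>M. p + q \<in> M) \<and> (\<forall>q. q\<^sup>2 \<in> M) \<and> (\<forall>p\<in>M. \<forall>q. q\<^sup>2 * p \<in> M)"

definition bounded_over :: "'v rpoly set \<Rightarrow> 'v rpoly \<Rightarrow> bool" where
  "bounded_over M p \<longleftrightarrow> (\<exists>r. const_poly r - p \<in> M \<and> const_poly r + p \<in> M)"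

context
  fixes M :: "'v rpoly set"
  assumes M: "quad_module M"
begin

lemma qm_add: "p \<in> M \<Longrightarrow> q \<in> M \<Longrightarrow> p + q \<in> M"
  and qm_square: "q\<^sup>2 \<in> M"
  and qm_mult_square: "p \<in> M \<Longrightarrow> q\<^sup>2 * p \<in> M"
  using M by (auto simp: quad_module_def)

lemma qm_0: "0 \<in> M"
  using qm_square[of 0] by simp

lemma qm_mult_sos: "s \<in> sos \<Longrightarrow> p \<in> M \<Longrightarrow> s * p \<in> M"
  by (induction s rule: sos_induct) (auto simp: qm_0 distrib_right intro: qm_add qm_mult_square)

lemma qm_sos: "s \<in> sos \<Longrightarrow> s \<in> M"
  using qm_mult_sos[of s 1] qm_square[of 1] by simp

lemma qm_const: "r \<ge> 0 \<Longrightarrow> const_poly r \<in> M"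
  using qm_square[of "const_poly (sqrt r)"] by (simp flip: const_poly_power)

lemma qm_scale: "r \<ge> 0 \<Longrightarrow> p \<in> M \<Longrightarrow> const_poly r * p \<in> M"
  using qm_mult_square[of p "const_poly (sqrt r)"] by (simp flip: const_poly_power)

lemma qm_unscale:
  assumes "r > 0" and "const_poly r * p \<in> M"
  shows "p \<in> M"
proof -
  have "const_poly (1 / r) * (const_poly r * p) = const_poly (1 / r * r) * p"
    by (simp only: const_poly_mult mult.assoc)
  also have "\<dots> = p"
    using assms(1) by simp
  finally show ?thesis
    using qm_scale[of "1 / r", OF _ assms(2)] assms(1) by simp
qed

text \<open>Because \<open>2 r (r\<^sup>2 - p\<^sup>2) = (r - p)\<^sup>2 (r + p) + (r + p)\<^sup>2 (r - p)\<close>.\<close>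

lemma qm_square_between:
  assumes "r > 0" and "const_poly r - p \<in> M" and "const_poly r + p \<in> M"
  shows "const_poly (r\<^sup>2) - p\<^sup>2 \<in> M"
proof (rule qm_unscale)
  let ?r = "const_poly r :: 'v rpoly"
  have "(?r - p)\<^sup>2 * (?r + p) + (?r + p)\<^sup>2 * (?r - p) \<in> M"
    by (rule qm_add) (rule qm_mult_square, fact)+
  also have "(?r - p)\<^sup>2 * (?r + p) + (?r + p)\<^sup>2 * (?r - p) = (?r + ?r) * (?r\<^sup>2 - p\<^sup>2)"
    by (simp add: algebra_simps power2_eq_square)
  finally show "const_poly (2 * r) * (const_poly (r\<^sup>2) - p\<^sup>2) \<in> M"
    by (simp add: const_poly_power flip: const_poly_add)
qed (use assms in simp)

lemma bounded_over_pos: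
  assumes "bounded_over M p"
  obtains r where "r > 0" "const_poly r - p \<in> M" "const_poly r + p \<in> M"
proof -
  obtain r where r: "const_poly r - p \<in> M" "const_poly r + p \<in> M"
    using assms by (auto simp: bounded_over_def)
  have c: "const_poly (\<bar>r\<bar> + 1 - r) \<in> M"
    by (rule qm_const) simp
  have "const_poly (\<bar>r\<bar> + 1) - p \<in> M" "const_poly (\<bar>r\<bar> + 1) + p \<in> M"
    using qm_add[OF c r(1)] qm_add[OF c r(2)]
    by (simp_all add: const_poly_diff algebra_simps)
  then show ?thesis by (intro that[of "\<bar>r\<bar> + 1"]) auto
qed

lemma bounded_over_const: "bounded_over M (const_poly r)"
  unfolding bounded_over_def
  by (intro exI[of _ "\<bar>r\<bar>"]) (auto intro!: qm_const simp flip: const_poly_add const_poly_diff)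

lemma bounded_over_add:
  assumes "bounded_over M p" "bounded_over M q"
  shows "bounded_over M (p + q)"
proof -
  obtain r s where "const_poly r - p \<in> M" "const_poly r + p \<in> M"
      "const_poly s - q \<in> M" "const_poly s + q \<in> M"
    using assms by (auto simp: bounded_over_def)
  then have "(const_poly r - p) + (const_poly s - q) \<in> M" "(const_poly r + p) + (const_poly s + q) \<in> M"
    by (auto intro: qm_add)
  then show ?thesis
    unfolding bounded_over_def by (intro exI[of _ "r + s"]) (simp add: const_poly_add algebra_simps)
qed

lemma bounded_over_minus: "bounded_over M p \<Longrightarrow> bounded_over M (- p)"
  by (auto simp: bounded_over_def)

lemma bounded_over_scale:
  assumes "bounded_over M p" and "c \<ge> 0"
  shows "bounded_over M (const_poly c * p)"
proof -
  obtain r where "const_poly r - p \<in> M" "const_poly r + p \<in> M"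
    using assms by (auto simp: bounded_over_def)
  then have "const_poly c * (const_poly r - p) \<in> M" "const_poly c * (const_poly r + p) \<in> M"
    using assms by (auto intro: qm_scale)
  then show ?thesis
    unfolding bounded_over_def by (intro exI[of _ "c * r"]) (simp add: const_poly_mult algebra_simps)
qed

lemma bounded_over_square:
  assumes "bounded_over M p"
  shows "bounded_over M (p\<^sup>2)"
proof -
  obtain r where r: "r > 0" "const_poly r - p \<in> M" "const_poly r + p \<in> M"
    using bounded_over_pos[OF assms] .
  have "const_poly (r\<^sup>2) - p\<^sup>2 \<in> M"
    by (rule qm_square_between[OF r])
  moreover have "const_poly (r\<^sup>2) + p\<^sup>2 \<in> M"
    by (intro qm_add qm_const qm_square) simp
  ultimately show ?thesis unfolding bounded_over_def by blast
qed

text \<open>By polarization, \<open>4 p q = (p + q)\<^sup>2 - (p - q)\<^sup>2\<close>, from the case of squares.\<close>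

lemma bounded_over_mult:
  assumes "bounded_over M p" "bounded_over M q"
  shows "bounded_over M (p * q)"
proof -
  have "bounded_over M (const_poly (1/4) * ((p + q)\<^sup>2 + - ((p + - q)\<^sup>2)))"
    by (intro bounded_over_scale bounded_over_add bounded_over_minus bounded_over_square assms) simp
  also have "(p + q)\<^sup>2 + - ((p + - q)\<^sup>2) = const_poly 4 * (p * q)"
  proof -
    have "const_poly 4 = (1 + 1 + 1 + 1 :: 'v rpoly)"
      by simp
    then show ?thesis by (simp add: algebra_simps power2_eq_square)
  qed
  also have "const_poly (1/4) * (const_poly 4 * (p * q)) = p * q"
    by (simp only: mult.assoc[symmetric] const_poly_mult[symmetric]) simp
  finally show ?thesis .
qed

end

text \<open>
  The bounded elements form a subring that contains the constants, so that it is enough to bound the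
  variables.
\<close>

lemma archimedean_imp_bounded_over:
  fixes M :: "'v::finite rpoly set"
  assumes M: "quad_module M" and "archimedean M"
  shows "bounded_over M p"
proof (induction p rule: rpoly_induct)
  case (var i)
  obtain N :: nat where N: "const_poly (real N) - (\<Sum>i\<in>UNIV. (var_poly i)\<^sup>2) \<in> M"
    using assms(2) by (auto simp: archimedean_def)
  \<comment> \<open>the bound comes from \<open>N + 1 \<plusminus> 2 x = (N - x\<^sup>2) + (x \<plusminus> 1)\<^sup>2\<close>\<close>
  have sq: "(\<Sum>j\<in>A. (var_poly j)\<^sup>2) \<in> M" if "finite A" for A :: "'v set"
    using that by induction (auto intro: qm_add[OF M] qm_square[OF M] qm_0[OF M])
  let ?x = "var_poly i :: 'v rpoly" and ?N = "const_poly (real N) :: 'v rpoly"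
  have "(?N - (\<Sum>j\<in>UNIV. (var_poly j)\<^sup>2)) + (\<Sum>j\<in>UNIV - {i}. (var_poly j)\<^sup>2) \<in> M"
    by (intro qm_add[OF M] N sq) simp
  then have a: "?N - ?x\<^sup>2 \<in> M"
    by (simp add: sum.remove[of UNIV i])
  have "(?N - ?x\<^sup>2) + (?x - 1)\<^sup>2 \<in> M" "(?N - ?x\<^sup>2) + (?x + 1)\<^sup>2 \<in> M"
    by (intro qm_add[OF M] a qm_square[OF M])+
  then have b: "(?N + 1) - (?x + ?x) \<in> M" "(?N + 1) + (?x + ?x) \<in> M"
    by (simp_all add: power2_eq_square algebra_simps)
  have "const_poly (real N + 1) = ?N + 1"
    by (simp add: const_poly_add)
  moreover have "const_poly 2 * const_poly ((real N + 1) / 2) = (const_poly (real N + 1) :: 'v rpoly)"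
    by (simp only: const_poly_mult[symmetric] nonzero_mult_div_cancel_left times_divide_eq_right)
  moreover have "const_poly 2 = (1 + 1 :: 'v rpoly)"
    by simp
  ultimately have "const_poly 2 * (const_poly ((real N + 1) / 2) - ?x) \<in> M"
      "const_poly 2 * (const_poly ((real N + 1) / 2) + ?x) \<in> M"
    using b by (simp_all only: distrib_left right_diff_distrib) (simp_all add: distrib_right)
  then have "const_poly ((real N + 1) / 2) - ?x \<in> M" "const_poly ((real N + 1) / 2) + ?x \<in> M"
    by (auto intro: qm_unscale[OF M, of 2])
  then show ?case unfolding bounded_over_def by blast
qed (auto intro: bounded_over_const[OF M] bounded_over_add[OF M] bounded_over_mult[OF M])

definition adjoin :: "'v rpoly set \<Rightarrow> 'v rpoly \<Rightarrow> 'v rpoly set" where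
  "adjoin M a = {p + s * a | p s. p \<in> M \<and> s \<in> sos}"

lemma adjoin_superset: "M \<subseteq> adjoin M a"
  unfolding adjoin_def using sos_0 by force

lemma adjoin_self: "quad_module M \<Longrightarrow> a \<in> adjoin M a"
  unfolding adjoin_def using qm_0[of M] sos_square[of 1] by force

lemma quad_module_adjoin:
  assumes M: "quad_module M"
  shows "quad_module (adjoin M a)"
  unfolding quad_module_def
proof (intro conjI ballI allI)
  fix p q assume "p \<in> adjoin M a" "q \<in> adjoin M a"
  then obtain p1 s1 p2 s2 where *: "p = p1 + s1 * a" "q = p2 + s2 * a"
      "p1 \<in> M" "p2 \<in> M" "s1 \<in> sos" "s2 \<in> sos"
    unfolding adjoin_def by blast
  then have "p + q = (p1 + p2) + (s1 + s2) * a"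
    by (simp add: algebra_simps)
  then show "p + q \<in> adjoin M a"
    unfolding adjoin_def using * qm_add[OF M] sos_add by blast
next
  fix q show "q\<^sup>2 \<in> adjoin M a"
    using adjoin_superset qm_square[OF M] by blast
next
  fix p q assume "p \<in> adjoin M a"
  then obtain p1 s1 where *: "p = p1 + s1 * a" "p1 \<in> M" "s1 \<in> sos"
    unfolding adjoin_def by blast
  then have "q\<^sup>2 * p = q\<^sup>2 * p1 + (q\<^sup>2 * s1) * a"
    by (simp add: algebra_simps)
  then show "q\<^sup>2 * p \<in> adjoin M a"
    unfolding adjoin_def using * qm_mult_square[OF M] sos_mult_square by blast
qed

lemma maximal_quad_module:
  assumes M: "quad_module M" and proper: "-1 \<notin> M"
  obtains Q where "quad_module Q" "M \<subseteq> Q" "-1 \<notin> Q"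
    "\<And>Q'. quad_module Q' \<Longrightarrow> Q \<subseteq> Q' \<Longrightarrow> -1 \<notin> Q' \<Longrightarrow> Q' = Q"
proof -
  let ?A = "{Q. quad_module Q \<and> M \<subseteq> Q \<and> -1 \<notin> Q}"
  have "\<exists>Q\<in>?A. \<forall>X\<in>?A. Q \<subseteq> X \<longrightarrow> X = Q"
  proof (rule subset_Zorn_nonempty)
    show "?A \<noteq> {}" using assms by blast
    fix C assume C: "C \<noteq> {}" "subset.chain ?A C"
    then have CA: "C \<subseteq> ?A" by (auto simp: subset.chain_def)
    have lin: "X \<subseteq> Y \<or> Y \<subseteq> X" if "X \<in> C" "Y \<in> C" for X Y
      using C that by (auto simp: subset.chain_def)
    have "quad_module (\<Union>C)"
      unfolding quad_module_def
    proof (intro conjI ballI allI)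
      fix p q assume "p \<in> \<Union>C" "q \<in> \<Union>C"
      then obtain X Y where XY: "p \<in> X" "q \<in> Y" "X \<in> C" "Y \<in> C" by blast
      then obtain Z where "Z \<in> C" "p \<in> Z" "q \<in> Z"
        using lin[of X Y] by blast
      moreover then have "quad_module Z" using CA by blast
      ultimately show "p + q \<in> \<Union>C" using qm_add by blast
    next
      fix q obtain X where "X \<in> C" using C by blast
      moreover then have "quad_module X" using CA by blast
      ultimately show "q\<^sup>2 \<in> \<Union>C" using qm_square by blast
    next
      fix p q assume "p \<in> \<Union>C"
      then obtain X where "X \<in> C" "p \<in> X" by blast
      moreover then have "quad_module X" using CA by blast
      ultimately show "q\<^sup>2 * p \<in> \<Union>C" using qm_mult_square by blast
    qed
    then show "\<Union>C \<in> ?A" using C(1) CA by blast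
  qed
  then show ?thesis using that M by (smt (verit) mem_Collect_eq order_trans)
qed

text \<open>
  If neither \<open>a\<close> nor \<open>- a\<close> is in \<open>Q\<close>, adjoining either of them produces \<open>-1\<close>. Eliminating \<open>a\<close> from
  the two representations of \<open>-1\<close> shows that the coefficient \<open>s\<close> of \<open>a\<close> in the first one lies in the
  support \<open>Q \<inter> - Q\<close>, which is an ideal; then \<open>s a\<close> lies in \<open>Q\<close> and so does \<open>-1\<close>.
\<close>

lemma maximal_quad_module_total:
  assumes Q: "quad_module Q" and proper: "-1 \<notin> Q"
    and max: "\<And>Q'. quad_module Q' \<Longrightarrow> Q \<subseteq> Q' \<Longrightarrow> -1 \<notin> Q' \<Longrightarrow> Q' = Q"
  shows "a \<in> Q \<or> - a \<in> Q"
proof (rule ccontr)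
  assume "\<not> ?thesis"
  then have a: "a \<notin> Q" "- a \<notin> Q" by auto
  have ext: "-1 \<in> adjoin Q b" if "b \<notin> Q" for b
    using max[OF quad_module_adjoin[OF Q] adjoin_superset] adjoin_self[OF Q, of b] that by metis
  obtain p s where ps: "-1 = p + s * a" "p \<in> Q" "s \<in> sos"
    using ext[OF a(1)] by (auto simp: adjoin_def)
  obtain q t where qt: "-1 = q + t * (- a)" "q \<in> Q" "t \<in> sos"
    using ext[OF a(2)] by (auto simp: adjoin_def)
  \<comment> \<open>eliminating \<open>a\<close> from \<open>s a = - 1 - p\<close> and \<open>t a = 1 + q\<close> gives \<open>s + t + t p + s q = 0\<close>\<close>
  have sa: "s * a = - 1 - p"
    using arg_cong[OF ps(1), of "\<lambda>u. u - p"] by simp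
  have ta: "t * a = 1 + q"
    using arg_cong[OF qt(1), of "\<lambda>u. q - u"] by (simp add: add.commute)
  have "t * (- 1 - p) = s * (1 + q)"
    by (simp only: sa[symmetric] ta[symmetric] mult.left_commute)
  then have "t * (- 1 - p) - s * (1 + q) = 0"
    by simp
  moreover have "- s = t + t * p + s * q + (t * (- 1 - p) - s * (1 + q)) + s * q + s * (- q)"
    by (simp add: algebra_simps)
  ultimately have "- s = t + t * p + s * q"
    by simp
  also have "\<dots> \<in> Q"
    by (intro qm_add[OF Q] qm_mult_sos[OF Q] qm_sos[OF Q] ps qt)
  finally have ms: "- s \<in> Q" .
  have s: "s \<in> Q" by (rule qm_sos[OF Q ps(3)])
  \<comment> \<open>the support \<open>Q \<inter> - Q\<close> absorbs products, by polarization\<close>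
  have "(a + 1)\<^sup>2 * s + (a - 1)\<^sup>2 * (- s) \<in> Q"
    by (intro qm_add[OF Q] qm_mult_square[OF Q] s ms)
  also have "(a + 1)\<^sup>2 * s + (a - 1)\<^sup>2 * (- s) = const_poly 4 * (s * a)"
  proof -
    have "const_poly 4 = (1 + 1 + 1 + 1 :: 'a rpoly)"
      by simp
    then show ?thesis by (simp add: algebra_simps power2_eq_square)
  qed
  finally have "s * a \<in> Q"
    by (rule qm_unscale[OF Q, rotated]) simp
  then have "p + s * a \<in> Q" by (intro qm_add[OF Q] ps)
  with ps(1) proper show False by simp
qed


text \<open>
  The values of the associated point: \<open>p\<close> is sent to the supremum of the reals \<open>r\<close> with
  \<open>r \<le> p\<close> in the ordering given by \<open>Q\<close>.
\<close>

definition qm_value :: "'v rpoly set \<Rightarrow> 'v rpoly \<Rightarrow> real" where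
  "qm_value Q p = Sup {r. p - const_poly r \<in> Q}"

context
  fixes Q :: "'v rpoly set"
  assumes Q: "quad_module Q"
    and proper: "-1 \<notin> Q"
    and total: "\<And>a. a \<in> Q \<or> - a \<in> Q"
    and bdd: "\<And>p. bounded_over Q p"
begin

lemma const_mem_iff: "const_poly r \<in> Q \<longleftrightarrow> r \<ge> 0"
proof
  assume r: "const_poly r \<in> Q"
  show "r \<ge> 0"
  proof (rule ccontr)
    assume "\<not> r \<ge> 0"
    then have "const_poly (1 / - r) * const_poly r \<in> Q"
      by (intro qm_scale[OF Q] r) simp
    also have "const_poly (1 / - r) * const_poly r = (- 1 :: 'v rpoly)"
      using \<open>\<not> r \<ge> 0\<close> by (simp flip: const_poly_mult add: single_uminus)
    finally show False using proper by simp
  qed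
qed (rule qm_const[OF Q])

lemma below_le_above:
  assumes "p - const_poly r \<in> Q" "const_poly s - p \<in> Q"
  shows "r \<le> s"
proof -
  have "(p - const_poly r) + (const_poly s - p) \<in> Q"
    by (rule qm_add[OF Q]) fact+
  then have "const_poly (s - r) \<in> Q" by (simp add: const_poly_diff)
  then show ?thesis by (simp add: const_mem_iff)
qed

lemma qm_value_properties:
  shows "p - const_poly r \<in> Q \<Longrightarrow> r \<le> qm_value Q p"
    and "const_poly r - p \<in> Q \<Longrightarrow> qm_value Q p \<le> r"
    and "r < qm_value Q p \<Longrightarrow> p - const_poly r \<in> Q"
    and "qm_value Q p < r \<Longrightarrow> const_poly r - p \<in> Q"
proof -
  let ?S = "{r. p - const_poly r \<in> Q}"
  obtain N where N: "const_poly N - p \<in> Q" "const_poly N + p \<in> Q"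
    using bdd[of p] by (auto simp: bounded_over_def)
  have ne: "- N \<in> ?S" using N(2) by (simp add: single_uminus add.commute)
  have ab: "bdd_above ?S" using below_le_above[OF _ N(1)] by (auto simp: bdd_above_def)
  show le: "r \<le> qm_value Q p" if "p - const_poly r \<in> Q" for r
    unfolding qm_value_def using that ab by (intro cSup_upper) auto
  show "qm_value Q p \<le> r" if "const_poly r - p \<in> Q"
    unfolding qm_value_def using ne below_le_above[OF _ that] by (intro cSup_least) auto
  show "p - const_poly r \<in> Q" if r: "r < qm_value Q p"
  proof -
    obtain t where t: "r < t" "p - const_poly t \<in> Q"
      using r ne ab unfolding qm_value_def by (subst (asm) less_cSup_iff) auto
    have "(p - const_poly t) + const_poly (t - r) \<in> Q"
      using t by (intro qm_add[OF Q] qm_const[OF Q]) auto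
    then show ?thesis by (simp add: const_poly_diff)
  qed
  show "const_poly r - p \<in> Q" if "qm_value Q p < r"
    using total[of "p - const_poly r"] le[of r] that by auto
qed

lemma qm_value_unique:
  assumes "\<And>e. e > 0 \<Longrightarrow> const_poly (x + e) - p \<in> Q" and "\<And>e. e > 0 \<Longrightarrow> p - const_poly (x - e) \<in> Q"
  shows "qm_value Q p = x"
proof (rule antisym)
  show "qm_value Q p \<le> x"
    by (rule field_le_epsilon) (rule qm_value_properties(2), rule assms(1))
  show "x \<le> qm_value Q p"
    by (rule field_le_epsilon) (use qm_value_properties(1)[OF assms(2)] in \<open>simp add: diff_le_eq\<close>)
qed

lemma qm_value_const: "qm_value Q (const_poly r) = r"
  by (rule qm_value_unique) (auto simp flip: const_poly_diff intro!: qm_const[OF Q])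

lemma qm_value_add: "qm_value Q (p + q) = qm_value Q p + qm_value Q q"
proof (rule qm_value_unique)
  fix e :: real assume e: "e > 0"
  have "(const_poly (qm_value Q p + e / 2) - p) + (const_poly (qm_value Q q + e / 2) - q) \<in> Q"
    using e by (intro qm_add[OF Q] qm_value_properties(4)) auto
  moreover have "const_poly (qm_value Q p + qm_value Q q + e) =
      (const_poly (qm_value Q p + e / 2) + const_poly (qm_value Q q + e / 2) :: 'v rpoly)"
    by (simp only: const_poly_add[symmetric]) (simp add: add_ac)
  ultimately show "const_poly (qm_value Q p + qm_value Q q + e) - (p + q) \<in> Q"
    by (simp add: algebra_simps)
  have "(p - const_poly (qm_value Q p - e / 2)) + (q - const_poly (qm_value Q q - e / 2)) \<in> Q"
    using e by (intro qm_add[OF Q] qm_value_properties(3)) auto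
  moreover have "const_poly (qm_value Q p + qm_value Q q - e) =
      (const_poly (qm_value Q p - e / 2) + const_poly (qm_value Q q - e / 2) :: 'v rpoly)"
    by (simp only: const_poly_add[symmetric]) (simp add: algebra_simps)
  ultimately show "p + q - const_poly (qm_value Q p + qm_value Q q - e) \<in> Q"
    by (simp add: algebra_simps)
qed

lemma qm_value_minus: "qm_value Q (- p) = - qm_value Q p"
  using qm_value_add[of p "- p"] qm_value_const[of 0] by simp

lemma qm_value_scale:
  assumes "c \<ge> 0"
  shows "qm_value Q (const_poly c * p) = c * qm_value Q p"
proof (cases "c = 0")
  case False
  with assms have c: "c > 0" by simp
  show ?thesis
  proof (rule qm_value_unique)
    fix e :: real assume e: "e > 0"
    have "const_poly c * (const_poly (qm_value Q p + e / c) - p) \<in> Q"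
      "const_poly c * (p - const_poly (qm_value Q p - e / c)) \<in> Q"
      using e c by (intro qm_scale[OF Q] qm_value_properties(3,4); simp)+
    moreover have "c * (qm_value Q p + e / c) = c * qm_value Q p + e"
      "c * (qm_value Q p - e / c) = c * qm_value Q p - e"
      using c by (simp_all add: field_simps)
    ultimately show "const_poly (c * qm_value Q p + e) - const_poly c * p \<in> Q"
      "const_poly c * p - const_poly (c * qm_value Q p - e) \<in> Q"
      by (simp_all only: right_diff_distrib const_poly_mult[symmetric])
  qed
qed (simp add: qm_value_const[of 0, simplified])

text \<open>
  After subtracting its value an element lies between \<open>- e\<close> and \<open>e\<close> for every \<open>e > 0\<close>, so that
  its square lies between \<open>0\<close> and \<open>e\<^sup>2\<close>: this is what makes the value multiplicative.
\<close>

lemma qm_value_square: "qm_value Q (p\<^sup>2) = (qm_value Q p)\<^sup>2"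
proof -
  let ?c = "qm_value Q p"
  define b where "b = p - const_poly ?c"
  have b0: "qm_value Q b = 0"
    using qm_value_add[of p "- const_poly ?c"]
    by (simp add: b_def qm_value_minus qm_value_const)
  have "qm_value Q (b\<^sup>2) \<le> 0 + e" if e: "e > 0" for e
  proof -
    have "const_poly ((sqrt e)\<^sup>2) - b\<^sup>2 \<in> Q"
    proof (rule qm_square_between[OF Q])
      show "const_poly (sqrt e) - b \<in> Q"
        by (rule qm_value_properties(4)) (use e b0 in simp)
      have "b - const_poly (- sqrt e) \<in> Q"
        by (rule qm_value_properties(3)) (use e b0 in simp)
      then show "const_poly (sqrt e) + b \<in> Q"
        by (simp add: single_uminus add.commute)
    qed (use e in simp)
    then show ?thesis using e qm_value_properties(2) by simp
  qed
  then have "qm_value Q (b\<^sup>2) \<le> 0" by (rule field_le_epsilon)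
  moreover have "0 \<le> qm_value Q (b\<^sup>2)"
    by (rule qm_value_properties(1)) (simp add: qm_square[OF Q])
  ultimately have "qm_value Q (b\<^sup>2) = 0" by simp
  have "p = b + const_poly ?c" by (simp add: b_def)
  have scale: "qm_value Q (const_poly r * b) = 0" for r
    using qm_value_scale[of r b] qm_value_scale[of "- r" b] b0 qm_value_minus[of "const_poly r * b"]
    by (cases "r \<ge> 0") (auto simp: single_uminus)
  have "p\<^sup>2 = b\<^sup>2 + const_poly (2 * ?c) * b + const_poly (?c\<^sup>2)"
  proof -
    have "const_poly (2 * ?c) = (const_poly ?c + const_poly ?c :: 'v rpoly)"
      by (simp flip: const_poly_add)
    then show ?thesis
      by (subst \<open>p = b + const_poly ?c\<close>) (simp add: power2_eq_square const_poly_mult algebra_simps)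
  qed
  then show ?thesis
    by (simp add: qm_value_add scale \<open>qm_value Q (b\<^sup>2) = 0\<close> qm_value_const)
qed

lemma qm_value_mult: "qm_value Q (p * q) = qm_value Q p * qm_value Q q"
proof -
  have "(p + q)\<^sup>2 + - ((p + - q)\<^sup>2) = const_poly 4 * (p * q)"
  proof -
    have "const_poly 4 = (1 + 1 + 1 + 1 :: 'v rpoly)"
      by simp
    then show ?thesis by (simp add: algebra_simps power2_eq_square)
  qed
  then have "qm_value Q ((p + q)\<^sup>2 + - ((p + - q)\<^sup>2)) = 4 * qm_value Q (p * q)"
    using qm_value_scale[of 4 "p * q"] by simp
  also have "qm_value Q ((p + q)\<^sup>2 + - ((p + - q)\<^sup>2)) =
      (qm_value Q p + qm_value Q q)\<^sup>2 - (qm_value Q p - qm_value Q q)\<^sup>2"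
    by (simp only: qm_value_add qm_value_minus qm_value_square) simp
  also have "\<dots> = 4 * (qm_value Q p * qm_value Q q)"
    by (simp add: power2_eq_square algebra_simps)
  finally show ?thesis by simp
qed

end

lemma qm_value_eq_poly_eval:
  fixes Q :: "'v::finite rpoly set"
  assumes "quad_module Q" "-1 \<notin> Q" "\<And>a. a \<in> Q \<or> - a \<in> Q" "\<And>p. bounded_over Q p"
  shows "qm_value Q p = poly_eval p (\<lambda>i. qm_value Q (var_poly i))"
  by (induction p rule: rpoly_induct)
    (simp_all add: qm_value_const[OF assms] qm_value_add[OF assms] qm_value_mult[OF assms]
      poly_eval_const poly_eval_var poly_eval_add poly_eval_mult)

text \<open>
  For a maximal proper extension \<open>Q\<close> of \<open>M\<close> the value map is a homomorphism of real algebras, hence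
  the evaluation at the point formed by the values of the variables.
\<close>

lemma archimedean_proper_point:
  fixes M :: "'v::finite rpoly set"
  assumes M: "quad_module M" and "-1 \<notin> M" and bdd: "\<And>p. bounded_over M p"
  obtains v where "\<And>p. p \<in> M \<Longrightarrow> poly_eval p v \<ge> 0"
proof -
  obtain Q where Q: "quad_module Q" "M \<subseteq> Q" "-1 \<notin> Q"
    and max: "\<And>Q'. quad_module Q' \<Longrightarrow> Q \<subseteq> Q' \<Longrightarrow> -1 \<notin> Q' \<Longrightarrow> Q' = Q"
    using maximal_quad_module[OF M assms(2)] by blast
  have total: "a \<in> Q \<or> - a \<in> Q" for a
    using maximal_quad_module_total[OF Q(1,3) max] .
  have bddQ: "bounded_over Q p" for p
    using bdd[of p] Q(2) unfolding bounded_over_def by blast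
  show ?thesis
  proof (rule that)
    fix p assume "p \<in> M"
    then have "0 \<le> qm_value Q p"
      using Q by (intro qm_value_properties(1)[OF Q(1,3) total bddQ]) auto
    also have "\<dots> = poly_eval p (\<lambda>i. qm_value Q (var_poly i))"
      by (rule qm_value_eq_poly_eval[OF Q(1,3) total bddQ])
    finally show "poly_eval p (\<lambda>i. qm_value Q (var_poly i)) \<ge> 0" .
  qed
qed

text \<open>
  As long as \<open>r \<ge> 0\<close>, a bound \<open>f + r \<in> M\<close> can be improved to \<open>f + r - 1 / k\<^sup>2 \<in> M\<close> with a fixed \<open>k\<close>,
  because \<open>k\<^sup>2 (f + r) - 1 = (k - s)\<^sup>2 (f + r) + 2 k (s f - 1) + (2 k - 1 - s\<^sup>2 f) + r s (2 k - s)\<close>.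
  Finitely many improvements reach \<open>r = 0\<close>.
\<close>

lemma mem_of_sos_multiple:
  fixes M :: "'v rpoly set"
  assumes M: "quad_module M" and bdd: "\<And>p. bounded_over M p"
    and s: "s \<in> sos" and sf: "s * f - 1 \<in> M"
  shows "f \<in> M"
proof -
  obtain a where a: "a > 0" "const_poly a - s \<in> M"
    using bounded_over_pos[OF M bdd] by metis
  obtain b where b: "b > 0" "const_poly b - s\<^sup>2 * f \<in> M"
    using bounded_over_pos[OF M bdd] by metis
  \<comment> \<open>large enough for \<open>2 k - s\<close> and \<open>2 k - 1 - s\<^sup>2 f\<close> to lie in \<open>M\<close>\<close>
  define k where "k = a + b + 1"
  let ?k = "const_poly k :: 'v rpoly"
  have k: "k > 0" using a b by (simp add: k_def)
  have "const_poly (k + b + 1) + (const_poly a - s) \<in> M" "const_poly (2 * a + b + 1) + (const_poly b - s\<^sup>2 * f) \<in> M"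
    using a b k by (intro qm_add[OF M] qm_const[OF M]; simp)+
  moreover have "const_poly (k + b + 1) + const_poly a = ?k + ?k"
  proof -
    have "k + b + 1 + a = k + k" by (simp add: k_def)
    then show ?thesis by (metis const_poly_add)
  qed
  moreover have "const_poly (2 * a + b + 1) + const_poly b = ?k + ?k - 1"
  proof -
    have "2 * a + b + 1 + b = k + k - 1" by (simp add: k_def)
    then show ?thesis by (metis const_poly_add const_poly_diff single_one)
  qed
  ultimately have ks: "?k + ?k - s \<in> M" and ksf: "?k + ?k - 1 - s\<^sup>2 * f \<in> M"
    by (simp_all add: add_diff_eq)
  have "(?k + ?k - s)\<^sup>2 * s + s\<^sup>2 * (?k + ?k - s) \<in> M"
    by (intro qm_add[OF M] qm_mult_square[OF M] qm_sos[OF M s] ks)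
  also have "(?k + ?k - s)\<^sup>2 * s + s\<^sup>2 * (?k + ?k - s) = (?k + ?k) * (s * (?k + ?k - s))"
    by (simp add: algebra_simps power2_eq_square)
  finally have "const_poly (2 * k) * (s * (?k + ?k - s)) \<in> M"
    by (simp only: mult_2 const_poly_add)
  then have sks: "s * (?k + ?k - s) \<in> M"
    by (rule qm_unscale[OF M, rotated]) (use k in simp)
  have step: "f + const_poly (r - 1 / k\<^sup>2) \<in> M" if "r \<ge> 0" "f + const_poly r \<in> M" for r
  proof (rule qm_unscale[OF M])
    have "(?k - s)\<^sup>2 * (f + const_poly r) + const_poly (2 * k) * (s * f - 1) + (?k + ?k - 1 - s\<^sup>2 * f) +
        const_poly r * (s * (?k + ?k - s)) \<in> M"
    proof -
      have 1: "(?k - s)\<^sup>2 * (f + const_poly r) \<in> M"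
        by (rule qm_mult_square[OF M that(2)])
      have 2: "const_poly (2 * k) * (s * f - 1) \<in> M"
        by (rule qm_scale[OF M _ sf]) (use k in simp)
      have 3: "const_poly r * (s * (?k + ?k - s)) \<in> M"
        by (rule qm_scale[OF M that(1) sks])
      show ?thesis
        by (rule qm_add[OF M qm_add[OF M qm_add[OF M 1 2] ksf] 3])
    qed
    also have "(?k - s)\<^sup>2 * (f + const_poly r) + const_poly (2 * k) * (s * f - 1) + (?k + ?k - 1 - s\<^sup>2 * f) +
        const_poly r * (s * (?k + ?k - s)) = ?k\<^sup>2 * (f + const_poly r) - 1"
      unfolding mult_2 const_poly_add by (simp add: algebra_simps power2_eq_square)
    also have "\<dots> = const_poly (k\<^sup>2) * (f + const_poly (r - 1 / k\<^sup>2))"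
    proof -
      have "const_poly (k\<^sup>2) * const_poly (1 / k\<^sup>2) = (1 :: 'v rpoly)"
        using k by (simp only: const_poly_mult[symmetric]) simp
      then show ?thesis
        by (simp only: distrib_left const_poly_diff right_diff_distrib const_poly_power[symmetric] add_diff_eq)
    qed
    finally show "const_poly (k\<^sup>2) * (f + const_poly (r - 1 / k\<^sup>2)) \<in> M" .
  qed (use k in simp)
  obtain r0 where r0: "r0 > 0" "const_poly r0 + f \<in> M"
    using bounded_over_pos[OF M bdd] by metis
  have iter: "f + const_poly (max 0 (r0 - real n / k\<^sup>2)) \<in> M" for n
  proof (induction n)
    case 0
    then show ?case using r0 by (simp add: add.commute)
  next
    case (Suc n)
    let ?r = "max 0 (r0 - real n / k\<^sup>2)"
    have "0 \<le> 1 / k\<^sup>2" "real (Suc n) / k\<^sup>2 = real n / k\<^sup>2 + 1 / k\<^sup>2"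
      by (simp_all add: add_divide_distrib)
    then have le: "?r - 1 / k\<^sup>2 \<le> max 0 (r0 - real (Suc n) / k\<^sup>2)"
      by linarith
    have "f + const_poly (?r - 1 / k\<^sup>2) + const_poly (max 0 (r0 - real (Suc n) / k\<^sup>2) - (?r - 1 / k\<^sup>2)) \<in> M"
      by (intro qm_add[OF M step[OF _ Suc]] qm_const[OF M]) (use le in simp_all)
    then show ?case by (simp only: add.assoc const_poly_add[symmetric]) simp
  qed
  obtain n :: nat where "r0 * k\<^sup>2 < real n"
    using reals_Archimedean2 by blast
  then have "max 0 (r0 - real n / k\<^sup>2) = 0"
    using k by (simp add: field_simps)
  with iter[of n] show ?thesis by simp
qed

text \<open>
  The abstract form of Putinar's Positivstellensatz. A point where the module \<open>M - \<Sigma>\<^sup>2 f\<close> is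
  nonnegative would be a point of nonnegativity of \<open>M\<close> with \<open>f \<le> 0\<close>; so \<open>-1\<close> lies in that module,
  that is, \<open>s f - 1 \<in> M\<close> for a sum of squares \<open>s\<close>.
\<close>

theorem archimedean_positivstellensatz:
  fixes M :: "'v::finite rpoly set"
  assumes M: "quad_module M" and "archimedean M"
    and pos: "\<And>v. (\<forall>p\<in>M. poly_eval p v \<ge> 0) \<Longrightarrow> poly_eval f v > 0"
  shows "f \<in> M"
proof -
  have bdd: "bounded_over M p" for p
    by (rule archimedean_imp_bounded_over) fact+
  have "-1 \<in> adjoin M (- f)"
  proof (rule ccontr)
    assume *: "-1 \<notin> adjoin M (- f)"
    have "bounded_over (adjoin M (- f)) p" for p
      using bdd[of p] adjoin_superset[of M "- f"] unfolding bounded_over_def by blast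
    then obtain v where v: "\<And>p. p \<in> adjoin M (- f) \<Longrightarrow> poly_eval p v \<ge> 0"
      using archimedean_proper_point[OF quad_module_adjoin[OF M] *] by blast
    have "poly_eval (- f) v \<ge> 0"
      using v adjoin_self[OF M] by blast
    moreover have "poly_eval f v > 0"
      using v adjoin_superset by (intro pos) blast
    ultimately show False by (simp add: poly_eval_minus)
  qed
  then obtain p s where ps: "-1 = p + s * (- f)" "p \<in> M" "s \<in> sos"
    unfolding adjoin_def by blast
  have "s * f - 1 = p"
    using arg_cong[OF ps(1), of "\<lambda>u. u + s * f"] by (simp add: algebra_simps)
  then show ?thesis
    using ps by (simp add: mem_of_sos_multiple[OF M bdd])
qed

section \<open>Carleman's inequality and the Carleman condition\<close>

text \<open>
  The inequality between geometric and arithmetic mean is applied to the numbers \<open>c\<^sub>i a\<^sub>i\<close>. The weights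
  are chosen such that the geometric mean of \<open>c\<^sub>0, \<dots>, c\<^sub>n\<close> is \<open>n + 2\<close>; after summation over \<open>n\<close> the
  factors \<open>1 / ((n + 1) (n + 2))\<close> telescope and leave \<open>c\<^sub>i / (i + 1) \<le> e\<close> in front of \<open>a\<^sub>i\<close>.
\<close>

lemma carleman_inequality:
  fixes a :: "nat \<Rightarrow> real"
  assumes pos: "\<And>i. a i \<ge> 0" and sum: "summable a"
  shows "summable (\<lambda>n. (\<Prod>i\<le>n. a i) powr (1 / real (Suc n)))"
proof -
  define c where "c i = real (i + 2) ^ (i + 1) / real (i + 1) ^ i" for i
  have c0: "c i \<ge> 0" for i by (simp add: c_def)
  have prod_c: "(\<Prod>i\<le>n. c i) = real (n + 2) ^ (n + 1)" for n
    by (induction n) (simp_all add: c_def)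
  have c_le: "c i / real (i + 1) \<le> exp 1" for i
  proof -
    have "c i / real (i + 1) = (real (i + 2) / real (i + 1)) ^ (i + 1)"
      by (simp only: c_def power_divide power_add power_one_right divide_divide_eq_left
          times_divide_times_eq)
    also have "\<dots> = (1 + 1 / real (i + 1)) ^ (i + 1)"
      by (rule arg_cong[of _ _ "\<lambda>u. u ^ (i + 1)"]) (simp add: field_simps)
    also have "\<dots> \<le> exp 1"
      by (rule exp_ge_one_plus_x_over_n_power_n) auto
    finally show ?thesis .
  qed
  define G where "G n = (\<Prod>i\<le>n. a i) powr (1 / real (Suc n))" for n
  have G_le: "G n \<le> (\<Sum>i\<le>n. c i * a i) * (1 / real (n + 1) - 1 / real (n + 2))" for n
  proof -
    have "(\<Prod>i\<le>n. c i * a i) powr (1 / real (card {..n})) \<le> (\<Sum>i\<le>n. c i * a i / real (card {..n}))"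
      by (rule arith_geom_mean) (auto simp: c0 pos)
    also have "(\<Prod>i\<le>n. c i * a i) powr (1 / real (card {..n})) = real (n + 2) * G n"
    proof -
      have "(\<Prod>i\<le>n. c i * a i) = real (n + 2) ^ (n + 1) * (\<Prod>i\<le>n. a i)"
        by (simp only: prod.distrib prod_c)
      moreover have "(real (n + 2) ^ (n + 1)) powr (1 / real (Suc n)) = real (n + 2)"
      proof -
        have "real (n + 2) ^ (n + 1) = real (n + 2) powr real (Suc n)"
          by (subst powr_realpow) auto
        then show ?thesis by (simp only: powr_powr) simp
      qed
      ultimately show ?thesis
        by (simp add: G_def powr_mult prod_nonneg pos)
    qed
    finally have le: "real (n + 2) * G n \<le> (\<Sum>i\<le>n. c i * a i) / real (n + 1)"
      by (simp add: sum_divide_distrib)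
    have "1 / real (n + 1) - 1 / real (n + 2) = 1 / real (n + 1) / real (n + 2)"
      by (simp add: divide_simps)
    moreover have "G n \<le> (\<Sum>i\<le>n. c i * a i) / real (n + 1) / real (n + 2)"
      using le by (subst pos_le_divide_eq) (auto simp: mult.commute)
    ultimately show ?thesis by simp
  qed
  have partial: "(\<Sum>n<N. G n) \<le> (\<Sum>i<N. c i * a i / real (i + 1)) - (\<Sum>i<N. c i * a i) / real (N + 1)" for N
  proof (induction N)
    case (Suc N)
    have "G N \<le> (\<Sum>i<N. c i * a i) / real (N + 1) + c N * a N / real (N + 1) -
        (\<Sum>i<Suc N. c i * a i) / real (Suc N + 1)"
      using G_le[of N] by (simp add: right_diff_distrib add_divide_distrib lessThan_Suc_atMost[symmetric])
    with Suc show ?case by simp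
  qed simp
  have "(\<Sum>n<N. G n) \<le> exp 1 * suminf a" for N
  proof -
    have "0 \<le> (\<Sum>i<N. c i * a i) / real (N + 1)"
      using c0 pos by (simp add: sum_nonneg)
    with partial[of N] have "(\<Sum>n<N. G n) \<le> (\<Sum>i<N. c i / real (i + 1) * a i)"
      by simp
    also have "\<dots> \<le> (\<Sum>i<N. exp 1 * a i)"
      using c_le pos by (intro sum_mono mult_right_mono) auto
    also have "\<dots> \<le> exp 1 * suminf a"
      unfolding sum_distrib_left[symmetric] using sum pos by (intro mult_left_mono sum_le_suminf) auto
    finally show ?thesis .
  qed
  then have "summable G"
    by (intro summableI_nonneg_bounded[of G]) (auto simp: G_def)
  then show ?thesis by (simp only: G_def[abs_def])
qed

lemma log_convex_ratio_mono:
  fixes m :: "nat \<Rightarrow> real"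
  assumes pos: "\<And>d. m d > 0" and lc: "\<And>d. (m (Suc d))\<^sup>2 \<le> m d * m (Suc (Suc d))"
    and "i \<le> l"
  shows "m (Suc i) / m i \<le> m (Suc l) / m l"
  using \<open>i \<le> l\<close>
proof (induction l rule: dec_induct)
  case (step l)
  have "m (Suc l) / m l \<le> m (Suc (Suc l)) / m (Suc l)"
    using lc[of l] pos[of l] pos[of "Suc l"] by (simp add: divide_simps power2_eq_square mult.commute)
  with step show ?case by linarith
qed simp

text \<open>
  The product of the first \<open>n + 1\<close> terms of the series telescopes to the square root of
  \<open>m\<^sub>0 / m\<^sub>n\<^sub>+\<^sub>1\<close>, so that their geometric mean is, up to a bounded factor, the \<open>n\<close>-th term of the series
  in the Carleman condition.
\<close>

lemma carleman_ratio_series_diverges: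
  fixes m :: "nat \<Rightarrow> real"
  assumes pos: "\<And>d. m d > 0" and lc: "\<And>d. (m (Suc d))\<^sup>2 \<le> m d * m (Suc (Suc d))"
    and div: "\<not> summable (\<lambda>n. m (Suc n) powr (- 1 / (2 * real (Suc n))))"
  shows "\<not> summable (\<lambda>n. sqrt (m n / m (Suc n)))"
proof
  let ?a = "\<lambda>n. sqrt (m n / m (Suc n))"
  assume "summable ?a"
  then have s: "summable (\<lambda>n. (\<Prod>i\<le>n. ?a i) powr (1 / real (Suc n)))"
    by (intro carleman_inequality) (use pos in \<open>auto simp: less_imp_le\<close>)
  have prod: "(\<Prod>i\<le>n. ?a i) = sqrt (m 0 / m (Suc n))" for n
  proof (induction n)
    case (Suc n)
    have "(\<Prod>i\<le>Suc n. ?a i) = sqrt (m 0 / m (Suc n) * (m (Suc n) / m (Suc (Suc n))))"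
      by (simp only: prod.atMost_Suc Suc real_sqrt_mult)
    then show ?case using pos[of "Suc n"] by simp
  qed simp
  \<comment> \<open>a bound for \<open>(1 / m\<^sub>0) powr x\<close> with \<open>0 \<le> x \<le> 1\<close>\<close>
  define C where "C = max 1 (1 / m 0)"
  have "summable (\<lambda>n. C * (\<Prod>i\<le>n. ?a i) powr (1 / real (Suc n)))"
    by (intro summable_mult s)
  then have "summable (\<lambda>n. m (Suc n) powr (- 1 / (2 * real (Suc n))))"
  proof (rule summable_comparison_test_ev[rotated], intro always_eventually allI)
    fix n
    let ?x = "1 / (2 * real (Suc n))"
    have x: "0 \<le> ?x" "?x \<le> 1" by auto
    have "(\<Prod>i\<le>n. ?a i) powr (1 / real (Suc n)) = (m 0 / m (Suc n)) powr ?x"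
      using pos[of 0] pos[of "Suc n"] by (simp add: prod powr_powr flip: powr_half_sqrt)
    also have "\<dots> = m (Suc n) powr (- 1 / (2 * real (Suc n))) / (1 / m 0) powr ?x"
      using pos[of 0] pos[of "Suc n"] by (simp add: powr_divide powr_minus_divide)
    finally have eq: "m (Suc n) powr (- 1 / (2 * real (Suc n))) =
        (1 / m 0) powr ?x * (\<Prod>i\<le>n. ?a i) powr (1 / real (Suc n))"
      using pos[of 0] by simp
    have "(1 / m 0) powr ?x \<le> C powr ?x"
      using pos[of 0] x by (intro powr_mono2) (auto simp: C_def)
    also have "\<dots> \<le> C powr 1"
      using x by (intro powr_mono) (auto simp: C_def)
    also have "\<dots> = C" by (simp add: C_def)
    finally show "norm (m (Suc n) powr (- 1 / (2 * real (Suc n)))) \<le>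
        C * (\<Prod>i\<le>n. ?a i) powr (1 / real (Suc n))"
      unfolding eq by (simp add: mult_right_mono)
  qed
  with div show False by contradiction
qed

text \<open>
  The ratios in the series above decrease, so that its terms of odd index already form a divergent
  series; these are dominated by the ratios of the sequence of fourth roots of \<open>m (2 n)\<close>. Fourth
  roots appear since, by the Cauchy-Schwarz inequality, weighted moments are bounded by a constant
  times the square roots of the moments of twice the order.
\<close>

lemma carleman_fourth_root_series_diverges:
  fixes m :: "nat \<Rightarrow> real"
  assumes pos: "\<And>d. m d > 0" and lc: "\<And>d. (m (Suc d))\<^sup>2 \<le> m d * m (Suc (Suc d))"
    and div: "\<not> summable (\<lambda>n. m (Suc n) powr (- 1 / (2 * real (Suc n))))"
  shows "\<not> summable (\<lambda>n. sqrt (sqrt (m (2 * n))) / sqrt (sqrt (m (2 * Suc n))))"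
proof
  let ?a = "\<lambda>n. sqrt (m n / m (Suc n))"
  let ?b = "\<lambda>n. sqrt (sqrt (m (2 * n))) / sqrt (sqrt (m (2 * Suc n)))"
  assume s: "summable ?b"
  have anti: "?a l \<le> ?a i" if "i \<le> l" for i l
  proof -
    have "inverse (m (Suc l) / m l) \<le> inverse (m (Suc i) / m i)"
      using log_convex_ratio_mono[of m, OF pos lc that] pos by (intro le_imp_inverse_le) auto
    then show ?thesis by simp
  qed
  have a0: "?a n \<ge> 0" for n using pos by (simp add: less_imp_le)
  have le: "?a (2 * n + 1) + ?a (2 * n + 2) \<le> 2 * ?b n" for n
  proof -
    have "?b n = sqrt (sqrt (m (2 * n) / m (2 * n + 1) * (m (2 * n + 1) / m (2 * n + 2))))"
      using pos[of "2 * n + 1"] by (simp add: real_sqrt_divide)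
    also have "\<dots> = sqrt (?a (2 * n) * ?a (2 * n + 1))"
      by (simp only: real_sqrt_mult) simp
    also have "\<dots> \<ge> sqrt (?a (2 * n + 1) * ?a (2 * n + 1))"
      by (intro real_sqrt_le_mono mult_right_mono anti a0) auto
    finally have "?a (2 * n + 1) \<le> ?b n"
      by (simp only: real_sqrt_abs2 abs_of_nonneg[OF a0])
    moreover have "?a (2 * n + 2) \<le> ?a (2 * n + 1)"
      by (rule anti) simp
    ultimately show ?thesis by linarith
  qed
  have b0: "?b n \<ge> 0" for n using pos by (simp add: less_imp_le)
  have bound: "(\<Sum>i<2 * N + 1. ?a i) \<le> ?a 0 + 2 * (\<Sum>n<N. ?b n)" for N
  proof (induction N)
    case (Suc N)
    have "(\<Sum>i<2 * Suc N + 1. ?a i) = (\<Sum>i<2 * N + 1. ?a i) + (?a (2 * N + 1) + ?a (2 * N + 2))"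
      by simp
    with Suc le[of N] show ?case by simp
  qed simp
  have "(\<Sum>i<N. ?a i) \<le> ?a 0 + 2 * suminf ?b" for N
  proof -
    have "(\<Sum>i<N. ?a i) \<le> (\<Sum>i<2 * N + 1. ?a i)"
      by (intro sum_mono2) (use a0 in auto)
    also have "\<dots> \<le> ?a 0 + 2 * suminf ?b"
      using bound[of N] sum_le_suminf[OF s, of "{..<N}"] b0 by auto
    finally show ?thesis .
  qed
  then have "summable ?a"
    by (intro summableI_nonneg_bounded) (use a0 in auto)
  with carleman_ratio_series_diverges[of m, OF pos lc div] show False by blast
qed

section \<open>Polynomial approximation in weighted mean square\<close>

lemma coordinate_polynomial_function [simp, intro]:
  "real_polynomial_function (\<lambda>y::real^'m::finite. y $ j)"
  by (intro real_polynomial_function.intros(1) bounded_linear_vec_nth)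

locale moment_measure = finite_measure \<nu> for \<nu> :: "(real^'m::finite) measure" +
  assumes sets_eq [measurable_cong, simp]: "sets \<nu> = sets borel"
    and integrable_polynomial: "\<And>p. real_polynomial_function p \<Longrightarrow> integrable \<nu> p"
begin

text \<open>Polynomial growth is preserved by products, which integrability is not.\<close>

definition tame :: "(real^'m \<Rightarrow> real) \<Rightarrow> bool" where
  "tame u \<longleftrightarrow> u \<in> borel_measurable \<nu> \<and> (\<exists>q. real_polynomial_function q \<and> (\<forall>y. \<bar>u y\<bar> \<le> q y))"

lemma tame_measurable: "tame u \<Longrightarrow> u \<in> borel_measurable \<nu>"
  by (simp add: tame_def)

lemma tame_polynomial:
  assumes "real_polynomial_function p"
  shows "tame p"
proof -
  have "real_polynomial_function (\<lambda>y. 1 + p y * p y)"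
    by (intro real_polynomial_function.intros(2-4) assms)
  moreover have "\<bar>p y\<bar> \<le> 1 + p y * p y" for y
  proof -
    have "2 * \<bar>p y\<bar> \<le> 1 + \<bar>p y\<bar> * \<bar>p y\<bar>"
      using zero_le_power2[of "\<bar>p y\<bar> - 1"] by (simp add: power2_eq_square algebra_simps)
    then show ?thesis by (simp add: abs_mult[symmetric])
  qed
  ultimately show ?thesis
    unfolding tame_def using borel_measurable_integrable[OF integrable_polynomial[OF assms]] by blast
qed

lemma tame_integrable:
  assumes "tame u"
  shows "integrable \<nu> u"
proof -
  obtain q where q: "real_polynomial_function q" "\<And>y. \<bar>u y\<bar> \<le> q y"
    using assms by (auto simp: tame_def)
  show ?thesis
    by (rule Bochner_Integration.integrable_bound[OF integrable_polynomial[OF q(1)]])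
      (use assms order_trans[OF q(2) abs_ge_self] in \<open>auto simp: tame_def\<close>)
qed

lemma tame_bounded:
  assumes "u \<in> borel_measurable \<nu>" and "\<And>y. \<bar>u y\<bar> \<le> B"
  shows "tame u"
  unfolding tame_def using assms by (intro conjI exI[of _ "\<lambda>y. B"]) auto

lemma tame_const: "tame (\<lambda>y. c)"
  by (intro tame_polynomial) auto

lemma tame_add:
  assumes "tame u" "tame v"
  shows "tame (\<lambda>y. u y + v y)"
proof -
  obtain p q where "real_polynomial_function p" "\<And>y. \<bar>u y\<bar> \<le> p y"
      "real_polynomial_function q" "\<And>y. \<bar>v y\<bar> \<le> q y"
    using assms by (auto simp: tame_def)
  then have "real_polynomial_function (\<lambda>y. p y + q y)" "\<forall>y. \<bar>u y + v y\<bar> \<le> p y + q y"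
    by (auto intro: order_trans[OF abs_triangle_ineq] add_mono)
  then show ?thesis unfolding tame_def using assms[THEN tame_measurable] by auto
qed

lemma tame_mult:
  assumes "tame u" "tame v"
  shows "tame (\<lambda>y. u y * v y)"
proof -
  obtain p q where "real_polynomial_function p" "\<And>y. \<bar>u y\<bar> \<le> p y"
      "real_polynomial_function q" "\<And>y. \<bar>v y\<bar> \<le> q y"
    using assms by (auto simp: tame_def)
  then have "real_polynomial_function (\<lambda>y. p y * q y)" "\<forall>y. \<bar>u y * v y\<bar> \<le> p y * q y"
    by (auto simp: abs_mult intro!: mult_mono intro: order_trans[OF abs_ge_zero])
  then show ?thesis unfolding tame_def using assms[THEN tame_measurable] by auto
qed

lemma tame_scale: "tame u \<Longrightarrow> tame (\<lambda>y. c * u y)"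
  by (intro tame_mult tame_const)

lemma tame_diff: "tame u \<Longrightarrow> tame v \<Longrightarrow> tame (\<lambda>y. u y - v y)"
  using tame_add[of u "\<lambda>y. - 1 * v y"] tame_scale[of v "-1"] by simp

lemma tame_power: "tame u \<Longrightarrow> tame (\<lambda>y. u y ^ n)"
  by (induction n) (auto intro: tame_mult tame_const)

lemmas tame_intros = tame_add tame_diff tame_mult tame_power tame_const

text \<open>
  \<open>approximable W r u\<close>: in \<open>L\<^sup>2(W \<nu>)\<close> the distance of \<open>u\<close> to the polynomials is at most \<open>r\<close>. As a
  seminorm, this distance plays the part that the scalar product with a function orthogonal to all
  polynomials has in the usual density proofs.
\<close>

definition approximable :: "(real^'m \<Rightarrow> real) \<Rightarrow> real \<Rightarrow> (real^'m \<Rightarrow> real) \<Rightarrow> bool" where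
  "approximable W r u \<longleftrightarrow> tame u \<and> r \<ge> 0 \<and> (\<forall>e>0. \<exists>p. real_polynomial_function p \<and>
     (\<integral>y. (u y - p y)\<^sup>2 * W y \<partial>\<nu>) \<le> (r + e)\<^sup>2)"

lemma approximable_mono:
  assumes "approximable W r u" "r \<le> s"
  shows "approximable W s u"
  unfolding approximable_def
proof (intro conjI allI impI)
  show "tame u" "s \<ge> 0" using assms by (auto simp: approximable_def)
  fix e :: real assume e: "e > 0"
  then obtain p where "real_polynomial_function p" "(\<integral>y. (u y - p y)\<^sup>2 * W y \<partial>\<nu>) \<le> (r + e)\<^sup>2"
    using assms unfolding approximable_def by blast
  moreover have "(r + e)\<^sup>2 \<le> (s + e)\<^sup>2"
    using assms e by (intro power_mono) (auto simp: approximable_def)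
  ultimately show "\<exists>p. real_polynomial_function p \<and> (\<integral>y. (u y - p y)\<^sup>2 * W y \<partial>\<nu>) \<le> (s + e)\<^sup>2"
    by (meson order_trans)
qed

lemma approximable_zeroI:
  assumes "\<And>e. e > 0 \<Longrightarrow> approximable W e u"
  shows "approximable W 0 u"
  unfolding approximable_def
proof (intro conjI allI impI)
  show "tame u" using assms[of 1] by (simp add: approximable_def)
  fix e :: real assume "e > 0"
  then have "approximable W (e / 2) u" "e / 2 > 0" by (simp_all add: assms)
  then show "\<exists>p. real_polynomial_function p \<and> (\<integral>y. (u y - p y)\<^sup>2 * W y \<partial>\<nu>) \<le> (0 + e)\<^sup>2"
    unfolding approximable_def by (metis add.left_neutral field_sum_of_halves)
qed simp

lemma approximable_of_norm:
  assumes "tame u" "r \<ge> 0" "(\<integral>y. (u y)\<^sup>2 * W y \<partial>\<nu>) \<le> r\<^sup>2"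
  shows "approximable W r u"
  unfolding approximable_def
proof (intro conjI allI impI assms)
  fix e :: real assume "e > 0"
  then have "r\<^sup>2 \<le> (r + e)\<^sup>2" using assms(2) by (intro power_mono) auto
  then show "\<exists>p. real_polynomial_function p \<and> (\<integral>y. (u y - p y)\<^sup>2 * W y \<partial>\<nu>) \<le> (r + e)\<^sup>2"
    using assms(3) by (intro exI[of _ "\<lambda>y. 0"]) auto
qed

lemma approximable_polynomial: "real_polynomial_function p \<Longrightarrow> approximable W 0 p"
  unfolding approximable_def by (auto intro!: tame_polynomial)

lemma approximable_scale:
  assumes "approximable W r u"
  shows "approximable W (\<bar>c\<bar> * r) (\<lambda>y. c * u y)"
proof (cases "c = 0")
  case True
  then show ?thesis by (auto intro!: approximable_of_norm tame_const)
next
  case False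
  show ?thesis
    unfolding approximable_def
  proof (intro conjI allI impI)
    show "tame (\<lambda>y. c * u y)" "\<bar>c\<bar> * r \<ge> 0"
      using assms by (auto simp: approximable_def intro: tame_scale)
    fix e :: real assume "e > 0"
    then have "e / \<bar>c\<bar> > 0" using False by simp
    then obtain p where p: "real_polynomial_function p" "(\<integral>y. (u y - p y)\<^sup>2 * W y \<partial>\<nu>) \<le> (r + e / \<bar>c\<bar>)\<^sup>2"
      using assms unfolding approximable_def by blast
    have "(\<integral>y. (c * u y - c * p y)\<^sup>2 * W y \<partial>\<nu>) = (\<integral>y. c\<^sup>2 * ((u y - p y)\<^sup>2 * W y) \<partial>\<nu>)"
      by (intro Bochner_Integration.integral_cong) (simp_all add: power_mult_distrib flip: right_diff_distrib)
    also have "\<dots> = c\<^sup>2 * (\<integral>y. (u y - p y)\<^sup>2 * W y \<partial>\<nu>)"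
      by simp
    also have "\<dots> \<le> \<bar>c\<bar>\<^sup>2 * (r + e / \<bar>c\<bar>)\<^sup>2"
      unfolding power2_abs by (intro mult_left_mono p) auto
    also have "\<dots> = (\<bar>c\<bar> * r + e)\<^sup>2"
    proof -
      have "\<bar>c\<bar> * (r + e / \<bar>c\<bar>) = \<bar>c\<bar> * r + e"
        using False by (simp add: distrib_left)
      then show ?thesis by (simp only: power_mult_distrib[symmetric])
    qed
    finally show "\<exists>p. real_polynomial_function p \<and> (\<integral>y. (c * u y - p y)\<^sup>2 * W y \<partial>\<nu>) \<le> (\<bar>c\<bar> * r + e)\<^sup>2"
      using p(1) by (intro exI[of _ "\<lambda>y. c * p y"]) auto
  qed
qed

context
  fixes W :: "real^'m \<Rightarrow> real"
  assumes W: "real_polynomial_function W" and W0: "\<And>y. W y \<ge> 0"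
begin

text \<open>Minkowski's inequality, from \<open>(u + v)\<^sup>2 \<le> (1 + b/a) u\<^sup>2 + (1 + a/b) v\<^sup>2\<close>.\<close>

lemma minkowski:
  assumes u: "tame u" "(\<integral>y. (u y)\<^sup>2 * W y \<partial>\<nu>) \<le> a\<^sup>2" and v: "tame v" "(\<integral>y. (v y)\<^sup>2 * W y \<partial>\<nu>) \<le> b\<^sup>2"
    and "a > 0" "b > 0"
  shows "(\<integral>y. (u y + v y)\<^sup>2 * W y \<partial>\<nu>) \<le> (a + b)\<^sup>2"
proof -
  have int: "integrable \<nu> (\<lambda>y. (u y)\<^sup>2 * W y)" "integrable \<nu> (\<lambda>y. (v y)\<^sup>2 * W y)"
    "integrable \<nu> (\<lambda>y. (u y + v y)\<^sup>2 * W y)"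
    by (intro tame_integrable tame_intros u v tame_polynomial[OF W])+
  have young: "(s + t)\<^sup>2 \<le> (1 + b / a) * s\<^sup>2 + (1 + a / b) * t\<^sup>2" for s t :: real
  proof -
    have "0 \<le> (b * s - a * t)\<^sup>2 / (a * b)"
      using assms by simp
    also have "\<dots> = (1 + b / a) * s\<^sup>2 + (1 + a / b) * t\<^sup>2 - (s + t)\<^sup>2"
      using assms by (simp add: field_simps power2_eq_square)
    finally show ?thesis by simp
  qed
  have "(\<integral>y. (u y + v y)\<^sup>2 * W y \<partial>\<nu>) \<le>
      (\<integral>y. (1 + b / a) * ((u y)\<^sup>2 * W y) + (1 + a / b) * ((v y)\<^sup>2 * W y) \<partial>\<nu>)"
  proof (intro integral_mono int Bochner_Integration.integrable_add integrable_mult_right)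
    fix y
    show "(u y + v y)\<^sup>2 * W y \<le> (1 + b / a) * ((u y)\<^sup>2 * W y) + (1 + a / b) * ((v y)\<^sup>2 * W y)"
      using mult_right_mono[OF young[of "u y" "v y"] W0[of y]] by (simp add: distrib_right)
  qed
  also have "\<dots> = (1 + b / a) * (\<integral>y. (u y)\<^sup>2 * W y \<partial>\<nu>) + (1 + a / b) * (\<integral>y. (v y)\<^sup>2 * W y \<partial>\<nu>)"
    using int by simp
  also have "\<dots> \<le> (1 + b / a) * a\<^sup>2 + (1 + a / b) * b\<^sup>2"
    using assms by (intro add_mono mult_left_mono) auto
  also have "\<dots> = (a + b)\<^sup>2"
    using assms by (simp add: field_simps power2_eq_square)
  finally show ?thesis .
qed

lemma approximable_add:
  assumes u: "approximable W r u" and v: "approximable W s v"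
  shows "approximable W (r + s) (\<lambda>y. u y + v y)"
  unfolding approximable_def
proof (intro conjI allI impI)
  show "tame (\<lambda>y. u y + v y)" "r + s \<ge> 0"
    using assms by (auto simp: approximable_def intro: tame_add)
  fix e :: real assume e: "e > 0"
  obtain p where p: "real_polynomial_function p" "(\<integral>y. (u y - p y)\<^sup>2 * W y \<partial>\<nu>) \<le> (r + e / 2)\<^sup>2"
    using u e unfolding approximable_def by (meson half_gt_zero)
  obtain q where q: "real_polynomial_function q" "(\<integral>y. (v y - q y)\<^sup>2 * W y \<partial>\<nu>) \<le> (s + e / 2)\<^sup>2"
    using v e unfolding approximable_def by (meson half_gt_zero)
  have "(\<integral>y. ((u y - p y) + (v y - q y))\<^sup>2 * W y \<partial>\<nu>) \<le> ((r + e / 2) + (s + e / 2))\<^sup>2"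
    by (intro minkowski p q tame_diff tame_polynomial[OF p(1)] tame_polynomial[OF q(1)])
      (use u v e in \<open>auto simp: approximable_def\<close>)
  then have "(\<integral>y. (u y + v y - (p y + q y))\<^sup>2 * W y \<partial>\<nu>) \<le> (r + s + e)\<^sup>2"
    by (simp add: algebra_simps)
  then show "\<exists>p. real_polynomial_function p \<and> (\<integral>y. (u y + v y - p y)\<^sup>2 * W y \<partial>\<nu>) \<le> (r + s + e)\<^sup>2"
    using p q by (intro exI[of _ "\<lambda>y. p y + q y"]) auto
qed

lemma approximable_sum:
  assumes "finite A" "\<And>i. i \<in> A \<Longrightarrow> approximable W (r i) (u i)"
  shows "approximable W (\<Sum>i\<in>A. r i) (\<lambda>y. \<Sum>i\<in>A. u i y)"
  using assms
proof (induction A rule: finite_induct)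
  case empty
  show ?case by (simp add: approximable_polynomial real_polynomial_function.intros(2))
qed (simp add: approximable_add)

lemma approximable_AE_polynomial:
  assumes "tame u" "real_polynomial_function p" "AE y in \<nu>. u y = p y"
  shows "approximable W 0 u"
proof -
  have "(\<integral>y. (u y - p y)\<^sup>2 * W y \<partial>\<nu>) = (\<integral>y. 0 \<partial>\<nu>)"
  proof (rule integral_cong_AE)
    show "(\<lambda>y. (u y - p y)\<^sup>2 * W y) \<in> borel_measurable \<nu>"
      by (intro tame_measurable tame_intros assms(1) tame_polynomial[OF W] tame_polynomial[OF assms(2)])
  qed (use assms(3) in auto)
  then show ?thesis
    unfolding approximable_def using assms by auto
qed

end

end

section \<open>Bang's argument\<close>

lemma cos_taylor:
  fixes x a :: real
  shows "\<bar>cos (x + a) - (\<Sum>i<k. x ^ i / fact i * cos (a + real i * pi / 2))\<bar> \<le> \<bar>x\<bar> ^ k / fact k"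
proof -
  let ?d = "\<lambda>m t. cos (t + a + real m * pi / 2)"
  have "\<exists>t. \<bar>t\<bar> \<le> \<bar>x\<bar> \<and> cos (x + a) = (\<Sum>m<k. ?d m 0 / fact m * x ^ m) + ?d k t / fact k * x ^ k"
  proof (rule Maclaurin_all_le)
    show "\<forall>m x. DERIV (?d m) x :> ?d (Suc m) x"
    proof (intro allI)
      fix m x
      have "?d (Suc m) x = cos (x + a + real m * pi / 2 + pi / 2)"
        by (simp add: field_simps)
      also have "\<dots> = - sin (x + a + real m * pi / 2)"
        by (simp add: cos_add)
      finally show "DERIV (?d m) x :> ?d (Suc m) x"
        by (auto intro!: derivative_eq_intros)
    qed
  qed simp
  then obtain t where t: "cos (x + a) = (\<Sum>m<k. ?d m 0 / fact m * x ^ m) + ?d k t / fact k * x ^ k"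
    by blast
  have "cos (x + a) - (\<Sum>i<k. x ^ i / fact i * cos (a + real i * pi / 2)) = ?d k t / fact k * x ^ k"
    unfolding t by (simp add: mult.commute)
  also have "\<bar>\<dots>\<bar> = \<bar>?d k t\<bar> * (\<bar>x\<bar> ^ k / fact k)"
    by (simp add: abs_mult power_abs)
  also have "\<dots> \<le> 1 * (\<bar>x\<bar> ^ k / fact k)"
    by (intro mult_right_mono) auto
  finally show ?thesis by simp
qed

text \<open>The \<open>n\<close>-th derivative with respect to \<open>s\<close> of \<open>cos (s y\<^sub>j + b)\<close>.\<close>

definition cos_deriv :: "'m \<Rightarrow> real \<Rightarrow> nat \<Rightarrow> real \<Rightarrow> real^'m \<Rightarrow> real" where
  "cos_deriv j b n s y = (y $ j) ^ n * cos (s * y $ j + b + real n * pi / 2)"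

lemma cos_deriv_taylor:
  "\<bar>cos_deriv j b n (s + h) y - (\<Sum>i<k. h ^ i / fact i * cos_deriv j b (n + i) s y)\<bar>
    \<le> \<bar>h\<bar> ^ k / fact k * \<bar>y $ j\<bar> ^ (n + k)"
proof -
  let ?a = "s * y $ j + b + real n * pi / 2"
  have "cos_deriv j b n (s + h) y = (y $ j) ^ n * cos (h * y $ j + ?a)"
    by (simp add: cos_deriv_def algebra_simps)
  moreover have "h ^ i / fact i * cos_deriv j b (n + i) s y =
      (y $ j) ^ n * ((h * y $ j) ^ i / fact i * cos (?a + real i * pi / 2))" for i
    by (simp add: cos_deriv_def power_add power_mult_distrib add_divide_distrib algebra_simps)
  ultimately have "\<bar>cos_deriv j b n (s + h) y - (\<Sum>i<k. h ^ i / fact i * cos_deriv j b (n + i) s y)\<bar> =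
      \<bar>y $ j\<bar> ^ n * \<bar>cos (h * y $ j + ?a) - (\<Sum>i<k. (h * y $ j) ^ i / fact i * cos (?a + real i * pi / 2))\<bar>"
    by (simp only: sum_distrib_left[symmetric] right_diff_distrib[symmetric] abs_mult power_abs)
  also have "\<dots> \<le> \<bar>y $ j\<bar> ^ n * (\<bar>h * y $ j\<bar> ^ k / fact k)"
    by (intro mult_left_mono cos_taylor) auto
  also have "\<dots> = \<bar>h\<bar> ^ k / fact k * \<bar>y $ j\<bar> ^ (n + k)"
    by (simp add: abs_mult power_mult_distrib power_add)
  finally show ?thesis .
qed

lemma exp_partial_sum_le:
  fixes x :: real
  assumes "x \<ge> 0"
  shows "(\<Sum>i<k. x ^ i / fact i) \<le> exp x"
proof -
  have "(\<lambda>n. x ^ n / fact n) sums exp x"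
    using exp_converges[of x] by (simp add: divide_inverse mult.commute)
  then show ?thesis
    using sum_le_suminf[of "\<lambda>n. x ^ n / fact n" "{..<k}"] assms
    by (auto simp: sums_iff)
qed

context moment_measure
begin

lemma tame_cos_deriv: "tame (cos_deriv j b n s)"
  unfolding cos_deriv_def[abs_def]
proof (rule tame_mult[OF tame_power[OF tame_polynomial[OF coordinate_polynomial_function]]])
  show "tame (\<lambda>y. cos (s * y $ j + b + real n * pi / 2))"
    by (rule tame_bounded[of _ 1]) (auto intro!: borel_measurable_continuous_onI continuous_intros
        cong: measurable_cong_sets)
qed

context
  fixes W :: "real^'m \<Rightarrow> real" and j :: 'm and b :: real and M :: "nat \<Rightarrow> real"
  assumes W: "real_polynomial_function W" and W0: "\<And>y. W y \<ge> 0"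
    and M0: "\<And>n. M n > 0"
    and M_norm: "\<And>n. (\<integral>y. (y $ j) ^ (2 * n) * W y \<partial>\<nu>) \<le> (M n)\<^sup>2"
    and M_ratio: "\<And>i l. i \<le> l \<Longrightarrow> M (Suc i) / M i \<le> M (Suc l) / M l"
begin

lemma ratio_power:
  assumes "n + i \<le> Suc K"
  shows "M (n + i) \<le> M n * (M (Suc K) / M K) ^ i"
  using assms
proof (induction i)
  case (Suc i)
  let ?r = "M (Suc K) / M K"
  have r: "?r > 0" using M0 by simp
  have "M (n + Suc i) = M (n + i) * (M (Suc (n + i)) / M (n + i))"
    using M0[of "n + i"] by simp
  also have "\<dots> \<le> (M n * ?r ^ i) * ?r"
    using Suc M_ratio[of "n + i" K] M0 r by (intro mult_mono) (auto simp: less_imp_le)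
  finally show ?case by (simp add: mult_ac)
qed simp

text \<open>
  One step of size \<open>h\<close>. The bounds \<open>B e\<^sup>n M\<^sub>n\<close> on the derivatives of order \<open>n \<le> K\<close> together with the
  trivial bound \<open>M\<^sub>K\<^sub>+\<^sub>1 \<le> B e\<^sup>K\<^sup>+\<^sup>1 M\<^sub>K\<^sub>+\<^sub>1\<close> in the remainder make the Taylor expansion of order \<open>K + 1\<close> a
  partial sum of an exponential series.
\<close>

lemma bang_step:
  assumes B: "B \<ge> exp (- real (Suc K))" and h: "h \<ge> 0"
    and app: "\<And>n. n \<le> K \<Longrightarrow> approximable W (B * exp (real n) * M n) (cos_deriv j b n s)"
    and n: "n \<le> K"
  shows "approximable W (B * exp (exp 1 * h * (M (Suc K) / M K)) * exp (real n) * M n)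
    (cos_deriv j b n (s + h))"
proof -
  define k where "k = Suc K - n"
  have nk: "n + k = Suc K" using n by (simp add: k_def)
  define \<rho> where "\<rho> = M (Suc K) / M K"
  have \<rho>: "\<rho> > 0" using M0 by (simp add: \<rho>_def)
  have B0: "B > 0" using B by (rule less_le_trans[OF exp_gt_zero])
  define R where "R y = cos_deriv j b n (s + h) y - (\<Sum>i<k. h ^ i / fact i * cos_deriv j b (n + i) s y)" for y
  have sum_app: "approximable W (\<Sum>i<k. \<bar>h ^ i / fact i\<bar> * (B * exp (real (n + i)) * M (n + i)))
      (\<lambda>y. \<Sum>i<k. h ^ i / fact i * cos_deriv j b (n + i) s y)"
    using nk by (intro approximable_sum[OF W W0] approximable_scale app) auto
  then have R_tame: "tame R"
    unfolding R_def[abs_def] by (intro tame_diff tame_cos_deriv) (simp add: approximable_def)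
  have R_app: "approximable W (h ^ k / fact k * M (Suc K)) R"
  proof (rule approximable_of_norm[OF R_tame])
    show "h ^ k / fact k * M (Suc K) \<ge> 0"
      using h M0 by (simp add: less_imp_le)
    have tame_bound: "tame (\<lambda>y. (h ^ k / fact k)\<^sup>2 * ((y $ j) ^ (2 * Suc K) * W y))"
      by (intro tame_scale tame_mult tame_power tame_polynomial[OF W] tame_polynomial[OF coordinate_polynomial_function])
    have "(\<integral>y. (R y)\<^sup>2 * W y \<partial>\<nu>) \<le> (\<integral>y. (h ^ k / fact k)\<^sup>2 * ((y $ j) ^ (2 * Suc K) * W y) \<partial>\<nu>)"
    proof (rule integral_mono)
      show "integrable \<nu> (\<lambda>y. (R y)\<^sup>2 * W y)"
        by (intro tame_integrable tame_mult tame_power R_tame tame_polynomial[OF W])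
      fix y
      have "\<bar>R y\<bar> \<le> h ^ k / fact k * \<bar>y $ j\<bar> ^ Suc K"
        unfolding R_def using cos_deriv_taylor[of j b n s h y k] h nk by simp
      then have "\<bar>R y\<bar>\<^sup>2 \<le> (h ^ k / fact k * \<bar>y $ j\<bar> ^ Suc K)\<^sup>2"
        by (rule power_mono) simp
      also have "\<dots> = (h ^ k / fact k)\<^sup>2 * (\<bar>y $ j\<bar>\<^sup>2) ^ Suc K"
        by (simp only: power_mult_distrib power_mult[symmetric] mult.commute)
      also have "\<dots> = (h ^ k / fact k)\<^sup>2 * (y $ j) ^ (2 * Suc K)"
        by (simp only: power2_abs power_mult)
      finally show "(R y)\<^sup>2 * W y \<le> (h ^ k / fact k)\<^sup>2 * ((y $ j) ^ (2 * Suc K) * W y)"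
        using W0[of y] by (simp only: power2_abs mult.assoc[symmetric] mult_right_mono)
    qed (rule tame_integrable[OF tame_bound])
    also have "\<dots> = (h ^ k / fact k)\<^sup>2 * (\<integral>y. (y $ j) ^ (2 * Suc K) * W y \<partial>\<nu>)"
      by (rule integral_mult_right_zero)
    also have "\<dots> \<le> (h ^ k / fact k)\<^sup>2 * (M (Suc K))\<^sup>2"
      by (intro mult_left_mono M_norm) simp
    finally show "(\<integral>y. (R y)\<^sup>2 * W y \<partial>\<nu>) \<le> (h ^ k / fact k * M (Suc K))\<^sup>2"
      by (simp only: power_mult_distrib)
  qed
  have "approximable W ((\<Sum>i<k. \<bar>h ^ i / fact i\<bar> * (B * exp (real (n + i)) * M (n + i))) +
      h ^ k / fact k * M (Suc K)) (cos_deriv j b n (s + h))"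
    using approximable_add[OF W W0 sum_app R_app] by (simp add: R_def)
  then show ?thesis
  proof (rule approximable_mono)
    have summand: "h ^ i / fact i * (B * exp (real (n + i)) * M (n + i)) \<le>
        B * exp (real n) * M n * ((exp 1 * h * \<rho>) ^ i / fact i)" if "n + i \<le> Suc K" for i
    proof -
      have "h ^ i / fact i * (B * exp (real (n + i)) * M (n + i)) \<le>
          h ^ i / fact i * (B * exp (real (n + i)) * (M n * \<rho> ^ i))"
        using ratio_power[OF that] h B0 by (intro mult_left_mono) (auto simp: \<rho>_def)
      also have "\<dots> = B * exp (real n) * M n * ((exp 1 * h * \<rho>) ^ i / fact i)"
        by (simp add: exp_add power_mult_distrib exp_of_nat_mult[of i 1, simplified] mult_ac)
      finally show ?thesis .
    qed
    have "h ^ k / fact k * M (Suc K) = h ^ k / fact k * (exp (- real (Suc K)) * exp (real (n + k)) * M (n + k))"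
      by (simp add: nk flip: exp_add)
    also have "\<dots> \<le> h ^ k / fact k * (B * exp (real (n + k)) * M (n + k))"
      using B h M0 by (intro mult_left_mono mult_right_mono) (auto simp: less_imp_le)
    finally have "(\<Sum>i<k. \<bar>h ^ i / fact i\<bar> * (B * exp (real (n + i)) * M (n + i))) + h ^ k / fact k * M (Suc K) \<le>
        (\<Sum>i<Suc k. h ^ i / fact i * (B * exp (real (n + i)) * M (n + i)))"
      using h by simp
    also have "\<dots> \<le> (\<Sum>i<Suc k. B * exp (real n) * M n * ((exp 1 * h * \<rho>) ^ i / fact i))"
      using nk by (intro sum_mono summand) auto
    also have "\<dots> = B * exp (real n) * M n * (\<Sum>i<Suc k. (exp 1 * h * \<rho>) ^ i / fact i)"
      by (simp only: sum_distrib_left)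
    also have "\<dots> \<le> B * exp (real n) * M n * exp (exp 1 * h * \<rho>)"
      using B0 M0 h \<rho> by (intro mult_left_mono exp_partial_sum_le) (auto simp: less_imp_le)
    finally show "(\<Sum>i<k. \<bar>h ^ i / fact i\<bar> * (B * exp (real (n + i)) * M (n + i))) + h ^ k / fact k * M (Suc K) \<le>
        B * exp (exp 1 * h * (M (Suc K) / M K)) * exp (real n) * M n"
      by (simp only: \<rho>_def mult_ac)
  qed
qed

text \<open>
  At \<open>s = 0\<close> all derivatives are polynomials. Starting there with \<open>B = e\<^sup>-\<^sup>N\<close>, a step of size
  \<open>M\<^sub>K / (e M\<^sub>K\<^sub>+\<^sub>1)\<close> multiplies \<open>B\<close> by at most \<open>e\<close>, at the price of one order of differentiation.
\<close>

lemma bang_iterate: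
  assumes "k \<le> N" and "0 \<le> s" "s \<le> (\<Sum>n=k..<N. M n / (exp 1 * M (Suc n)))" and "n < k"
  shows "approximable W (exp (- real k) * exp (real n) * M n) (cos_deriv j b n s)"
  using assms
proof (induction k arbitrary: s n rule: inc_induct)
  case base
  then have "s = 0" by simp
  have "cos_deriv j b n 0 = (\<lambda>y. (y $ j) ^ n * cos (b + real n * pi / 2))"
    by (simp add: cos_deriv_def fun_eq_iff)
  moreover have "real_polynomial_function (\<lambda>y. (y $ j) ^ n * cos (b + real n * pi / 2))"
    by (intro real_polynomial_function.intros(2,4) real_polynomial_function_power
        coordinate_polynomial_function)
  ultimately have "approximable W 0 (cos_deriv j b n 0)"
    using approximable_polynomial by simp
  then show ?case
    unfolding \<open>s = 0\<close> by (rule approximable_mono) (use M0[of n] in simp)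
next
  case (step k)
  let ?S = "\<Sum>n=Suc k..<N. M n / (exp 1 * M (Suc n))"
  define s' where "s' = min s ?S"
  define h where "h = s - s'"
  have "0 \<le> ?S" using M0 by (intro sum_nonneg) (auto simp: less_imp_le)
  then have s': "0 \<le> s'" "s' \<le> ?S" using step.prems by (auto simp: s'_def)
  have h: "0 \<le> h" "h \<le> M k / (exp 1 * M (Suc k))"
    using step.prems step.hyps M0[of k] M0[of "Suc k"]
    by (auto simp: h_def s'_def sum.atLeast_Suc_lessThan min_def)
  have "approximable W (exp (- real (Suc k)) * exp (exp 1 * h * (M (Suc k) / M k)) * exp (real n) * M n)
      (cos_deriv j b n (s' + h))"
    using step.prems s' by (intro bang_step[OF order_refl h(1)] step.IH) auto
  moreover have "exp 1 * h * (M (Suc k) / M k) \<le> 1"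
    using h(2) M0[of k] M0[of "Suc k"] by (simp add: field_simps)
  then have "exp (- real (Suc k)) * exp (exp 1 * h * (M (Suc k) / M k)) \<le> exp (- real k)"
    by (simp flip: exp_add)
  then have "exp (- real (Suc k)) * exp (exp 1 * h * (M (Suc k) / M k)) * exp (real n) * M n
      \<le> exp (- real k) * exp (real n) * M n"
    using M0[of n] by (intro mult_right_mono) auto
  ultimately show ?case
    unfolding h_def by (auto intro: approximable_mono)
qed

text \<open>
  Since the tails of the series diverge, every \<open>s\<close> is reached while \<open>k\<close> orders of differentiation are
  left, and the distance at \<open>s\<close> is at most \<open>e\<^sup>-\<^sup>k M\<^sub>0\<close> for every \<open>k\<close>.
\<close>

lemma cos_approximable_of_ratio_series:
  assumes div: "\<not> summable (\<lambda>n. M n / M (Suc n))" and s: "s \<ge> 0"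
  shows "approximable W 0 (\<lambda>y. cos (s * y $ j + b))"
proof (rule approximable_zeroI)
  fix e :: real assume e: "e > 0"
  obtain k :: nat where k: "k > 0" "exp (- real k) * M 0 \<le> e"
  proof -
    obtain k :: nat where "M 0 / e < real k"
      using reals_Archimedean2 by blast
    moreover have "real k \<le> exp (real k)"
      using exp_ge_add_one_self[of "real k"] by linarith
    ultimately have "M 0 / e < exp (real k)" by linarith
    then have "exp (- real k) * M 0 \<le> e"
      using e by (simp add: exp_minus field_simps)
    moreover have "k > 0"
    proof (rule ccontr)
      assume "\<not> k > 0"
      then have "M 0 / e < 0" using \<open>M 0 / e < real k\<close> by simp
      with e M0[of 0] show False by (simp add: divide_less_0_iff)
    qed
    ultimately show ?thesis by (rule that[rotated])
  qed
  let ?a = "\<lambda>n. M n / (exp 1 * M (Suc n))"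
  have a0: "?a n \<ge> 0" for n using M0 by (simp add: less_imp_le)
  have "\<exists>N\<ge>k. s \<le> (\<Sum>n=k..<N. ?a n)"
  proof (rule ccontr)
    assume "\<not> ?thesis"
    then have *: "(\<Sum>n=k..<N. ?a n) < s" if "N \<ge> k" for N using that by force
    have "summable ?a"
    proof (rule summableI_nonneg_bounded[OF a0])
      fix N
      have "(\<Sum>i<N. ?a i) \<le> (\<Sum>i\<in>{..<k} \<union> {k..<max k N}. ?a i)"
        by (intro sum_mono2) (use a0 in auto)
      also have "\<dots> = (\<Sum>i<k. ?a i) + (\<Sum>i=k..<max k N. ?a i)"
        by (intro sum.union_disjoint) auto
      also have "\<dots> \<le> (\<Sum>i<k. ?a i) + s"
        using *[of "max k N"] by simp
      finally show "(\<Sum>i<N. ?a i) \<le> (\<Sum>i<k. ?a i) + s" .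
    qed
    from summable_mult[OF this, of "exp 1"] div show False by simp
  qed
  then obtain N where N: "k \<le> N" "s \<le> (\<Sum>n=k..<N. ?a n)" by blast
  have "approximable W (exp (- real k) * exp (real 0) * M 0) (cos_deriv j b 0 s)"
    by (rule bang_iterate[OF N(1) s N(2) k(1)])
  then have "approximable W (exp (- real k) * M 0) (\<lambda>y. cos (s * y $ j + b))"
    by (simp add: cos_deriv_def[abs_def])
  then show "approximable W e (\<lambda>y. cos (s * y $ j + b))"
    by (rule approximable_mono) (rule k(2))
qed

end

end

section \<open>Measures satisfying the Carleman condition\<close>

context moment_measure
begin

lemma cauchy_schwarz_tame:
  assumes u: "tame u" and v: "tame v"
  shows "(\<integral>y. u y * v y \<partial>\<nu>)\<^sup>2 \<le> (\<integral>y. (u y)\<^sup>2 \<partial>\<nu>) * (\<integral>y. (v y)\<^sup>2 \<partial>\<nu>)"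
proof -
  let ?A = "\<integral>y. (u y)\<^sup>2 \<partial>\<nu>" and ?B = "\<integral>y. u y * v y \<partial>\<nu>" and ?C = "\<integral>y. (v y)\<^sup>2 \<partial>\<nu>"
  have int: "integrable \<nu> (\<lambda>y. (u y)\<^sup>2)" "integrable \<nu> (\<lambda>y. u y * v y)" "integrable \<nu> (\<lambda>y. (v y)\<^sup>2)"
    by (intro tame_integrable tame_power tame_mult u v)+
  have quad: "0 \<le> ?A - 2 * t * ?B + t\<^sup>2 * ?C" for t
  proof -
    have "0 \<le> (\<integral>y. (u y - t * v y)\<^sup>2 \<partial>\<nu>)"
      by (rule Bochner_Integration.integral_nonneg) simp
    also have "\<dots> = (\<integral>y. (u y)\<^sup>2 - 2 * t * (u y * v y) + t\<^sup>2 * (v y)\<^sup>2 \<partial>\<nu>)"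
      by (intro Bochner_Integration.integral_cong) (simp_all add: power2_eq_square algebra_simps)
    also have "\<dots> = ?A - 2 * t * ?B + t\<^sup>2 * ?C"
      using int by simp
    finally show ?thesis .
  qed
  have "?C \<ge> 0" by (rule Bochner_Integration.integral_nonneg) simp
  show ?thesis
  proof (cases "?C = 0")
    case True
    have "?B = 0"
    proof (rule ccontr)
      assume B: "?B \<noteq> 0"
      with quad[of "(?A + 1) / (2 * ?B)"] True show False by simp
    qed
    with True show ?thesis by simp
  next
    case False
    with \<open>?C \<ge> 0\<close> have C: "?C > 0" by linarith
    have "0 \<le> (?A - 2 * (?B / ?C) * ?B + (?B / ?C)\<^sup>2 * ?C) * ?C"
      using C by (intro mult_nonneg_nonneg quad) simp
    also have "\<dots> = ?A * ?C - ?B\<^sup>2"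
      using C by (simp add: field_simps power2_eq_square)
    finally show ?thesis by simp
  qed
qed

text \<open>
  Bang's argument applies with \<open>M\<^sub>n\<^sup>2 = C (\<integral> y\<^sub>j\<^sup>4\<^sup>n d\<nu>)\<^sup>1\<^sup>/\<^sup>2\<close>, where \<open>C\<close> bounds the norm of the weight in
  \<open>L\<^sup>2(\<nu>)\<close>. If a moment vanishes, then \<open>y\<^sub>j = 0\<close> almost everywhere and the cosine is almost everywhere
  constant.
\<close>

lemma cos_approximable:
  assumes carleman: "carleman \<nu>" and W: "real_polynomial_function W" and W0: "\<And>y. W y \<ge> 0" and s: "s \<ge> 0"
  shows "approximable W 0 (\<lambda>y. cos (s * y $ j + b))"
proof -
  define m where "m d = (\<integral>y. (y $ j) ^ (2 * d) \<partial>\<nu>)" for d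
  have tame_j: "tame (\<lambda>y. (y $ j) ^ n)" for n
    by (intro tame_power tame_polynomial coordinate_polynomial_function)
  have m_nonneg: "m d \<ge> 0" for d
    unfolding m_def by (rule Bochner_Integration.integral_nonneg) simp
  have m_cs: "(m (d + e))\<^sup>2 \<le> m (2 * d) * m (2 * e)" for d e
    using cauchy_schwarz_tame[OF tame_j[of "2 * d"] tame_j[of "2 * e"]]
    by (simp add: m_def power_add[symmetric] power_mult[symmetric] distrib_left mult.commute)
  have m_lc: "(m (Suc d))\<^sup>2 \<le> m d * m (Suc (Suc d))" for d
    using cauchy_schwarz_tame[OF tame_j[of d] tame_j[of "Suc (Suc d)"]]
    by (simp add: m_def power_add[symmetric] power_mult[symmetric] mult.commute flip: mult_2_right power_Suc)
  show ?thesis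
  proof (cases "\<exists>d. m d = 0")
    case True
    then obtain d where "m d = 0" by blast
    then have "AE y in \<nu>. (y $ j) ^ (2 * d) = 0"
      unfolding m_def by (subst (asm) integral_nonneg_eq_0_iff_AE[OF tame_integrable[OF tame_j]]) auto
    then have "AE y in \<nu>. cos (s * y $ j + b) = cos b"
      by eventually_elim auto
    then show ?thesis
      using tame_cos_deriv[of j b 0 s]
      by (intro approximable_AE_polynomial[OF W W0, of _ "\<lambda>y. cos b"])
        (auto simp: cos_deriv_def[abs_def])
  next
    case False
    then have m_pos: "m d > 0" for d
      using m_nonneg[of d] by (metis less_eq_real_def)
    have "\<not> summable (\<lambda>n. m (Suc n) powr (- 1 / (2 * real (Suc n))))"
    proof
      assume "summable (\<lambda>n. m (Suc n) powr (- 1 / (2 * real (Suc n))))"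
      then have "suminf (\<lambda>n. ennreal (m (Suc n) powr (- 1 / (2 * real (Suc n))))) \<noteq> \<infinity>"
        unfolding infinity_ennreal_def by (intro ennreal_suminf_neq_top) auto
      moreover have "carleman_term \<nu> j (Suc n) = ennreal (m (Suc n) powr (- 1 / (2 * real (Suc n))))" for n
        using m_pos[of "Suc n"] unfolding carleman_term_def Let_def m_def[symmetric] by simp
      ultimately show False
        using carleman[unfolded carleman_def, rule_format, of j] by simp
    qed
    from carleman_fourth_root_series_diverges[OF m_pos m_lc this]
    have div: "\<not> summable (\<lambda>n. sqrt (sqrt (m (2 * n))) / sqrt (sqrt (m (2 * Suc n))))" .
    define C where "C = sqrt (\<integral>y. (W y)\<^sup>2 \<partial>\<nu>) + 1"
    have C: "C > 0" by (simp add: C_def add_nonneg_pos)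
    define M where "M n = sqrt C * sqrt (sqrt (m (2 * n)))" for n
    show ?thesis
    proof (rule cos_approximable_of_ratio_series[OF W W0])
      show M_pos: "M n > 0" for n
        using C m_pos by (simp add: M_def)
      show "(\<integral>y. (y $ j) ^ (2 * n) * W y \<partial>\<nu>) \<le> (M n)\<^sup>2" for n
      proof -
        have "(\<integral>y. (y $ j) ^ (2 * n) * W y \<partial>\<nu>)\<^sup>2 \<le> m (2 * n) * (\<integral>y. (W y)\<^sup>2 \<partial>\<nu>)"
          using cauchy_schwarz_tame[OF tame_j[of "2 * n"] tame_polynomial[OF W]]
          by (simp add: m_def power_mult[symmetric] mult_ac)
        then have "(\<integral>y. (y $ j) ^ (2 * n) * W y \<partial>\<nu>) \<le> sqrt (m (2 * n) * (\<integral>y. (W y)\<^sup>2 \<partial>\<nu>))"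
          by (rule real_le_rsqrt)
        also have "\<dots> = sqrt (\<integral>y. (W y)\<^sup>2 \<partial>\<nu>) * sqrt (m (2 * n))"
          by (simp add: real_sqrt_mult)
        also have "\<dots> \<le> C * sqrt (m (2 * n))"
          using m_nonneg by (intro mult_right_mono) (auto simp: C_def)
        also have "\<dots> = (M n)\<^sup>2"
          using C m_nonneg by (simp add: M_def power_mult_distrib)
        finally show ?thesis .
      qed
      show "M (Suc i) / M i \<le> M (Suc l) / M l" if "i \<le> l" for i l
      proof -
        have "m (2 * Suc i) / m (2 * i) \<le> m (2 * Suc l) / m (2 * l)"
        proof (rule log_convex_ratio_mono[of "\<lambda>n. m (2 * n)", OF m_pos _ that])
          show "(m (2 * Suc d))\<^sup>2 \<le> m (2 * d) * m (2 * Suc (Suc d))" for d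
          proof -
            have "d + Suc (Suc d) = 2 * Suc d" by simp
            with m_cs[of d "Suc (Suc d)"] show ?thesis by (simp only:)
          qed
        qed
        then have "sqrt (sqrt (m (2 * Suc i) / m (2 * i))) \<le> sqrt (sqrt (m (2 * Suc l) / m (2 * l)))"
          by (intro real_sqrt_le_mono)
        then show ?thesis
          using C by (simp add: M_def real_sqrt_divide)
      qed
      show "\<not> summable (\<lambda>n. M n / M (Suc n))"
        using div C by (simp add: M_def)
    qed (rule s)
  qed
qed

text \<open>
  The bounded functions that are limits of polynomials in \<open>L\<^sup>2(W \<nu>)\<close> for every polynomial weight
  \<open>W\<close>. Allowing all weights at once makes this class an algebra.
\<close>

definition in_polynomial_closure :: "(real^'m \<Rightarrow> real) \<Rightarrow> bool" where
  "in_polynomial_closure u \<longleftrightarrow> u \<in> borel_measurable \<nu> \<and> (\<exists>B. \<forall>y. \<bar>u y\<bar> \<le> B) \<and>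
     (\<forall>W. real_polynomial_function W \<longrightarrow> (\<forall>y. W y \<ge> 0) \<longrightarrow> approximable W 0 u)"

lemma in_polynomial_closureD:
  assumes "in_polynomial_closure u"
  shows "u \<in> borel_measurable \<nu>" "\<exists>B>0. \<forall>y. \<bar>u y\<bar> \<le> B" "tame u"
    "\<And>W. real_polynomial_function W \<Longrightarrow> (\<And>y. W y \<ge> 0) \<Longrightarrow> approximable W 0 u"
proof -
  obtain B where B: "\<And>y. \<bar>u y\<bar> \<le> B"
    using assms by (auto simp: in_polynomial_closure_def)
  have "\<forall>y. \<bar>u y\<bar> \<le> max B 1" using B by (simp add: le_max_iff_disj)
  then show "\<exists>B>0. \<forall>y. \<bar>u y\<bar> \<le> B" by (intro exI[of _ "max B 1"]) auto
  show "tame u" using assms B by (auto simp: in_polynomial_closure_def intro: tame_bounded)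
qed (use assms in \<open>auto simp: in_polynomial_closure_def\<close>)

lemma in_polynomial_closure_const: "in_polynomial_closure (\<lambda>y. c)"
  unfolding in_polynomial_closure_def by (auto intro!: approximable_polynomial)

lemma in_polynomial_closure_add:
  assumes "in_polynomial_closure u" "in_polynomial_closure v"
  shows "in_polynomial_closure (\<lambda>y. u y + v y)"
proof -
  obtain A B where "\<forall>y. \<bar>u y\<bar> \<le> A" "\<forall>y. \<bar>v y\<bar> \<le> B"
    using assms[THEN in_polynomial_closureD(2)] by blast
  then have "\<forall>y. \<bar>u y + v y\<bar> \<le> A + B"
    by (auto intro: order_trans[OF abs_triangle_ineq] add_mono)
  moreover have "approximable W 0 (\<lambda>y. u y + v y)"
    if "real_polynomial_function W" "\<forall>y. W y \<ge> 0" for W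
    using approximable_add[of W 0 u 0 v] that assms[THEN in_polynomial_closureD(4)] by simp
  ultimately show ?thesis
    using assms[THEN in_polynomial_closureD(1)] unfolding in_polynomial_closure_def by auto
qed

lemma in_polynomial_closure_mult:
  assumes u: "in_polynomial_closure u" and v: "in_polynomial_closure v"
  shows "in_polynomial_closure (\<lambda>y. u y * v y)"
proof -
  obtain A where A: "A > 0" "\<And>y. \<bar>u y\<bar> \<le> A" using in_polynomial_closureD(2)[OF u] by blast
  obtain B where B: "B > 0" "\<And>y. \<bar>v y\<bar> \<le> B" using in_polynomial_closureD(2)[OF v] by blast
  have "\<bar>u y * v y\<bar> \<le> A * B" for y
    using A B unfolding abs_mult by (intro mult_mono) auto
  moreover have "approximable W 0 (\<lambda>y. u y * v y)"
    if W: "real_polynomial_function W" and W0: "\<And>y. W y \<ge> 0" for W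
  proof (rule approximable_zeroI)
    fix e :: real assume e: "e > 0"
    \<comment> \<open>\<open>u v = u (v - q) + u q\<close> with \<open>q\<close> close to \<open>v\<close>; then \<open>u\<close> is approximated for the weight \<open>q\<^sup>2 W\<close>\<close>
    obtain q where q: "real_polynomial_function q" "(\<integral>y. (v y - q y)\<^sup>2 * W y \<partial>\<nu>) \<le> (0 + e / A)\<^sup>2"
      using in_polynomial_closureD(4)[OF v W W0] e A(1) unfolding approximable_def
      by (meson divide_pos_pos)
    have tame_vq: "tame (\<lambda>y. v y - q y)"
      by (intro tame_diff in_polynomial_closureD[OF v] tame_polynomial q)
    have "approximable W e (\<lambda>y. u y * (v y - q y))"
    proof (rule approximable_of_norm)
      show "tame (\<lambda>y. u y * (v y - q y))"
        by (intro tame_mult tame_vq in_polynomial_closureD[OF u])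
      have "(\<integral>y. (u y * (v y - q y))\<^sup>2 * W y \<partial>\<nu>) \<le> (\<integral>y. A\<^sup>2 * ((v y - q y)\<^sup>2 * W y) \<partial>\<nu>)"
      proof (intro integral_mono tame_integrable tame_mult[OF tame_const] tame_mult[OF tame_power]
          tame_vq tame_polynomial[OF W] tame_mult[of u] in_polynomial_closureD(3)[OF u])
        fix y
        have "(u y)\<^sup>2 \<le> A\<^sup>2"
          using power_mono[OF A(2)[of y], of 2] by simp
        then show "(u y * (v y - q y))\<^sup>2 * W y \<le> A\<^sup>2 * ((v y - q y)\<^sup>2 * W y)"
          using W0[of y] by (simp add: power_mult_distrib mult.assoc mult_right_mono)
      qed
      also have "\<dots> = A\<^sup>2 * (\<integral>y. (v y - q y)\<^sup>2 * W y \<partial>\<nu>)" by simp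
      also have "\<dots> \<le> A\<^sup>2 * (0 + e / A)\<^sup>2"
        by (intro mult_left_mono q) auto
      also have "\<dots> = e\<^sup>2" using A(1) by (simp add: power_divide)
      finally show "(\<integral>y. (u y * (v y - q y))\<^sup>2 * W y \<partial>\<nu>) \<le> e\<^sup>2" .
    qed (use e in simp)
    moreover have "approximable W 0 (\<lambda>y. u y * q y)"
      unfolding approximable_def
    proof (intro conjI allI impI)
      show "tame (\<lambda>y. u y * q y)"
        by (intro tame_mult in_polynomial_closureD(3)[OF u] tame_polynomial q)
      fix d :: real assume d: "d > 0"
      have "real_polynomial_function (\<lambda>y. q y * q y * W y)"
        by (intro real_polynomial_function.intros(4) q W)
      then have "approximable (\<lambda>y. q y * q y * W y) 0 u"
        by (rule in_polynomial_closureD(4)[OF u]) (simp add: W0)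
      then obtain p where p: "real_polynomial_function p" "(\<integral>y. (u y - p y)\<^sup>2 * (q y * q y * W y) \<partial>\<nu>) \<le> (0 + d)\<^sup>2"
        using d unfolding approximable_def by blast
      have "(\<lambda>y. (u y - p y)\<^sup>2 * (q y * q y * W y)) = (\<lambda>y. (u y * q y - p y * q y)\<^sup>2 * W y)"
        by (simp add: power2_eq_square algebra_simps)
      then show "\<exists>p. real_polynomial_function p \<and> (\<integral>y. (u y * q y - p y)\<^sup>2 * W y \<partial>\<nu>) \<le> (0 + d)\<^sup>2"
        using p q(1) by (intro exI[of _ "\<lambda>y. p y * q y"] conjI real_polynomial_function.intros(4)) auto
    qed simp
    ultimately have "approximable W (e + 0) (\<lambda>y. u y * (v y - q y) + u y * q y)"
      by (rule approximable_add[OF W W0])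
    then show "approximable W e (\<lambda>y. u y * v y)"
      by (simp add: algebra_simps)
  qed
  ultimately show ?thesis
    using in_polynomial_closureD(1)[OF u] in_polynomial_closureD(1)[OF v]
    unfolding in_polynomial_closure_def by auto
qed

lemma in_polynomial_closure_compose_polynomial:
  fixes P :: "real^'k::finite \<Rightarrow> real"
  assumes "real_polynomial_function P" and u: "\<And>i. in_polynomial_closure (u i)"
  shows "in_polynomial_closure (\<lambda>y. P (\<chi> i. u i y))"
  using assms(1)
proof induction
  case (linear f)
  have sum: "in_polynomial_closure (\<lambda>y. \<Sum>i\<in>A. u i y * f (axis i 1))" if "finite A" for A
    using that by induction
      (auto intro!: in_polynomial_closure_const in_polynomial_closure_add in_polynomial_closure_mult u)
  have "f (\<chi> i. u i y) = (\<Sum>i\<in>UNIV. u i y * f (axis i 1))" for y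
  proof -
    interpret bounded_linear f by (rule linear)
    have "(\<chi> i. u i y) = (\<Sum>i\<in>UNIV. u i y *\<^sub>R axis i 1)"
      by (simp add: vec_eq_iff axis_def if_distrib cong: if_cong)
    then show ?thesis by (simp add: sum scaleR)
  qed
  with sum[of UNIV] show ?case by simp
qed (auto intro: in_polynomial_closure_const in_polynomial_closure_add in_polynomial_closure_mult)

lemma in_polynomial_closure_uniform_limit:
  assumes meas: "u \<in> borel_measurable \<nu>"
    and lim: "\<And>d. d > 0 \<Longrightarrow> \<exists>v. in_polynomial_closure v \<and> (\<forall>y. \<bar>u y - v y\<bar> \<le> d)"
  shows "in_polynomial_closure u"
  unfolding in_polynomial_closure_def
proof (intro conjI allI impI meas)
  obtain v where v: "in_polynomial_closure v" "\<And>y. \<bar>u y - v y\<bar> \<le> 1"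
    using lim[of 1] by auto
  obtain B where B: "\<And>y. \<bar>v y\<bar> \<le> B" using in_polynomial_closureD(2)[OF v(1)] by blast
  have "\<bar>u y\<bar> \<le> 1 + B" for y
    using v(2)[of y] B[of y] by linarith
  then show "\<exists>B. \<forall>y. \<bar>u y\<bar> \<le> B" by blast
next
  fix W :: "real^'m \<Rightarrow> real"
  assume W: "real_polynomial_function W" and W0: "\<forall>y. W y \<ge> 0"
  define C where "C = (\<integral>y. W y \<partial>\<nu>)"
  have "C \<ge> 0" unfolding C_def by (rule Bochner_Integration.integral_nonneg) (use W0 in simp)
  show "approximable W 0 u"
  proof (rule approximable_zeroI)
    fix e :: real assume e: "e > 0"
    define d where "d = e / (sqrt C + 1)"
    have d: "d > 0" using e \<open>C \<ge> 0\<close> by (simp add: d_def add_nonneg_pos)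
    obtain v where v: "in_polynomial_closure v" "\<And>y. \<bar>u y - v y\<bar> \<le> d"
      using lim[OF d] by blast
    have tame_uv: "tame (\<lambda>y. u y - v y)"
      by (rule tame_bounded[OF _ v(2)]) (use meas in_polynomial_closureD(1)[OF v(1)] in measurable)
    have "approximable W e (\<lambda>y. u y - v y)"
    proof (rule approximable_of_norm[OF tame_uv])
      have "(\<integral>y. (u y - v y)\<^sup>2 * W y \<partial>\<nu>) \<le> (\<integral>y. d\<^sup>2 * W y \<partial>\<nu>)"
      proof (intro integral_mono tame_integrable tame_mult tame_power tame_uv tame_const tame_polynomial[OF W])
        fix y show "(u y - v y)\<^sup>2 * W y \<le> d\<^sup>2 * W y"
          using power_mono[OF v(2)[of y], of 2] W0 by (intro mult_right_mono) auto
      qed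
      also have "\<dots> = (d * sqrt C)\<^sup>2"
        using \<open>C \<ge> 0\<close> by (simp add: C_def power_mult_distrib)
      also have "\<dots> \<le> e\<^sup>2"
      proof (rule power_mono)
        show "d * sqrt C \<le> e"
          using e \<open>C \<ge> 0\<close> by (simp add: d_def divide_simps add_nonneg_pos distrib_left)
      qed (use d \<open>C \<ge> 0\<close> in simp)
      finally show "(\<integral>y. (u y - v y)\<^sup>2 * W y \<partial>\<nu>) \<le> e\<^sup>2" .
    qed (use e in simp)
    moreover have "approximable W 0 v"
      using in_polynomial_closureD(4)[OF v(1) W] W0 by blast
    ultimately have "approximable W (e + 0) (\<lambda>y. (u y - v y) + v y)"
      using W0 by (intro approximable_add[OF W]) auto
    then show "approximable W e u" by simp
  qed
qed

text \<open>Positivity on squares of polynomials passes to squares of functions in the closure, by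
  approximation with respect to the weight \<open>1 + h\<^sup>2 \<ge> |h|\<close>.\<close>

lemma integral_square_nonneg_closure:
  assumes h: "real_polynomial_function h"
    and pos: "\<And>p. real_polynomial_function p \<Longrightarrow> (\<integral>y. (p y)\<^sup>2 * h y \<partial>\<nu>) \<ge> 0"
    and u: "in_polynomial_closure u"
  shows "(\<integral>y. (u y)\<^sup>2 * h y \<partial>\<nu>) \<ge> 0"
proof -
  define W where "W y = 1 + h y * h y" for y
  have W: "real_polynomial_function W"
    unfolding W_def[abs_def] by (intro real_polynomial_function.intros(2-4) h)
  have W0: "W y \<ge> 0" for y by (simp add: W_def add_nonneg_nonneg)
  have hW: "\<bar>h y\<bar> \<le> W y" for y
    using zero_le_power2[of "\<bar>h y\<bar> - 1"] by (simp add: W_def power2_eq_square algebra_simps flip: abs_mult)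
  define C where "C = (\<integral>y. (u y)\<^sup>2 * W y \<partial>\<nu>)"
  have C: "C \<ge> 0" unfolding C_def by (rule Bochner_Integration.integral_nonneg) (simp add: W0)
  note tu = in_polynomial_closureD(3)[OF u]
  have bound: "0 \<le> (\<integral>y. (u y)\<^sup>2 * h y \<partial>\<nu>) + e * (C + 2)" if e: "0 < e" "e \<le> 1" for e
  proof -
    obtain p where p: "real_polynomial_function p" "(\<integral>y. (u y - p y)\<^sup>2 * W y \<partial>\<nu>) \<le> (0 + e)\<^sup>2"
      using in_polynomial_closureD(4)[OF u W W0] e unfolding approximable_def by blast
    let ?D = "\<integral>y. (u y - p y)\<^sup>2 * W y \<partial>\<nu>"
    have int: "integrable \<nu> (\<lambda>y. (u y)\<^sup>2 * h y)" "integrable \<nu> (\<lambda>y. (u y)\<^sup>2 * W y)"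
      "integrable \<nu> (\<lambda>y. (u y - p y)\<^sup>2 * W y)" "integrable \<nu> (\<lambda>y. (p y)\<^sup>2 * h y)"
      by (intro tame_integrable tame_mult tame_power tame_diff tu tame_polynomial h W p)+
    have "0 \<le> (\<integral>y. (p y)\<^sup>2 * h y \<partial>\<nu>)" by (rule pos[OF p(1)])
    also have "\<dots> \<le> (\<integral>y. (u y)\<^sup>2 * h y + e * ((u y)\<^sup>2 * W y) + (1 + 1 / e) * ((u y - p y)\<^sup>2 * W y) \<partial>\<nu>)"
    proof (intro integral_mono int Bochner_Integration.integrable_add integrable_mult_right)
      fix y
      let ?d = "u y - p y"
      have "0 \<le> (e * \<bar>u y\<bar> - \<bar>?d\<bar>)\<^sup>2 / e" using e by simp
      also have "\<dots> = e * (u y)\<^sup>2 + ?d\<^sup>2 / e - 2 * (\<bar>u y\<bar> * \<bar>?d\<bar>)"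
        using e by (simp add: power2_diff field_simps) (simp add: power2_eq_square)
      finally have young: "2 * \<bar>u y * ?d\<bar> \<le> e * (u y)\<^sup>2 + ?d\<^sup>2 / e"
        by (simp add: abs_mult)
      have "(p y)\<^sup>2 * h y = (u y)\<^sup>2 * h y + (?d\<^sup>2 - 2 * (u y * ?d)) * h y"
        by (simp add: power2_eq_square algebra_simps)
      also have "(?d\<^sup>2 - 2 * (u y * ?d)) * h y \<le> \<bar>?d\<^sup>2 - 2 * (u y * ?d)\<bar> * \<bar>h y\<bar>"
        by (metis abs_ge_self abs_mult)
      also have "\<dots> \<le> (e * (u y)\<^sup>2 + (1 + 1 / e) * ?d\<^sup>2) * W y"
      proof (intro mult_mono hW)
        have "\<bar>?d\<^sup>2 - 2 * (u y * ?d)\<bar> \<le> ?d\<^sup>2 + 2 * \<bar>u y * ?d\<bar>"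
          using abs_triangle_ineq4[of "?d\<^sup>2" "2 * (u y * ?d)"] by simp
        with young show "\<bar>?d\<^sup>2 - 2 * (u y * ?d)\<bar> \<le> e * (u y)\<^sup>2 + (1 + 1 / e) * ?d\<^sup>2"
          by (simp add: distrib_right)
      qed (use e in auto)
      finally show "(p y)\<^sup>2 * h y \<le> (u y)\<^sup>2 * h y + e * ((u y)\<^sup>2 * W y) + (1 + 1 / e) * (?d\<^sup>2 * W y)"
        by (simp add: distrib_right mult.assoc)
    qed
    also have "\<dots> = (\<integral>y. (u y)\<^sup>2 * h y \<partial>\<nu>) + e * C + (1 + 1 / e) * ?D"
      using int by (simp add: C_def)
    also have "\<dots> \<le> (\<integral>y. (u y)\<^sup>2 * h y \<partial>\<nu>) + e * C + (1 + 1 / e) * e\<^sup>2"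
      using p(2) e by (intro add_left_mono mult_left_mono) auto
    also have "(1 + 1 / e) * e\<^sup>2 \<le> 2 * e"
    proof -
      have "(1 + 1 / e) * e\<^sup>2 = e * e + e"
        using e by (simp add: distrib_right power2_eq_square)
      then show ?thesis using mult_left_mono[of e 1 e] e by simp
    qed
    finally show ?thesis by (simp add: algebra_simps)
  qed
  show ?thesis
  proof (rule ccontr)
    define I where "I = (\<integral>y. (u y)\<^sup>2 * h y \<partial>\<nu>)"
    assume "\<not> ?thesis"
    then have I: "I < 0" by (simp add: I_def)
    define e where "e = min 1 (- I / (2 * (C + 2)))"
    have e: "0 < e" "e \<le> 1" using I C by (auto simp: e_def divide_neg_pos)
    have "e * (C + 2) \<le> - I / (2 * (C + 2)) * (C + 2)"
      using C by (intro mult_right_mono) (auto simp: e_def)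
    also have "\<dots> = - I / 2" using C by (simp add: field_simps)
    finally show False using bound[OF e] I unfolding I_def[symmetric] by linarith
  qed
qed

text \<open>
  If \<open>h\<close> were negative near \<open>y\<^sub>0\<close>, then so would be \<open>\<integral> \<beta>\<^sup>2 h d\<nu>\<close> for a bump function \<open>\<beta>\<close> around \<open>y\<^sub>0\<close>. To
  obtain \<open>\<beta>\<close> as a bounded pointwise limit of functions in the closure, replace each \<open>|x|\<close> in it by the
  \<open>2 \<pi> n\<close>-periodic function \<open>n arccos (cos (x / n))\<close>, which agrees with \<open>|x|\<close> for \<open>|x| \<le> \<pi> n\<close> and is a
  continuous function of a cosine.
\<close>

lemma nonneg_on_support:
  assumes carleman: "carleman \<nu>" and h: "real_polynomial_function h"
    and pos: "\<And>p. real_polynomial_function p \<Longrightarrow> (\<integral>y. (p y)\<^sup>2 * h y \<partial>\<nu>) \<ge> 0"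
    and y0: "y0 \<in> measure_supp \<nu>"
  shows "h y0 \<ge> 0"
proof (rule ccontr)
  assume "\<not> h y0 \<ge> 0"
  have cont_h: "continuous_on UNIV h"
    using h by (simp add: continuous_on_polymonial_function real_polynomial_function_eq)
  then have "open {y. h y < 0}"
    by (intro open_Collect_less continuous_on_const)
  moreover have "y0 \<in> {y. h y < 0}"
    using \<open>\<not> h y0 \<ge> 0\<close> by simp
  ultimately obtain r where r: "r > 0" "\<And>y. dist y y0 < r \<Longrightarrow> h y < 0"
    unfolding open_dist by (metis mem_Collect_eq)
  define \<beta> where "\<beta> y = max 0 (1 - (\<Sum>j\<in>UNIV. \<bar>y $ j - y0 $ j\<bar>) / r)" for y :: "real^'m"
  define \<phi> where "\<phi> n y = max 0 (1 - (\<Sum>j\<in>UNIV. real (Suc n) * arccos (cos ((y $ j - y0 $ j) / real (Suc n)))) / r)"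
    for n and y :: "real^'m"
  have arccos_nonneg: "0 \<le> arccos (cos x)" for x :: real
    by (rule arccos_lbound) auto
  have \<phi>_bounds: "0 \<le> \<phi> n y" "\<phi> n y \<le> 1" for n y
  proof -
    have "0 \<le> (\<Sum>j\<in>UNIV. real (Suc n) * arccos (cos ((y $ j - y0 $ j) / real (Suc n)))) / r"
      using r(1) by (intro divide_nonneg_pos sum_nonneg mult_nonneg_nonneg arccos_nonneg) auto
    then show "0 \<le> \<phi> n y" "\<phi> n y \<le> 1" by (auto simp: \<phi>_def)
  qed
  have \<phi>_meas: "\<phi> n \<in> borel_measurable \<nu>" for n
  proof -
    have "continuous_on UNIV (\<phi> n)"
      unfolding \<phi>_def[abs_def] using r(1) by (auto intro!: continuous_intros)
    then show ?thesis
      using borel_measurable_continuous_onI measurable_cong_sets[OF sets_eq refl] by blast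
  qed
  have \<phi>_closure: "in_polynomial_closure (\<phi> n)" for n
  proof (rule in_polynomial_closure_uniform_limit[OF \<phi>_meas])
    fix d :: real assume d: "d > 0"
    define C where "C j y = cos ((y $ j - y0 $ j) / real (Suc n))" for j and y :: "real^'m"
    have C_closure: "in_polynomial_closure (C j)" for j
    proof -
      have eq: "C j = (\<lambda>y. cos (1 / real (Suc n) * y $ j + (- y0 $ j / real (Suc n))))"
        by (simp add: C_def fun_eq_iff diff_divide_distrib)
      have "C j \<in> borel_measurable \<nu>"
        using tame_measurable[OF tame_cos_deriv[of j "- y0 $ j / real (Suc n)" 0 "1 / real (Suc n)"]]
        by (simp add: eq cos_deriv_def[abs_def])
      moreover have "\<exists>B. \<forall>y. \<bar>C j y\<bar> \<le> B"
        by (intro exI[of _ 1]) (simp add: C_def)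
      moreover have "approximable W 0 (C j)" if "real_polynomial_function W" "\<forall>y. W y \<ge> 0" for W
        unfolding eq by (rule cos_approximable[OF carleman that(1)]) (use that(2) in auto)
      ultimately show ?thesis
        unfolding in_polynomial_closure_def by blast
    qed
    let ?S = "cbox (- 1) 1 :: (real^'m) set"
    define \<psi> where "\<psi> c = max 0 (1 - (\<Sum>j\<in>UNIV. real (Suc n) * arccos (c $ j)) / r)"
      for c :: "real^'m"
    have "continuous_on ?S \<psi>"
      unfolding \<psi>_def[abs_def] using r(1) by (intro continuous_intros) (auto simp: mem_box_cart)
    then obtain P where P: "real_polynomial_function P" "\<And>c. c \<in> ?S \<Longrightarrow> \<bar>\<psi> c - P c\<bar> < d"
      using Stone_Weierstrass_real_polynomial_function[OF compact_cbox _ d] by blast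
    show "\<exists>v. in_polynomial_closure v \<and> (\<forall>y. \<bar>\<phi> n y - v y\<bar> \<le> d)"
    proof (intro exI conjI allI)
      show "in_polynomial_closure (\<lambda>y. P (\<chi> j. C j y))"
        by (rule in_polynomial_closure_compose_polynomial[OF P(1) C_closure])
      fix y
      have "(\<chi> j. C j y) \<in> ?S" by (simp add: mem_box_cart C_def)
      then show "\<bar>\<phi> n y - P (\<chi> j. C j y)\<bar> \<le> d"
        using P(2)[of "\<chi> j. C j y"] by (simp add: \<phi>_def \<psi>_def C_def less_imp_le)
    qed
  qed
  have lim: "(\<lambda>n. \<phi> n y) \<longlonglongrightarrow> \<beta> y" for y
  proof (rule tendsto_eventually)
    obtain N :: nat where N: "(\<Sum>j\<in>UNIV. \<bar>y $ j - y0 $ j\<bar>) < real N"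
      using reals_Archimedean2 by blast
    show "\<forall>\<^sub>F n in sequentially. \<phi> n y = \<beta> y"
      using eventually_ge_at_top[of N]
    proof eventually_elim
      case (elim n)
      have "real (Suc n) * arccos (cos ((y $ j - y0 $ j) / real (Suc n))) = \<bar>y $ j - y0 $ j\<bar>" for j
      proof -
        have "\<bar>y $ j - y0 $ j\<bar> \<le> (\<Sum>j\<in>UNIV. \<bar>y $ j - y0 $ j\<bar>)"
          by (rule member_le_sum) auto
        also have "\<dots> \<le> real (Suc n)" using N elim by simp
        finally have "\<bar>(y $ j - y0 $ j) / real (Suc n)\<bar> \<le> 1"
          by (simp add: abs_divide)
        then have "\<bar>(y $ j - y0 $ j) / real (Suc n)\<bar> \<le> pi"
          using pi_ge_two by linarith
        then show ?thesis
          by (subst arccos_cos_eq_abs) (simp_all add: abs_divide)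
      qed
      then show ?case by (simp only: \<phi>_def \<beta>_def)
    qed
  qed
  have cont_\<beta>: "continuous_on UNIV \<beta>"
    unfolding \<beta>_def[abs_def] using r(1) by (auto intro!: continuous_intros)
  then have \<beta>_meas: "\<beta> \<in> borel_measurable \<nu>"
    using borel_measurable_continuous_onI measurable_cong_sets[OF sets_eq refl] by blast
  have h_meas: "h \<in> borel_measurable \<nu>"
    by (rule tame_measurable[OF tame_polynomial[OF h]])
  have \<beta>_bounds: "0 \<le> \<beta> y" "\<beta> y \<le> 1" for y
    using r(1) by (auto simp: \<beta>_def sum_nonneg)
  have "(\<lambda>n. \<integral>y. (\<phi> n y)\<^sup>2 * h y \<partial>\<nu>) \<longlonglongrightarrow> (\<integral>y. (\<beta> y)\<^sup>2 * h y \<partial>\<nu>)"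
  proof (rule integral_dominated_convergence)
    show "integrable \<nu> (\<lambda>y. \<bar>h y\<bar>)"
      by (intro integrable_abs integrable_polynomial h)
    show "AE y in \<nu>. (\<lambda>n. (\<phi> n y)\<^sup>2 * h y) \<longlonglongrightarrow> (\<beta> y)\<^sup>2 * h y"
      by (intro always_eventually allI tendsto_intros lim)
    show "AE y in \<nu>. norm ((\<phi> n y)\<^sup>2 * h y) \<le> \<bar>h y\<bar>" for n
      using \<phi>_bounds[of n] by (intro always_eventually allI)
        (auto simp: abs_mult power_le_one intro!: mult_left_le_one_le)
  qed (use \<phi>_meas \<beta>_meas h_meas in measurable)
  then have "0 \<le> (\<integral>y. (\<beta> y)\<^sup>2 * h y \<partial>\<nu>)"
    by (rule LIMSEQ_le_const) (use integral_square_nonneg_closure[OF h pos \<phi>_closure] in auto)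
  moreover have sign: "0 \<le> - ((\<beta> y)\<^sup>2 * h y)" for y
  proof (cases "dist y y0 < r")
    case True
    then show ?thesis using r(2)[of y] by (simp add: mult_nonneg_nonpos)
  next
    case False
    have "dist y y0 \<le> (\<Sum>j\<in>UNIV. \<bar>y $ j - y0 $ j\<bar>)"
      using norm_le_l1_cart[of "y - y0"] by (simp add: dist_norm)
    with False have "\<beta> y = 0" using r(1) by (simp add: \<beta>_def)
    then show ?thesis by simp
  qed
  then have "0 \<le> (\<integral>y. - ((\<beta> y)\<^sup>2 * h y) \<partial>\<nu>)"
    by (intro Bochner_Integration.integral_nonneg)
  ultimately have "(\<integral>y. - ((\<beta> y)\<^sup>2 * h y) \<partial>\<nu>) = 0"
    by simp
  moreover have "tame \<beta>"
    by (rule tame_bounded[OF \<beta>_meas, of 1]) (use \<beta>_bounds in simp)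
  then have "integrable \<nu> (\<lambda>y. - ((\<beta> y)\<^sup>2 * h y))"
    by (intro Bochner_Integration.integrable_minus tame_integrable tame_mult tame_power tame_polynomial[OF h])
  ultimately have AE: "AE y in \<nu>. - ((\<beta> y)\<^sup>2 * h y) = 0"
    using sign by (subst (asm) integral_nonneg_eq_0_iff_AE) auto
  let ?U = "{y. 0 < \<beta> y}"
  have U: "open ?U"
    by (intro open_Collect_less continuous_on_const cont_\<beta>)
  have "AE y in \<nu>. y \<notin> ?U"
    using AE
  proof eventually_elim
    case (elim y)
    show ?case
    proof
      assume y: "y \<in> ?U"
      have "dist y y0 \<le> (\<Sum>j\<in>UNIV. \<bar>y $ j - y0 $ j\<bar>)"
        using norm_le_l1_cart[of "y - y0"] by (simp add: dist_norm)
      also have "\<dots> < r" using y r(1) by (simp add: \<beta>_def less_max_iff_disj)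
      finally have "h y < 0" by (rule r(2))
      with elim y show False by simp
    qed
  qed
  moreover have "?U \<in> sets \<nu>" using U by simp
  ultimately have "emeasure \<nu> ?U = 0"
    by (subst (asm) AE_iff_measurable[OF _ refl]) (auto simp: sets_eq_imp_space_eq[OF sets_eq])
  moreover have "y0 \<in> ?U" by (simp add: \<beta>_def)
  ultimately show False
    using y0 U unfolding measure_supp_def by (metis (mono_tags, lifting) less_irrefl mem_Collect_eq)
qed

end

section \<open>Polynomials in \<open>x\<close> and \<open>y\<close> as polynomial functions of \<open>y\<close>\<close>

lemma polynomial_function_eval_xy: "real_polynomial_function (\<lambda>y. eval_xy p x y)"
  unfolding eval_xy_def poly_eval_def mono_eval_def
proof (intro real_polynomial_function_sum real_polynomial_function.intros(2,4)
    real_polynomial_function_prod real_polynomial_function_power)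
  show "real_polynomial_function (\<lambda>y. case_sum (\<lambda>i. x $ i) (\<lambda>j. y $ j) i)" for i
    by (cases i) (auto intro: real_polynomial_function.intros(2))
qed auto

lemma eval_xy_simps:
  "eval_xy (p + q) x y = eval_xy p x y + eval_xy q x y"
  "eval_xy (p * q) x y = eval_xy p x y * eval_xy q x y"
  "eval_xy (p\<^sup>2) x y = (eval_xy p x y)\<^sup>2"
  "eval_xy (const_poly r) x y = r"
  "eval_xy (var_poly (Inr j)) x y = y $ j"
  by (simp_all add: eval_xy_def poly_eval_add poly_eval_mult poly_eval_power poly_eval_const poly_eval_var)

lemma polynomial_function_imp_eval_xy:
  fixes p :: "real^'m::finite \<Rightarrow> real" and x :: "real^'n::finite"
  assumes "real_polynomial_function p"
  shows "\<exists>q. \<forall>y. eval_xy q x y = p y"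
  using assms
proof induction
  case (linear f)
  have "\<exists>q. \<forall>y. eval_xy q x y = (\<Sum>j\<in>A. y $ j * f (axis j 1))" if "finite A" for A :: "'m set"
    using that
  proof induction
    case empty
    show ?case by (intro exI[of _ "const_poly 0"] allI) (simp only: eval_xy_simps sum.empty)
  next
    case (insert j A)
    then obtain q where "\<And>y. eval_xy q x y = (\<Sum>j\<in>A. y $ j * f (axis j 1))" by blast
    then show ?case using insert
      by (intro exI[of _ "var_poly (Inr j) * const_poly (f (axis j 1)) + q"] allI)
        (simp only: eval_xy_simps sum.insert simp_thms)
  qed
  from this[OF finite_class.finite_UNIV] obtain q where q: "\<And>y. eval_xy q x y = (\<Sum>j\<in>UNIV. y $ j * f (axis j 1))"
    by blast
  have f: "f y = (\<Sum>j\<in>UNIV. y $ j * f (axis j 1))" for y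
  proof -
    interpret bounded_linear f by (rule linear)
    have "y = (\<Sum>j\<in>UNIV. y $ j *\<^sub>R axis j 1)"
      by (simp add: vec_eq_iff axis_def if_distrib cong: if_cong)
    then have "f y = f (\<Sum>j\<in>UNIV. y $ j *\<^sub>R axis j 1)" by simp
    then show ?thesis by (simp add: sum scaleR)
  qed
  show ?case by (intro exI[of _ q] allI) (rule trans[OF q f[symmetric]])
next
  case (const c)
  show ?case by (intro exI[of _ "const_poly c"] allI) (simp only: eval_xy_simps)
next
  case (add f g)
  from add.IH obtain q where q: "\<And>y. eval_xy q x y = f y" by blast
  from add.IH obtain r where r: "\<And>y. eval_xy r x y = g y" by blast
  show ?case by (intro exI[of _ "q + r"]) (simp add: eval_xy_simps q r)
next
  case (mult f g)
  from mult.IH obtain q where q: "\<And>y. eval_xy q x y = f y" by blast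
  from mult.IH obtain r where r: "\<And>y. eval_xy r x y = g y" by blast
  show ?case by (intro exI[of _ "q * r"]) (simp add: eval_xy_simps q r)
qed

lemma integrable_eval_xy:
  assumes "finite_moments \<nu>"
  shows "integrable \<nu> (\<lambda>y. eval_xy p x y)"
  unfolding eval_xy_def poly_eval_def mono_eval_case_sum
  using assms by (auto simp: finite_moments_def)

lemma moment_measure_of_finite_moments:
  fixes \<nu> :: "(real^'m::finite) measure"
  assumes "finite_measure \<nu>" "sets \<nu> = sets borel" "finite_moments \<nu>"
  shows "moment_measure \<nu>"
proof -
  interpret finite_measure \<nu> by fact
  show ?thesis
  proof
    fix p :: "real^'m \<Rightarrow> real" assume "real_polynomial_function p"
    then obtain q where "\<And>y. eval_xy q (0 :: real^1) y = p y"
      using polynomial_function_imp_eval_xy by blast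
    then show "integrable \<nu> p"
      using integrable_eval_xy[OF assms(3), of q 0] by simp
  qed fact
qed

section \<open>The quadratic module of the semi-infinite program\<close>


definition embed_mono :: "'n::finite monom \<Rightarrow> ('n + 'm) monom" where
  "embed_mono a = (\<Sum>i\<in>UNIV. Poly_Mapping.single (Inl i) (Poly_Mapping.lookup a i))"

definition embed_x :: "'n::finite rpoly \<Rightarrow> ('n + 'm) rpoly" where
  "embed_x q = (\<Sum>a\<in>Poly_Mapping.keys q. Poly_Mapping.single (embed_mono a) (Poly_Mapping.lookup q a))"

lemma x_part_plus: "x_part (a + b) = x_part a + x_part b"
  and y_part_plus: "y_part (a + b) = y_part a + y_part b"
  by (simp_all add: map_key_plus)

lemma x_part_embed_mono: "x_part (embed_mono a) = a"
  by (rule poly_mapping_eqI) (simp add: map_key.rep_eq embed_mono_def lookup_sum lookup_single when_def)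

lemma y_part_embed_mono: "y_part (embed_mono a) = 0"
  by (rule poly_mapping_eqI) (simp add: map_key.rep_eq embed_mono_def lookup_sum lookup_single when_def)

text \<open>
  Integration over \<open>y\<close> is linear over the polynomials in \<open>x\<close>. Hence multiplying \<open>\<integral> p\<^sup>2 g\<^sub>j d\<nu>\<close> by a
  square in \<open>x\<close> gives an integral of the same kind.
\<close>

lemma integrate_y_embed_mult: "integrate_y \<nu> (embed_x q * p) = q * integrate_y \<nu> p"
proof (induction p rule: rpoly_induct_single)
  case (single e r)
  let ?t = "Poly_Mapping.single (x_part e) (r * moment \<nu> (y_part e))"
  have "integrate_y \<nu> (embed_x q * Poly_Mapping.single e r) =
      (\<Sum>a\<in>Poly_Mapping.keys q. Poly_Mapping.single a (Poly_Mapping.lookup q a) * ?t)"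
    by (simp add: embed_x_def sum_distrib_right mult_single integrate_y_sum integrate_y_single
        x_part_plus y_part_plus x_part_embed_mono y_part_embed_mono mult.assoc)
  also have "\<dots> = q * ?t"
    by (subst (3) poly_eq_sum_singles) (simp only: sum_distrib_right)
  finally show ?case by (simp only: integrate_y_single)
qed (simp add: distrib_left integrate_y_add)

lemma integrate_y_1: "integrate_y \<nu> 1 = const_poly (moment \<nu> 0)"
  using integrate_y_single[of \<nu> 0 1] by simp

text \<open>
  Generated by addition from single squares in place of sums of squares, so that statements about its
  elements can be checked on generators.
\<close>

inductive_set relax_cone ::
    "'i set \<Rightarrow> 'i set \<Rightarrow> ('i \<Rightarrow> 'n::finite rpoly) \<Rightarrow> nat \<Rightarrow> (nat \<Rightarrow> ('n + 'm::finite) rpoly)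
      \<Rightarrow> (real^'m) measure \<Rightarrow> 'n rpoly set"
  for I J c s g \<nu> where
  square: "q\<^sup>2 \<in> relax_cone I J c s g \<nu>"
| integral: "j \<le> s \<Longrightarrow> integrate_y \<nu> (p\<^sup>2 * g j) \<in> relax_cone I J c s g \<nu>"
| inequality: "j \<in> J \<Longrightarrow> q\<^sup>2 * c j \<in> relax_cone I J c s g \<nu>"
| equation: "i \<in> I \<Longrightarrow> h * c i \<in> relax_cone I J c s g \<nu>"
| add: "p \<in> relax_cone I J c s g \<nu> \<Longrightarrow> q \<in> relax_cone I J c s g \<nu> \<Longrightarrow> p + q \<in> relax_cone I J c s g \<nu>"

lemma relax_cone_0: "0 \<in> relax_cone I J c s g \<nu>"
  using relax_cone.square[of 0] by simp

lemma relax_cone_sum: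
  "(\<And>i. i \<in> A \<Longrightarrow> p i \<in> relax_cone I J c s g \<nu>) \<Longrightarrow> (\<Sum>i\<in>A. p i) \<in> relax_cone I J c s g \<nu>"
  by (induction A rule: infinite_finite_induct) (auto intro: relax_cone_0 relax_cone.add)

lemma quad_module_relax_cone: "quad_module (relax_cone I J c s g \<nu>)"
  unfolding quad_module_def
proof (intro conjI ballI allI)
  fix p q assume "p \<in> relax_cone I J c s g \<nu>"
  then show "q\<^sup>2 * p \<in> relax_cone I J c s g \<nu>"
  proof induction
    case (square r)
    then show ?case using relax_cone.square[of "q * r"] by (simp add: power_mult_distrib)
  next
    case (integral j p)
    have "q\<^sup>2 * integrate_y \<nu> (p\<^sup>2 * g j) = integrate_y \<nu> (embed_x q * (embed_x q * (p\<^sup>2 * g j)))"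
      by (simp only: integrate_y_embed_mult power2_eq_square mult.assoc)
    also have "embed_x q * (embed_x q * (p\<^sup>2 * g j)) = (embed_x q * p)\<^sup>2 * g j"
      by (simp only: power2_eq_square ac_simps)
    finally show ?case using relax_cone.integral[OF integral] by simp
  next
    case (inequality j r)
    then show ?case using relax_cone.inequality[of j J "q * r"] by (simp add: power_mult_distrib mult.assoc)
  next
    case (equation i h)
    then show ?case using relax_cone.equation[of i I "q\<^sup>2 * h"] by (simp add: mult.assoc)
  qed (simp add: distrib_left relax_cone.add)
qed (auto intro: relax_cone.square relax_cone.add)

lemma sum_modules_subset_relax_cone: "QM_nu s g \<nu> + ideal_eq I c + QM_in J c \<subseteq> relax_cone I J c s g \<nu>"
proof -
  have "integrate_y \<nu> (t * g j) \<in> relax_cone I J c s g \<nu>" if "t \<in> sos" "j \<le> s" for t j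
    using that(1)
  proof (induction t rule: sos_induct)
    case zero
    show ?case using relax_cone.integral[OF that(2), of \<nu> 0] by simp
  qed (simp add: distrib_right integrate_y_add relax_cone.add relax_cone.integral that(2))
  moreover have "t * c j \<in> relax_cone I J c s g \<nu>" if "t \<in> sos" "j \<in> J" for t j
    using that(1) by (induction t rule: sos_induct)
      (auto simp: distrib_right relax_cone_0 intro: relax_cone.add relax_cone.inequality that(2))
  moreover have "t \<in> relax_cone I J c s g \<nu>" if "t \<in> sos" for t
    using that by (induction t rule: sos_induct) (auto intro: relax_cone_0 relax_cone.add relax_cone.square)
  ultimately have "QM_nu s g \<nu> \<subseteq> relax_cone I J c s g \<nu>" "QM_in J c \<subseteq> relax_cone I J c s g \<nu>"
    by (auto simp: QM_nu_def QM_in_def intro!: relax_cone_sum relax_cone.add)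
  moreover have "ideal_eq I c \<subseteq> relax_cone I J c s g \<nu>"
    by (auto simp: ideal_eq_def intro!: relax_cone_sum relax_cone.equation)
  ultimately show ?thesis
    by (auto simp: set_plus_def intro!: relax_cone.add)
qed

text \<open>
  The points at which the whole module is nonnegative are feasible for the semi-infinite program:
  this is where the Carleman condition turns the integral inequalities into inequalities on \<open>Q\<close>.
\<close>

lemma relax_cone_nonneg_point:
  fixes \<nu> :: "(real^'m::finite) measure" and g :: "nat \<Rightarrow> ('n::finite + 'm) rpoly"
  assumes fin: "finite_measure \<nu>" and sets: "sets \<nu> = sets borel" and mom: "finite_moments \<nu>"
    and carl: "carleman \<nu>"
    and nonneg: "\<And>p. p \<in> relax_cone I J c s g \<nu> \<Longrightarrow> eval_x p x \<ge> 0"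
  shows "x \<in> set_X I J c \<inter> set_K (measure_supp \<nu>) s g"
proof -
  interpret moment_measure \<nu>
    by (rule moment_measure_of_finite_moments) fact+
  have "eval_x (c i) x = 0" if "i \<in> I" for i
    using nonneg[OF relax_cone.equation[OF that, of 1]] nonneg[OF relax_cone.equation[OF that, of "-1"]]
    by (simp add: eval_x_def poly_eval_minus)
  moreover have "eval_x (c j) x \<ge> 0" if "j \<in> J" for j
    using nonneg[OF relax_cone.inequality[OF that, of 1]] by simp
  moreover have "eval_xy (g j) x y \<ge> 0" if "j \<le> s" "y \<in> measure_supp \<nu>" for j y
  proof (rule nonneg_on_support[OF carl polynomial_function_eval_xy _ that(2)])
    fix p :: "real^'m \<Rightarrow> real" assume "real_polynomial_function p"
    then obtain q where q: "\<And>y. eval_xy q x y = p y"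
      using polynomial_function_imp_eval_xy by blast
    have "0 \<le> eval_x (integrate_y \<nu> (q\<^sup>2 * g j)) x"
      by (intro nonneg relax_cone.integral that)
    also have "\<dots> = (\<integral>y. (p y)\<^sup>2 * eval_xy (g j) x y \<partial>\<nu>)"
      by (simp add: eval_integrate_y[OF mom] eval_xy_simps q)
    finally show "(\<integral>y. (p y)\<^sup>2 * eval_xy (g j) x y \<partial>\<nu>) \<ge> 0" .
  qed
  ultimately show ?thesis by (simp add: set_X_def set_K_def)
qed

section \<open>Degree bounds and the feasible sets\<close>

lemma mono_deg_plus: "mono_deg (a + b) = mono_deg a + mono_deg b"
  by (simp add: mono_deg_def lookup_add sum.distrib)

lemma mono_deg_le_poly_deg: "a \<in> Poly_Mapping.keys p \<Longrightarrow> mono_deg a \<le> poly_deg p"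
  unfolding poly_deg_def by (intro Max_ge) auto

lemma keys_mult_mono:
  "b \<in> Poly_Mapping.keys (p * mono_poly a) \<Longrightarrow> \<exists>e\<in>Poly_Mapping.keys p. b = e + a"
  using keys_mult[of p "mono_poly a"] by auto

lemma riesz_cong:
  "(\<And>a. a \<in> Poly_Mapping.keys p \<Longrightarrow> w a = w' a) \<Longrightarrow> riesz w p = riesz w' p"
  by (simp add: riesz_def)

lemma riesz_restrict:
  "Poly_Mapping.keys p \<subseteq> D \<Longrightarrow> riesz (restrict w D) p = riesz w p"
  by (rule riesz_cong) auto

lemma keys_subset_monos_upto: "poly_deg p \<le> d \<Longrightarrow> Poly_Mapping.keys p \<subseteq> monos_upto d"
  using mono_deg_le_poly_deg by (fastforce simp: monos_upto_def)

lemma keys_loc_vec: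
  "a \<in> loc_vec_index d c \<Longrightarrow> Poly_Mapping.keys (c * mono_poly a) \<subseteq> monos_upto d"
  using mono_deg_le_poly_deg[of _ c]
  by (fastforce dest!: keys_mult_mono simp: loc_vec_index_def monos_upto_def mono_deg_plus)

lemma keys_loc_mat:
  assumes "a \<in> loc_mat_index k c" "b \<in> loc_mat_index k c"
  shows "Poly_Mapping.keys (c * (mono_poly a * mono_poly b)) \<subseteq> monos_upto (2 * k)"
proof
  fix e assume "e \<in> Poly_Mapping.keys (c * (mono_poly a * mono_poly b))"
  then obtain d where d: "d \<in> Poly_Mapping.keys c" "e = d + (a + b)"
    using keys_mult_mono[of e c "a + b"] by (auto simp: mult_single)
  then show "e \<in> monos_upto (2 * k)"
    using mono_deg_le_poly_deg[OF d(1)] assms by (simp add: loc_mat_index_def monos_upto_def mono_deg_plus)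
qed

lemma keys_integrate_y: "Poly_Mapping.keys (integrate_y \<nu> p) \<subseteq> x_part ` Poly_Mapping.keys p"
proof
  fix a assume "a \<in> Poly_Mapping.keys (integrate_y \<nu> p)"
  then have "Poly_Mapping.lookup (integrate_y \<nu> p) a \<noteq> 0" by (simp add: in_keys_iff)
  then obtain e where "e \<in> Poly_Mapping.keys p"
      "Poly_Mapping.lookup (Poly_Mapping.single (x_part e) (Poly_Mapping.lookup p e * moment \<nu> (y_part e))) a \<noteq> 0"
    unfolding integrate_y_def lookup_sum by (meson sum.not_neutral_contains_not_neutral)
  then show "a \<in> x_part ` Poly_Mapping.keys p"
    by (auto simp: lookup_single when_def split: if_splits)
qed

lemma keys_nu_mat:
  assumes "a \<in> nu_mat_index k l g" "b \<in> nu_mat_index k l g"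
  shows "Poly_Mapping.keys (integrate_y \<nu> ((mono_poly a * mono_poly b) * g)) \<subseteq> monos_upto (2 * k)"
proof
  fix e assume "e \<in> Poly_Mapping.keys (integrate_y \<nu> ((mono_poly a * mono_poly b) * g))"
  then obtain e' where e': "e' \<in> Poly_Mapping.keys ((mono_poly a * mono_poly b) * g)" "e = x_part e'"
    using keys_integrate_y by blast
  then have "e' \<in> Poly_Mapping.keys (g * mono_poly (a + b))"
    by (simp add: mult_single mult.commute)
  then obtain d where d: "d \<in> Poly_Mapping.keys g" "e' = d + (a + b)"
    using keys_mult_mono by blast
  have "mono_deg (x_part d) \<le> deg_x g"
    unfolding deg_x_def using d(1) by (intro Max_ge) auto
  moreover have "deg_x g \<le> 2 * ((deg_x g + 1) div 2)"
    by simp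
  moreover have "mono_deg (x_part a) + (deg_x g + 1) div 2 \<le> k" "mono_deg (x_part b) + (deg_x g + 1) div 2 \<le> k"
    using assms unfolding nu_mat_index_def by blast+
  ultimately have "mono_deg (x_part d) + (mono_deg (x_part a) + mono_deg (x_part b)) \<le> 2 * k"
    by linarith
  then show "e \<in> monos_upto (2 * k)"
    by (simp add: e' d monos_upto_def mono_deg_plus x_part_plus)
qed

lemma psd_on_subset:
  assumes psd: "psd_on B A" and "finite B" "B' \<subseteq> B"
    and eq: "\<And>a b. a \<in> B' \<Longrightarrow> b \<in> B' \<Longrightarrow> A' a b = A a b"
  shows "psd_on B' A'"
  unfolding psd_on_def
proof (intro conjI ballI allI)
  fix a b assume "a \<in> B'" "b \<in> B'"
  then show "A' a b = A' b a"
    using psd eq \<open>B' \<subseteq> B\<close> unfolding psd_on_def by (metis subsetD)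
next
  fix v :: "'a \<Rightarrow> real"
  define v' where "v' a = (if a \<in> B' then v a else 0)" for a
  have "0 \<le> (\<Sum>a\<in>B. \<Sum>b\<in>B. v' a * A a b * v' b)"
    using psd by (simp add: psd_on_def)
  also have "\<dots> = (\<Sum>a\<in>B'. \<Sum>b\<in>B. v' a * A a b * v' b)"
    using assms(2,3) by (intro sum.mono_neutral_right) (auto simp: v'_def)
  also have "\<dots> = (\<Sum>a\<in>B'. \<Sum>b\<in>B'. v' a * A a b * v' b)"
    using assms(2,3) by (intro sum.cong refl sum.mono_neutral_right) (auto simp: v'_def)
  also have "\<dots> = (\<Sum>a\<in>B'. \<Sum>b\<in>B'. v a * A' a b * v b)"
    by (intro sum.cong refl) (simp add: v'_def eq)
  finally show "0 \<le> (\<Sum>a\<in>B'. \<Sum>b\<in>B'. v a * A' a b * v b)" .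
qed

text \<open>The constraints of order \<open>k\<close> only see the entries of \<open>w\<close> up to degree \<open>2 k\<close>.\<close>

lemma relax_feasible_restrictI:
  assumes "\<And>i a. i \<in> I \<Longrightarrow> a \<in> loc_vec_index (2 * k) (c i) \<Longrightarrow> loc_vec (c i) w a = 0"
    and "\<And>j. j \<in> J \<Longrightarrow> psd_on (loc_mat_index k (c j)) (loc_mat (c j) w)"
    and "\<And>j. j \<le> s \<Longrightarrow> psd_on (nu_mat_index k k (g j)) (nu_mat \<nu> (g j) w)"
    and "w 0 = 1"
  shows "restrict w (monos_upto (2 * k)) \<in> relax_feasible I J c s g \<nu> k"
  unfolding relax_feasible_def
proof (intro CollectI conjI ballI allI impI)
  let ?w = "restrict w (monos_upto (2 * k))"
  show "?w \<in> monos_upto (2 * k) \<rightarrow>\<^sub>E UNIV" by simp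
  show "loc_vec (c i) ?w a = 0" if "i \<in> I" "a \<in> loc_vec_index (2 * k) (c i)" for i a
    using assms(1)[OF that] by (simp add: loc_vec_def riesz_restrict[OF keys_loc_vec[OF that(2)]])
  show "psd_on (loc_mat_index k (c j)) (loc_mat (c j) ?w)" if "j \<in> J" for j
    by (rule psd_on_subset[OF assms(2)[OF that] finite_index_sets(2) order_refl])
      (simp add: loc_mat_def riesz_restrict[OF keys_loc_mat])
  show "psd_on (nu_mat_index k k (g j)) (nu_mat \<nu> (g j) ?w)" if "j \<le> s" for j
    by (rule psd_on_subset[OF assms(3)[OF that] finite_index_sets(3) order_refl])
      (simp add: nu_mat_def riesz_restrict[OF keys_nu_mat])
  show "?w 0 = 1" using assms(4) by (simp add: monos_upto_def mono_deg_def)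
qed

lemma relax_value_eq: "relax_value f I J c s g \<nu> k = (INF w\<in>relax_feasible I J c s g \<nu> k. ereal (riesz w f))"
  by (simp add: relax_value_def riesz_def)

lemma relax_value_mono:
  assumes "poly_deg f \<le> 2 * k"
  shows "relax_value f I J c s g \<nu> k \<le> relax_value f I J c s g \<nu> (Suc k)"
  unfolding relax_value_eq
proof (rule INF_greatest)
  fix w assume w: "w \<in> relax_feasible I J c s g \<nu> (Suc k)"
  have "restrict w (monos_upto (2 * k)) \<in> relax_feasible I J c s g \<nu> k"
  proof (rule relax_feasible_restrictI)
    show "loc_vec (c i) w a = 0" if "i \<in> I" "a \<in> loc_vec_index (2 * k) (c i)" for i a
      using w that by (auto simp: relax_feasible_def loc_vec_index_def)
    show "psd_on (loc_mat_index k (c j)) (loc_mat (c j) w)" if "j \<in> J" for j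
      by (rule psd_on_subset[of "loc_mat_index (Suc k) (c j)"])
        (use w that in \<open>auto simp: relax_feasible_def finite_index_sets, auto simp: loc_mat_index_def\<close>)
    show "psd_on (nu_mat_index k k (g j)) (nu_mat \<nu> (g j) w)" if "j \<le> s" for j
      by (rule psd_on_subset[of "nu_mat_index (Suc k) (Suc k) (g j)"])
        (use w that in \<open>auto simp: relax_feasible_def finite_index_sets, auto simp: nu_mat_index_def\<close>)
    show "w 0 = 1" using w by (simp add: relax_feasible_def)
  qed
  moreover have "riesz (restrict w (monos_upto (2 * k))) f = riesz w f"
    by (rule riesz_restrict[OF keys_subset_monos_upto[OF assms]])
  ultimately show "(INF w\<in>relax_feasible I J c s g \<nu> k. ereal (riesz w f)) \<le> ereal (riesz w f)"
    by (metis INF_lower)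
qed

section \<open>Upper bound: point evaluations are feasible\<close>

text \<open>The complement of the support is a union of open null sets, of which countably many suffice.\<close>

lemma AE_in_measure_supp:
  fixes \<nu> :: "'a::second_countable_topology measure"
  assumes "sets \<nu> = sets borel"
  shows "AE y in \<nu>. y \<in> measure_supp \<nu>"
proof -
  let ?F = "{U. open U \<and> emeasure \<nu> U = 0}"
  obtain F where F: "F \<subseteq> ?F" "countable F" "\<Union>F = \<Union>?F"
    using Lindelof[of ?F] by auto
  have "(\<Union>U\<in>F. U) \<in> null_sets \<nu>"
    using F assms by (intro null_sets_UN') (auto simp: null_sets_def)
  moreover have "{y \<in> space \<nu>. y \<notin> measure_supp \<nu>} \<subseteq> (\<Union>U\<in>F. U)"
    using F(3) by (auto simp: measure_supp_def not_less)
  ultimately show ?thesis by (rule AE_I')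
qed

lemma mono_poly_combination:
  assumes "finite B" "Poly_Mapping.keys q \<subseteq> B"
  shows "q = (\<Sum>a\<in>B. const_poly (Poly_Mapping.lookup q a) * mono_poly a)"
proof -
  have "q = (\<Sum>a\<in>Poly_Mapping.keys q. Poly_Mapping.single a (Poly_Mapping.lookup q a))"
    by (rule poly_eq_sum_singles)
  also have "\<dots> = (\<Sum>a\<in>B. Poly_Mapping.single a (Poly_Mapping.lookup q a))"
    using assms by (intro sum.mono_neutral_left) (auto simp: in_keys_iff)
  finally show ?thesis by (simp add: mult_single)
qed

lemma loc_mat_property:
  "riesz w ((\<Sum>a\<in>B. const_poly (u a) * mono_poly a)\<^sup>2 * c) = (\<Sum>a\<in>B. \<Sum>b\<in>B. u a * loc_mat c w a b * u b)"
proof -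
  have "const_poly (u a) * (const_poly (u b) * (mono_poly a * mono_poly b)) * c =
      const_poly (u a) * (const_poly (u b) * (c * (mono_poly a * mono_poly b)))" for a b
    by (simp only: ac_simps)
  then show ?thesis
    unfolding square_expand loc_mat_def
    by (simp only: sum_distrib_right riesz_sum riesz_const_mult) (simp only: ac_simps)
qed

lemma point_evaluation_feasible:
  fixes \<nu> :: "(real^'m::finite) measure" and g :: "nat \<Rightarrow> ('n::finite + 'm) rpoly"
  assumes sets: "sets \<nu> = sets borel" and mom: "finite_moments \<nu>" and "g 0 = 1"
    and x: "x \<in> set_X I J c \<inter> set_K (measure_supp \<nu>) s g"
  shows "restrict (\<lambda>a. mono_eval a (\<lambda>i. x $ i)) (monos_upto (2 * k)) \<in> relax_feasible I J c s g \<nu> k"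
proof (rule relax_feasible_restrictI)
  let ?w = "\<lambda>a. mono_eval a (\<lambda>i. x $ i)"
  show "loc_vec (c i) ?w a = 0" if "i \<in> I" for i a
    using x that by (simp add: loc_vec_def eval_x_eq_riesz[symmetric])
      (simp add: eval_x_def poly_eval_mult set_X_def)
  show "psd_on (loc_mat_index k (c j)) (loc_mat (c j) ?w)" if "j \<in> J" for j
    unfolding psd_on_def
  proof (intro conjI ballI allI)
    show "loc_mat (c j) ?w a b = loc_mat (c j) ?w b a" for a b
      by (simp add: loc_mat_def mult.commute)
    show "0 \<le> (\<Sum>a\<in>loc_mat_index k (c j). \<Sum>b\<in>loc_mat_index k (c j). v a * loc_mat (c j) ?w a b * v b)" for v
      unfolding loc_mat_property[symmetric] eval_x_eq_riesz[symmetric]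
      using x that by (simp add: eval_x_def poly_eval_mult poly_eval_power set_X_def)
  qed
  show "psd_on (nu_mat_index k k (g j)) (nu_mat \<nu> (g j) ?w)" if "j \<le> s" for j
    unfolding psd_on_def
  proof (intro conjI ballI allI)
    show "nu_mat \<nu> (g j) ?w a b = nu_mat \<nu> (g j) ?w b a" for a b
      by (rule nu_mat_sym)
    have g: "eval_xy (g j) x y \<ge> 0" if "y \<in> measure_supp \<nu>" for y
      using x that \<open>j \<le> s\<close> \<open>g 0 = 1\<close>
      by (cases "j = 0") (auto simp: set_K_def eval_xy_def poly_eval_1)
    show "0 \<le> (\<Sum>a\<in>nu_mat_index k k (g j). \<Sum>b\<in>nu_mat_index k k (g j). v a * nu_mat \<nu> (g j) ?w a b * v b)" for v
      unfolding nu_mat_property[symmetric] eval_x_eq_riesz[symmetric] eval_integrate_y[OF mom] eval_xy_simps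
    proof (rule integral_nonneg_AE)
      show "AE y in \<nu>. 0 \<le> (eval_xy (\<Sum>a\<in>nu_mat_index k k (g j). const_poly (v a) * mono_poly a) x y)\<^sup>2 * eval_xy (g j) x y"
        using AE_in_measure_supp[OF sets] by eventually_elim (simp add: g)
    qed
  qed
  show "mono_eval 0 (\<lambda>i. x $ i) = 1" by (rule mono_eval_0)
qed

lemma relax_value_le:
  fixes \<nu> :: "(real^'m::finite) measure" and g :: "nat \<Rightarrow> ('n::finite + 'm) rpoly"
  assumes "sets \<nu> = sets borel" "finite_moments \<nu>" "g 0 = 1" "poly_deg f \<le> 2 * k"
  shows "relax_value f I J c s g \<nu> k \<le> sip_value f (set_X I J c \<inter> set_K (measure_supp \<nu>) s g)"
  unfolding sip_value_def relax_value_eq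
proof (rule INF_greatest)
  fix x assume x: "x \<in> set_X I J c \<inter> set_K (measure_supp \<nu>) s g"
  let ?w = "\<lambda>a. mono_eval a (\<lambda>i. x $ i)"
  have "riesz (restrict ?w (monos_upto (2 * k))) f = eval_x f x"
    by (simp add: riesz_restrict[OF keys_subset_monos_upto[OF assms(4)]] eval_x_eq_riesz)
  then show "(INF w\<in>relax_feasible I J c s g \<nu> k. ereal (riesz w f)) \<le> ereal (eval_x f x)"
    using INF_lower[OF point_evaluation_feasible[OF assms(1-3) x, of k]] by metis
qed

section \<open>Lower bound: feasible functionals are eventually nonnegative on the module\<close>

lemma moment_0_pos:
  fixes \<nu> :: "(real^'m::finite) measure"
  assumes "finite_measure \<nu>" "sets \<nu> = sets borel" "y0 \<in> measure_supp \<nu>"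
  shows "moment \<nu> 0 > 0"
proof -
  interpret finite_measure \<nu> by fact
  have "emeasure \<nu> UNIV > 0"
    using assms(3) unfolding measure_supp_def by auto
  then have "measure \<nu> UNIV > 0"
    by (simp add: emeasure_eq_measure)
  then show ?thesis
    using sets_eq_imp_space_eq[OF assms(2)] by (simp add: moment_def mono_eval_0)
qed

lemma ceil_half_le: "((d::nat) + 1) div 2 \<le> d"
  by simp

text \<open>
  A generator is controlled by the constraints of order \<open>k\<close> as soon as \<open>k\<close> exceeds the degrees of its
  factors. A square \<open>q\<^sup>2\<close> is, up to the positive total mass of \<open>\<nu>\<close>, the integral of \<open>q\<^sup>2 g\<^sub>0\<close>, where
  \<open>g\<^sub>0 = 1\<close>.
\<close>

lemma relax_cone_eventually_nonneg:
  fixes \<nu> :: "(real^'m::finite) measure" and g :: "nat \<Rightarrow> ('n::finite + 'm) rpoly"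
  assumes m0: "moment \<nu> 0 > 0" and g0: "g 0 = 1"
    and "p \<in> relax_cone I J c s g \<nu>"
  shows "\<forall>\<^sub>F k in sequentially. \<forall>w\<in>relax_feasible I J c s g \<nu> k. riesz w p \<ge> 0"
proof -
  have int_nonneg: "\<forall>\<^sub>F k in sequentially. \<forall>w\<in>relax_feasible I J c s g \<nu> k. riesz w (integrate_y \<nu> (p\<^sup>2 * g j)) \<ge> 0"
    if j: "j \<le> s" for j p
    using eventually_ge_at_top[of "poly_deg p + deg_x (g j) + deg_y (g j)"]
  proof eventually_elim
    case (elim k)
    let ?B = "nu_mat_index k k (g j)"
    have keys: "Poly_Mapping.keys p \<subseteq> ?B"
    proof
      fix a assume "a \<in> Poly_Mapping.keys p"
      from mono_deg_le_poly_deg[OF this] show "a \<in> ?B"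
        using elim ceil_half_le[of "deg_x (g j)"] ceil_half_le[of "deg_y (g j)"]
        unfolding nu_mat_index_def mono_deg_parts by simp
    qed
    show ?case
    proof
      fix w assume "w \<in> relax_feasible I J c s g \<nu> k"
      with j have "psd_on ?B (nu_mat \<nu> (g j) w)" by (simp add: relax_feasible_def)
      then show "riesz w (integrate_y \<nu> (p\<^sup>2 * g j)) \<ge> 0"
        by (subst mono_poly_combination[OF finite_index_sets(3) keys])
          (simp only: nu_mat_property psd_on_def)
    qed
  qed
  show ?thesis
    using assms(3)
  proof induction
    case (square q)
    have "integrate_y \<nu> ((embed_x q)\<^sup>2 * g 0) = integrate_y \<nu> (embed_x q * (embed_x q * 1))"
      by (simp add: g0 power2_eq_square)
    also have "\<dots> = q * (q * const_poly (moment \<nu> 0))"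
      by (simp only: integrate_y_embed_mult integrate_y_1)
    also have "\<dots> = const_poly (moment \<nu> 0) * q\<^sup>2"
      by (simp only: power2_eq_square ac_simps)
    finally have eq: "riesz w (integrate_y \<nu> ((embed_x q)\<^sup>2 * g 0)) = moment \<nu> 0 * riesz w (q\<^sup>2)" for w
      by (simp only: riesz_const_mult)
    show ?case
      using int_nonneg[of 0 "embed_x q"] m0 by (simp add: eq zero_le_mult_iff)
  next
    case (integral j p)
    then show ?case by (rule int_nonneg)
  next
    case (inequality j q)
    show ?case
      using eventually_ge_at_top[of "poly_deg q + poly_deg (c j)"]
    proof eventually_elim
      case (elim k)
      let ?B = "loc_mat_index k (c j)"
      have keys: "Poly_Mapping.keys q \<subseteq> ?B"
      proof
        fix a assume "a \<in> Poly_Mapping.keys q"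
        from mono_deg_le_poly_deg[OF this] show "a \<in> ?B"
          using elim ceil_half_le[of "poly_deg (c j)"] unfolding loc_mat_index_def by simp
      qed
      show ?case
      proof
        fix w assume "w \<in> relax_feasible I J c s g \<nu> k"
        with inequality have "psd_on ?B (loc_mat (c j) w)" by (simp add: relax_feasible_def)
        then show "riesz w (q\<^sup>2 * c j) \<ge> 0"
          by (subst mono_poly_combination[OF finite_index_sets(2) keys])
            (simp only: loc_mat_property psd_on_def)
      qed
    qed
  next
    case (equation i h)
    show ?case
      using eventually_ge_at_top[of "poly_deg h + poly_deg (c i)"]
    proof eventually_elim
      case (elim k)
      let ?B = "loc_vec_index (2 * k) (c i)"
      have keys: "Poly_Mapping.keys h \<subseteq> ?B"
        using elim mono_deg_le_poly_deg[of _ h] unfolding loc_vec_index_def by fastforce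
      show ?case
      proof
        fix w assume "w \<in> relax_feasible I J c s g \<nu> k"
        with equation have zero: "loc_vec (c i) w a = 0" if "a \<in> ?B" for a
          using that by (simp add: relax_feasible_def)
        have "riesz w (h * c i) = riesz w (c i * (\<Sum>a\<in>?B. const_poly (Poly_Mapping.lookup h a) * mono_poly a))"
          by (subst mono_poly_combination[OF finite_index_sets(1) keys]) (simp only: mult.commute)
        also have "\<dots> = 0"
          by (simp add: loc_vec_property[OF finite_index_sets(1)] zero)
        finally show "riesz w (h * c i) \<ge> 0" by simp
      qed
    qed
  next
    case (add p q)
    from add.IH show ?case
      by eventually_elim (simp add: riesz_add)
  qed
qed

lemma relax_value_eventually_ge:
  fixes \<nu> :: "(real^'m::finite) measure" and g :: "nat \<Rightarrow> ('n::finite + 'm) rpoly"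
  assumes fin: "finite_measure \<nu>" and sets: "sets \<nu> = sets borel" and mom: "finite_moments \<nu>"
    and carl: "carleman \<nu>" and y0: "y0 \<in> measure_supp \<nu>" and g0: "g 0 = 1"
    and arch: "archimedean (QM_nu s g \<nu> + ideal_eq I c + QM_in J c)"
    and r: "ereal r < sip_value f (set_X I J c \<inter> set_K (measure_supp \<nu>) s g)"
  shows "\<forall>\<^sub>F k in sequentially. ereal r \<le> relax_value f I J c s g \<nu> k"
proof -
  have "f - const_poly r \<in> relax_cone I J c s g \<nu>"
  proof (rule archimedean_positivstellensatz[OF quad_module_relax_cone])
    show "archimedean (relax_cone I J c s g \<nu>)"
      using arch sum_modules_subset_relax_cone unfolding archimedean_def by blast
    fix v assume v: "\<forall>p\<in>relax_cone I J c s g \<nu>. poly_eval p v \<ge> 0"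
    define x where "x = (\<chi> i. v i)"
    have ev: "eval_x p x = poly_eval p v" for p
      by (simp add: eval_x_def x_def)
    have "x \<in> set_X I J c \<inter> set_K (measure_supp \<nu>) s g"
      by (rule relax_cone_nonneg_point[OF fin sets mom carl]) (use v in \<open>simp add: ev\<close>)
    then have "sip_value f (set_X I J c \<inter> set_K (measure_supp \<nu>) s g) \<le> ereal (eval_x f x)"
      unfolding sip_value_def by (rule INF_lower)
    with r have "ereal r < ereal (eval_x f x)" by (rule less_le_trans)
    then show "poly_eval (f - const_poly r) v > 0"
      by (simp add: ev poly_eval_diff poly_eval_const)
  qed
  from relax_cone_eventually_nonneg[OF moment_0_pos[OF fin sets y0] g0 this]
  show ?thesis
  proof eventually_elim
    case (elim k)
    show ?case
      unfolding relax_value_eq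
    proof (rule INF_greatest)
      fix w assume w: "w \<in> relax_feasible I J c s g \<nu> k"
      have "riesz w f = riesz w (f - const_poly r) + riesz w (const_poly r)"
        by (simp flip: riesz_add)
      also have "riesz w (const_poly r) = r"
        using w by (simp add: riesz_single relax_feasible_def)
      finally show "ereal r \<le> ereal (riesz w f)"
        using elim w by simp
    qed
  qed
qed

theorem theorem5p2:
  fixes Q :: "(real^'m::finite) set"
    and s :: nat
    and g :: "nat \<Rightarrow> ('n::finite + 'm) rpoly"
    and \<nu> :: "(real^'m) measure"
    and I J :: "'i set"
    and c :: "'i \<Rightarrow> 'n rpoly"
    and f :: "'n rpoly"
  assumes "closed Q" and "Q \<noteq> {}"
    and "g 0 = 1"
    and "sets \<nu> = sets borel" and "finite_measure \<nu>" and "finite_moments \<nu>"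
    and "measure_supp \<nu> = Q"
    and "carleman \<nu>"
    and "finite I" and "finite J" and "I \<inter> J = {}"
    and "archimedean (QM_nu s g \<nu> + ideal_eq I c + QM_in J c)"
  shows "(\<forall>k. poly_deg f \<le> 2 * k \<and> (\<forall>i\<in>I. poly_deg (c i) \<le> 2 * k) \<longrightarrow>
             relax_value f I J c s g \<nu> k \<le> relax_value f I J c s g \<nu> (Suc k))
         \<and> (\<lambda>k. relax_value f I J c s g \<nu> k)
             \<longlonglongrightarrow> sip_value f (set_X I J c \<inter> set_K Q s g)"
proof (intro conjI allI impI)
  fix k assume "poly_deg f \<le> 2 * k \<and> (\<forall>i\<in>I. poly_deg (c i) \<le> 2 * k)"
  then show "relax_value f I J c s g \<nu> k \<le> relax_value f I J c s g \<nu> (Suc k)"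
    by (intro relax_value_mono) simp
next
  obtain y0 where y0: "y0 \<in> measure_supp \<nu>"
    using assms(2,7) by blast
  let ?v = "sip_value f (set_X I J c \<inter> set_K Q s g)"
  show "(\<lambda>k. relax_value f I J c s g \<nu> k) \<longlonglongrightarrow> ?v"
  proof (rule order_tendstoI)
    fix a assume "a < ?v"
    then obtain r where r: "a < ereal r" "ereal r < ?v"
      using ereal_dense2 by blast
    have "\<forall>\<^sub>F k in sequentially. ereal r \<le> relax_value f I J c s g \<nu> k"
      by (rule relax_value_eventually_ge[where g = g, OF assms(5,4,6,8) y0 assms(3,12)])
        (use r assms(7) in simp)
    then show "\<forall>\<^sub>F k in sequentially. a < relax_value f I J c s g \<nu> k"
      by eventually_elim (use r in \<open>auto intro: less_le_trans\<close>)
  next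
    fix a assume a: "?v < a"
    show "\<forall>\<^sub>F k in sequentially. relax_value f I J c s g \<nu> k < a"
      using eventually_ge_at_top[of "poly_deg f"]
    proof eventually_elim
      case (elim k)
      have "relax_value f I J c s g \<nu> k \<le> ?v"
        using relax_value_le[of \<nu> g f k I J c s, OF assms(4,6,3)] elim assms(7) by simp
      with a show ?case by (rule le_less_trans[rotated])
    qed
  qed
qed

end
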